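(* (Ergodic capacity of P1.) Suppose that each destination terminal $\mathcal{D}_m$ ($1\le m\le M$) has perfect knowledge of the mean of the effective channel gain of its link, namely of the deterministic number $\frac{\pi}{4\sqrt{K}}\sum_{k:\,p(k)=m}C^{m,m}_{\mathrm{P1},k}$. Then, for any $\epsilon,\delta>0$ there exist $M_0,K_0>0$ such that for all $M\ge M_0$, $K\ge K_0$ (with $K$ an integer multiple of $M$), the per source-destination terminal pair capacity $C_{\mathrm{P1}}$ achieved by P1 satisfies $$\frac12\log\left(1+\frac{\pi^{2}}{16}\frac{\underline{C}^{2}}{\overline{C}^{2}_{\mathrm{SN}}}\frac{K}{M^3}(1-\epsilon)\right)\le C_{\mathrm{P1}}\le\frac12\log\left(1+\frac{\pi^2}{16}\frac{\overline{C}^{2}}{\underline{C}^{2}_{\mathrm{SN}}}\,\frac{\max\left[K,M^{2+\delta}\right]}{M^3}(1+\epsilon)\right).$$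
   Context: $\log$ is to base 2. Fix constants $0<\underline{E}\le\overline{E}<\infty$, $0<\underline{P}\le\overline{P}<\infty$, $P_{\mathrm{rel}}>0$, $\sigma^2>0$ (independent of $M,K$). For every $M$ and $K$ ($K$ a multiple of $M$) a network with $M$ source-destination pairs and $K$ relays is given, with deterministic coefficients $E_{k,m}\in[\underline{E},\overline{E}]$, $P_{m,k}\in[\underline{P},\overline{P}]$ ($1\le k\le K$, $1\le m\le M$). The channel gains $h_{k,m}$ (source $m$ to relay $k$) and $f_{m,k}$ (relay $k$ to destination $m$) are jointly independent $\mathcal{CN}(0,1)$, and ergodic over time. Put $\tilde h_{k,m}=\exp(j\arg h_{k,m})$, $\tilde f_{m,k}=\exp(j\arg f_{m,k})$. Protocol P1: $p:\{1,\dots,K\}\to\{1,\dots,M\}$ is a relay partitioning function with $|p^{-1}(m)|=K/M$ for each $m$. Let $$d_{\mathrm{P1},k}=\sqrt{P_{\mathrm{rel}}}\Big[\tfrac{K}{M}\sum_{m=1}^M E_{k,m}+K\sigma^2\Big]^{-1/2},\quad C^{m,\hat m}_{\mathrm{P1},k}=\sqrt{K}\,d_{\mathrm{P1},k}\sqrt{P_{m,k}E_{k,\hat m}},\quad C^{m}_{\mathrm{P1},k}=\sqrt{K}\,d_{\mathrm{P1},k}\sqrt{P_{m,k}},$$ $$a_k^{m,\hat m}=C^{m,\hat m}_{\mathrm{P1},k}\,\tilde f^{*}_{p(k),k}\,f_{m,k}\,\tilde h^{*}_{k,p(k)}\,h_{k,\hat m},\qquad b_k^m=C^{m}_{\mathrm{P1},k}\,\tilde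 f^{*}_{p(k),k}\,f_{m,k}\,\tilde h^{*}_{k,p(k)}.$$ Destination $\mathcal{D}_m$ receives $$y_m=s_m\frac{1}{\sqrt K}\sum_{k=1}^K a_k^{m,m}+\sum_{\hat m\ne m}s_{\hat m}\frac1{\sqrt K}\sum_{k=1}^K a_k^{m,\hat m}+\frac1{\sqrt K}\sum_{k=1}^K b_k^m z_k+w_m,$$ where the source signals $s_m\sim\mathcal{CN}(0,1/M)$ and the noise variables $z_k,w_m\sim\mathcal{CN}(0,\sigma^2)$ are jointly independent, independent of the channel gains, and i.i.d. over time. The destinations do not cooperate, and the only channel knowledge assumed at $\mathcal{D}_m$ is the deterministic mean gain named in the claim. The per source-destination terminal pair capacity achieved (induced) by P1, for pair $m$, is $C_{\mathrm{P1}}=\frac12 I(y_m;s_m)$, the factor $\frac12$ accounting for the use of two time slots (two-hop half-duplex relaying); the bounds hold for each $m\in\{1,\dots,M\}$. Constants: $\underline{C}=\sqrt{\underline{P}\,\underline{E}P_{\mathrm{rel}}/(\overline{E}+\sigma^2)}$, $\overline{C}=\sqrt{\overline{P}\,\overline{E}P_{\mathrm{rel}}/(\underline{E}+\sigma^2)}$, $\underline{c}=\sqrt{\underline{P}P_{\mathrm{rel}}/(\overline{E}+\sigma^2)}$, $\overline{c}=\sqrt{\overline{P}P_{\mathrm{rel}}/(\underline{E}+\sigma^2)}$, $\overline{C}_{\mathrm{SN}}=\sqrt{\overline{C}^2+\sigma^2(\overline{c}^2+1)}$, $\underline{C}_{\mathrm{SN}}=\sqrt{\underline{C}^2+\sigma^2(\underline{c}^2+1)}$.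 *)

theory Defs
  imports "HOL-Probability.Probability"
begin

text \<open>
  Circularly symmetric complex Gaussian law: the density below is taken with respect to Lebesgue
  measure on the complex plane, so that \<open>v\<close> is the mean of the squared modulus.
\<close>

definition complex_normal :: "'a measure \<Rightarrow> real \<Rightarrow> ('a \<Rightarrow> complex) \<Rightarrow> bool" where
  "complex_normal \<Omega> v X \<longleftrightarrow>
     distributed \<Omega> lborel X (\<lambda>z. ennreal (exp (- (cmod z)\<^sup>2 / v) / (pi * v)))"

definition ergodic_process :: "'a measure \<Rightarrow> 'b measure \<Rightarrow> (nat \<Rightarrow> 'a \<Rightarrow> 'b) \<Rightarrow> bool" where
  "ergodic_process \<Omega> N G \<longleftrightarrow>
     (\<forall>t. G t \<in> measurable \<Omega> N) \<and>
     (let Q = distr \<Omega> (\<Pi>\<^sub>M t\<in>UNIV. N) (\<lambda>\<omega> t. G t \<omega>);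
          shift = (\<lambda>x t. x (Suc t))
      in distr Q Q shift = Q \<and>
         (\<forall>A\<in>sets Q. shift -` A \<inter> space Q = A \<longrightarrow> measure Q A = 0 \<or> measure Q A = 1))"

text \<open>
  \<open>Src_gain k m\<close> labels the gain from source \<open>m\<close> to relay \<open>k\<close> and \<open>Dst_gain m k\<close> the gain from
  relay \<open>k\<close> to destination \<open>m\<close>.  In a network record, \<open>src_amp k m\<close> and \<open>dst_amp m k\<close> are the
  deterministic coefficients \<open>E\<close> and \<open>P\<close>, and \<open>rv t i\<close> is the value of the random variable \<open>i\<close> in
  the \<open>t\<close>-th use of the two-hop protocol.
\<close>

datatype label =
    Src_gain nat nat
  | Dst_gain nat nat
  | Signal nat
  | Relay_noise nat
  | Dst_noise nat

record 'a network =
  src_amp :: "nat \<Rightarrow> nat \<Rightarrow> real"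
  dst_amp :: "nat \<Rightarrow> nat \<Rightarrow> real"
  partner :: "nat \<Rightarrow> nat"
  prob_sp :: "'a measure"
  rv :: "nat \<Rightarrow> label \<Rightarrow> 'a \<Rightarrow> complex"

definition gain_labels :: "nat \<Rightarrow> nat \<Rightarrow> label set" where
  "gain_labels M K =
     (\<lambda>(k, m). Src_gain k m) ` ({1..K} \<times> {1..M}) \<union> (\<lambda>(m, k). Dst_gain m k) ` ({1..M} \<times> {1..K})"

definition input_labels :: "nat \<Rightarrow> nat \<Rightarrow> label set" where
  "input_labels M K = Signal ` {1..M} \<union> Relay_noise ` {1..K} \<union> Dst_noise ` {1..M}"

definition relay_partition :: "nat \<Rightarrow> nat \<Rightarrow> (nat \<Rightarrow> nat) \<Rightarrow> bool" where
  "relay_partition M K p \<longleftrightarrow>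
     p ` {1..K} \<subseteq> {1..M} \<and> (\<forall>m\<in>{1..M}. card {k\<in>{1..K}. p k = m} = K div M)"

definition random_model :: "nat \<Rightarrow> nat \<Rightarrow> real \<Rightarrow> 'a measure \<Rightarrow> (nat \<Rightarrow> label \<Rightarrow> 'a \<Rightarrow> complex) \<Rightarrow> bool" where
  "random_model M K \<sigma>2 \<Omega> X \<longleftrightarrow>
     prob_space \<Omega> \<and>
     (\<forall>t. \<forall>i\<in>gain_labels M K. complex_normal \<Omega> 1 (X t i)) \<and>
     (\<forall>t. \<forall>m\<in>{1..M}. complex_normal \<Omega> (1 / real M) (X t (Signal m))) \<and>
     (\<forall>t. \<forall>k\<in>{1..K}. complex_normal \<Omega> \<sigma>2 (X t (Relay_noise k))) \<and>
     (\<forall>t. \<forall>m\<in>{1..M}. complex_normal \<Omega> \<sigma>2 (X t (Dst_noise m))) \<and>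
     (\<forall>t. prob_space.indep_vars \<Omega> (\<lambda>_. borel) (X t) (gain_labels M K)) \<and>
     ergodic_process \<Omega> (\<Pi>\<^sub>M i\<in>gain_labels M K. borel) (\<lambda>t \<omega>. \<lambda>i\<in>gain_labels M K. X t i \<omega>) \<and>
     prob_space.indep_vars \<Omega> (\<lambda>_. borel) (\<lambda>(t, i). X t i) (UNIV \<times> input_labels M K) \<and>
     prob_space.indep_var \<Omega>
       (\<Pi>\<^sub>M _\<in>UNIV \<times> gain_labels M K. borel) (\<lambda>\<omega>. \<lambda>(t, i)\<in>UNIV \<times> gain_labels M K. X t i \<omega>)
       (\<Pi>\<^sub>M _\<in>UNIV \<times> input_labels M K. borel) (\<lambda>\<omega>. \<lambda>(t, i)\<in>UNIV \<times> input_labels M K. X t i \<omega>)"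

definition p1_network ::
    "nat \<Rightarrow> nat \<Rightarrow> real \<Rightarrow> real \<Rightarrow> real \<Rightarrow> real \<Rightarrow> real \<Rightarrow> 'a network \<Rightarrow> bool" where
  "p1_network M K E_lo E_hi P_lo P_hi \<sigma>2 N \<longleftrightarrow>
     (\<forall>k\<in>{1..K}. \<forall>m\<in>{1..M}. src_amp N k m \<in> {E_lo..E_hi}) \<and>
     (\<forall>k\<in>{1..K}. \<forall>m\<in>{1..M}. dst_amp N m k \<in> {P_lo..P_hi}) \<and>
     relay_partition M K (partner N) \<and>
     random_model M K \<sigma>2 (prob_sp N) (rv N)"

definition phase :: "complex \<Rightarrow> complex" where
  "phase z = exp (\<i> * complex_of_real (Arg z))"

definition d_P1 :: "nat \<Rightarrow> nat \<Rightarrow> real \<Rightarrow> real \<Rightarrow> 'a network \<Rightarrow> nat \<Rightarrow> real" where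
  "d_P1 M K P_rel \<sigma>2 N k =
     sqrt P_rel *
     (real K / real M * (\<Sum>m=1..M. src_amp N k m) + real K * \<sigma>2) powr (- 1 / 2)"

definition C2_P1 :: "nat \<Rightarrow> nat \<Rightarrow> real \<Rightarrow> real \<Rightarrow> 'a network \<Rightarrow> nat \<Rightarrow> nat \<Rightarrow> nat \<Rightarrow> real" where
  "C2_P1 M K P_rel \<sigma>2 N m m' k =
     sqrt (real K) * d_P1 M K P_rel \<sigma>2 N k * sqrt (dst_amp N m k * src_amp N k m')"

definition C1_P1 :: "nat \<Rightarrow> nat \<Rightarrow> real \<Rightarrow> real \<Rightarrow> 'a network \<Rightarrow> nat \<Rightarrow> nat \<Rightarrow> real" where
  "C1_P1 M K P_rel \<sigma>2 N m k =
     sqrt (real K) * d_P1 M K P_rel \<sigma>2 N k * sqrt (dst_amp N m k)"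

definition a_coeff ::
    "nat \<Rightarrow> nat \<Rightarrow> real \<Rightarrow> real \<Rightarrow> 'a network \<Rightarrow> nat \<Rightarrow> nat \<Rightarrow> nat \<Rightarrow> nat \<Rightarrow> 'a \<Rightarrow> complex" where
  "a_coeff M K P_rel \<sigma>2 N t m m' k \<omega> =
     complex_of_real (C2_P1 M K P_rel \<sigma>2 N m m' k) *
     cnj (phase (rv N t (Dst_gain (partner N k) k) \<omega>)) * rv N t (Dst_gain m k) \<omega> *
     cnj (phase (rv N t (Src_gain k (partner N k)) \<omega>)) * rv N t (Src_gain k m') \<omega>"

definition b_coeff ::
    "nat \<Rightarrow> nat \<Rightarrow> real \<Rightarrow> real \<Rightarrow> 'a network \<Rightarrow> nat \<Rightarrow> nat \<Rightarrow> nat \<Rightarrow> 'a \<Rightarrow> complex" where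
  "b_coeff M K P_rel \<sigma>2 N t m k \<omega> =
     complex_of_real (C1_P1 M K P_rel \<sigma>2 N m k) *
     cnj (phase (rv N t (Dst_gain (partner N k) k) \<omega>)) * rv N t (Dst_gain m k) \<omega> *
     cnj (phase (rv N t (Src_gain k (partner N k)) \<omega>))"

definition received ::
    "nat \<Rightarrow> nat \<Rightarrow> real \<Rightarrow> real \<Rightarrow> 'a network \<Rightarrow> nat \<Rightarrow> nat \<Rightarrow> 'a \<Rightarrow> complex" where
  "received M K P_rel \<sigma>2 N t m \<omega> =
     rv N t (Signal m) \<omega> *
       (complex_of_real (1 / sqrt (real K)) * (\<Sum>k=1..K. a_coeff M K P_rel \<sigma>2 N t m m k \<omega>)) +
     (\<Sum>m'\<in>{1..M} - {m}. rv N t (Signal m') \<omega> *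
       (complex_of_real (1 / sqrt (real K)) * (\<Sum>k=1..K. a_coeff M K P_rel \<sigma>2 N t m m' k \<omega>))) +
     complex_of_real (1 / sqrt (real K)) *
       (\<Sum>k=1..K. b_coeff M K P_rel \<sigma>2 N t m k \<omega> * rv N t (Relay_noise k) \<omega>) +
     rv N t (Dst_noise m) \<omega>"

definition mean_gain :: "nat \<Rightarrow> nat \<Rightarrow> real \<Rightarrow> real \<Rightarrow> 'a network \<Rightarrow> nat \<Rightarrow> real" where
  "mean_gain M K P_rel \<sigma>2 N m =
     pi / (4 * sqrt (real K)) * (\<Sum>k | k \<in> {1..K} \<and> partner N k = m. C2_P1 M K P_rel \<sigma>2 N m m k)"

text \<open>
  The only channel knowledge at destination \<open>m\<close> is the number \<open>mean_gain\<close>.  It is deterministic, so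
  the mutual information is not conditioned on any gain: the gains are part of the randomness of
  \<open>received\<close>.  Lemma \<open>mutual_information_known_constant\<close> below states that letting the destination
  observe such a number together with the received signal leaves the mutual information unchanged.
  The factor one half accounts for the two time slots of each use of the protocol.
\<close>

definition capacity_P1 ::
    "nat \<Rightarrow> nat \<Rightarrow> real \<Rightarrow> real \<Rightarrow> 'a network \<Rightarrow> nat \<Rightarrow> nat \<Rightarrow> real" where
  "capacity_P1 M K P_rel \<sigma>2 N t m =
     1 / 2 * prob_space.mutual_information (prob_sp N) 2 borel borel
               (received M K P_rel \<sigma>2 N t m) (rv N t (Signal m))"

lemma (in prob_space) mutual_information_known_constant:
  fixes X Y :: "'a \<Rightarrow> complex" and c :: real
  assumes [measurable]: "random_variable borel X" "random_variable borel Y"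
    and ac: "absolutely_continuous (distr M borel X \<Otimes>\<^sub>M distr M borel Y)
               (distr M (borel \<Otimes>\<^sub>M borel) (\<lambda>\<omega>. (X \<omega>, Y \<omega>)))"
  shows "mutual_information b (borel \<Otimes>\<^sub>M borel) borel (\<lambda>\<omega>. (X \<omega>, c)) Y
       = mutual_information b borel borel X Y"
proof -
  define P where "P = distr M borel X \<Otimes>\<^sub>M distr M borel Y"
  define Q where "Q = distr M (borel \<Otimes>\<^sub>M borel) (\<lambda>\<omega>. (X \<omega>, Y \<omega>))"
  define B :: "((complex \<times> real) \<times> complex) measure" where "B = (borel \<Otimes>\<^sub>M borel) \<Otimes>\<^sub>M borel"
  define \<phi> where "\<phi> = (\<lambda>(x::complex, y::complex). ((x, c), y))"
  define \<psi> where "\<psi> = (\<lambda>z::(complex \<times> real) \<times> complex. (fst (fst z), snd z))"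
  interpret X: prob_space "distr M borel X" by (rule prob_space_distr) simp
  interpret Y: prob_space "distr M borel Y" by (rule prob_space_distr) simp
  interpret XY: pair_prob_space "distr M borel X" "distr M borel Y" ..
  interpret P: prob_space P unfolding P_def by (rule XY.prob_space_axioms)
  have setsP: "sets P = sets (borel \<Otimes>\<^sub>M borel)" unfolding P_def by (auto intro!: sets_pair_measure_cong)
  have setsQ: "sets Q = sets (borel \<Otimes>\<^sub>M borel)" unfolding Q_def by simp
  have phi0 [measurable]: "\<phi> \<in> measurable (borel \<Otimes>\<^sub>M borel) B" unfolding \<phi>_def B_def by measurable
  have psi0 [measurable]: "\<psi> \<in> measurable B (borel \<Otimes>\<^sub>M borel)" unfolding \<psi>_def B_def by measurable
  have phiP: "\<phi> \<in> measurable P B" using phi0 setsP by (simp cong: measurable_cong_sets)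
  have phiQ: "\<phi> \<in> measurable Q B" using phi0 setsQ by (simp cong: measurable_cong_sets)
  have psiP: "\<psi> \<in> measurable B P" using psi0 setsP by (simp cong: measurable_cong_sets)
  have Q': "distr M B (\<lambda>\<omega>. ((X \<omega>, c), Y \<omega>)) = distr Q B \<phi>"
    unfolding Q_def by (subst distr_distr[OF phi0]) (auto simp: \<phi>_def comp_def)
  have dX: "distr M (borel \<Otimes>\<^sub>M borel) (\<lambda>\<omega>. (X \<omega>, c))
      = distr (distr M borel X) (borel \<Otimes>\<^sub>M borel) (\<lambda>x. (x, c))"
    by (subst distr_distr) (auto simp: comp_def)
  have P': "distr M (borel \<Otimes>\<^sub>M borel) (\<lambda>\<omega>. (X \<omega>, c)) \<Otimes>\<^sub>M distr M borel Y = distr P B \<phi>"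
  proof -
    have "distr (distr M borel X) (borel \<Otimes>\<^sub>M borel) (\<lambda>x. (x, c)) \<Otimes>\<^sub>M
          distr (distr M borel Y) borel (\<lambda>y. y)
        = distr P B (\<lambda>(x, y). ((x, c), y))"
      unfolding P_def B_def
      by (rule pair_measure_distr)
        (auto intro!: prob_space_imp_sigma_finite prob_space.prob_space_distr Y.prob_space_axioms)
    moreover have "distr (distr M borel Y) borel (\<lambda>y. y) = distr M borel Y"
      by (subst distr_distr) (auto simp: comp_def)
    ultimately show ?thesis unfolding dX \<phi>_def by simp
  qed
  have ac': "absolutely_continuous (distr P B \<phi>) (distr Q B \<phi>)"
    unfolding absolutely_continuous_def
  proof
    fix A assume "A \<in> null_sets (distr P B \<phi>)"
    then have A: "A \<in> sets B" "emeasure P (\<phi> -` A \<inter> space P) = 0"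
      using phiP by (auto simp: null_sets_def emeasure_distr)
    then have "\<phi> -` A \<inter> space P \<in> null_sets P"
      using phiP by (auto simp: null_sets_def intro: measurable_sets)
    then have "\<phi> -` A \<inter> space P \<in> null_sets Q"
      using ac unfolding absolutely_continuous_def P_def Q_def by auto
    then show "A \<in> null_sets (distr Q B \<phi>)"
      using A phiQ sets_eq_imp_space_eq[OF setsP] sets_eq_imp_space_eq[OF setsQ]
      by (auto simp: null_sets_def emeasure_distr)
  qed
  have "AE x in P. RN_deriv (distr P B \<phi>) (distr Q B \<phi>) (\<phi> x) = RN_deriv P Q x"
    by (rule P.RN_deriv_distr[OF phiP psiP _ ac']) (auto simp: \<phi>_def \<psi>_def setsP setsQ)
  moreover have "absolutely_continuous P Q" using ac unfolding P_def Q_def .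
  ultimately have *: "AE x in Q. RN_deriv (distr P B \<phi>) (distr Q B \<phi>) (\<phi> x) = RN_deriv P Q x"
    using absolutely_continuous_AE[of Q P] setsP setsQ by simp
  have m: "entropy_density b (distr P B \<phi>) (distr Q B \<phi>) \<in> borel_measurable B"
    using measurable_entropy_density[of b "distr P B \<phi>" "distr Q B \<phi>"] by simp
  have m0: "entropy_density b P Q \<in> borel_measurable Q"
    using measurable_entropy_density[of b P Q] setsP setsQ by (simp cong: measurable_cong_sets)
  have "KL_divergence b (distr P B \<phi>) (distr Q B \<phi>)
      = (\<integral>x. entropy_density b (distr P B \<phi>) (distr Q B \<phi>) (\<phi> x) \<partial>Q)"
    unfolding KL_divergence_def by (rule integral_distr[OF phiQ m])
  also have "\<dots> = KL_divergence b P Q"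
    unfolding KL_divergence_def
  proof (rule integral_cong_AE)
    show "(\<lambda>x. entropy_density b (distr P B \<phi>) (distr Q B \<phi>) (\<phi> x)) \<in> borel_measurable Q"
      by (rule measurable_compose[OF phiQ m])
    show "entropy_density b P Q \<in> borel_measurable Q" by (rule m0)
    show "AE x in Q. entropy_density b (distr P B \<phi>) (distr Q B \<phi>) (\<phi> x) = entropy_density b P Q x"
      using * by eventually_elim (simp add: entropy_density_def)
  qed
  finally show ?thesis
    unfolding mutual_information_def P'
    by (simp add: P_def[symmetric] Q_def[symmetric] B_def[symmetric] Q')
qed

end

theory Submission
  imports Defs
begin

text \<open>
  Conditionally on all channel gains the received signal is \<open>A s + n\<close>, where \<open>n\<close> is complex normal
  of variance \<open>D\<close> and the effective gain \<open>A\<close> and noise power \<open>D\<close> are independent of the input \<open>s\<close>.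
  Both bounds are instances of Gibbs' inequality for the joint law of gains, output and input.

  For the lower bound, the posterior of \<open>s\<close> is compared with a normal law centred at the linear
  minimum mean square estimate of \<open>s\<close>. The resulting signal-to-noise ratio involves only \<open>E A\<close>,
  \<open>E \<bar>A\<bar>\<^sup>2\<close> and \<open>E D\<close>, so that no asymptotics is needed.

  For the upper bound, the conditional law of the output is a mixture over the gains, and convexity
  gives \<open>I \<le> log V - E (log D)\<close>, where \<open>V\<close> is the output power. As \<open>D \<ge> \<sigma>\<^sup>2\<close>, the gap
  \<open>log (E D) - E (log D)\<close> is at most \<open>Var D / \<sigma>\<^sup>4\<close>. Up to independent terms, \<open>D\<close> is the squared norm
  of a sum of \<open>K\<close> independent centred random vectors, one for each relay, divided by \<open>M K\<close>, and
  therefore \<open>Var D = O (1 / M)\<close>. This is absorbed by \<open>\<epsilon>\<close>, since the maximum with \<open>M\<close> to the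
  power \<open>2 + \<delta>\<close> keeps the signal-to-noise ratio in the claim above a multiple of \<open>M\<close> to the power
  \<open>\<delta> - 1\<close>.
\<close>

section \<open>Complex normal variables\<close>

text \<open>The destination sees no realisation of the gains, so the output given the input follows
  a mixture over all gains and the mutual information has no closed form; only expected logarithms
  can be compared. In the upper bound Jensen's inequality for \<open>D\<close> points the wrong way.
  Order 1/M for the variance of \<open>D\<close>, rather than a constant, is the main difficulty:
  the M - 1 interference powers share the gains towards the destination, and it is the cancellation
  of phases in products of two coefficients of one relay that leaves their cross terms uncorrelated.
  The factor pi^2/16 is the square of pi/4 = (sqrt pi / 2)^2: a standard complex normal variable has
  mean modulus sqrt pi / 2, and each coherent relay contributes two such moduli. In the lower bound
  \<open>CSN_hi\<close> comes out exactly: M - 1 interferers of power 1/M leave a share 1/M free,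
  and the variance of the effective gain, counted as noise, fills it. The upper bound counts that
  variance as signal, which costs a further 1/M inside the logarithm and is absorbed in the same
  way.\<close>

definition cgauss :: "real \<Rightarrow> complex \<Rightarrow> real" where
  "cgauss v z = exp (- (cmod z)\<^sup>2 / v) / (pi * v)"

lemma cgauss_measurable [measurable]:
  assumes [measurable]: "v \<in> borel_measurable M" "f \<in> borel_measurable M"
  shows "(\<lambda>x. cgauss (v x) (f x)) \<in> borel_measurable M"
  unfolding cgauss_def by measurable

lemma cgauss_pos: "0 < v \<Longrightarrow> 0 < cgauss v z"
  by (simp add: cgauss_def)

lemma cgauss_minus: "cgauss v (- z) = cgauss v z"
  by (simp add: cgauss_def)

lemma cgauss_le: "0 < v \<Longrightarrow> cgauss v z \<le> 1 / (pi * v)"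
  by (simp add: cgauss_def divide_right_mono)

lemma ln_cgauss: "0 < v \<Longrightarrow> ln (cgauss v z) = - ln (pi * v) - (cmod z)\<^sup>2 / v"
  by (simp add: cgauss_def ln_div)

section \<open>Radial integration and moments of the complex normal law\<close>

text \<open>Polar coordinates without a Jacobian: the image measure is determined by the areas pi
  r^2 of discs, whose derivative is the density 2 pi r. The half-lines form an intersection-stable
  generator, and those ending at natural numbers exhaust the line with finite measure.\<close>

lemma distr_cmod_lborel:
  "distr lborel borel cmod = density lborel (\<lambda>r. ennreal (2 * pi * r) * indicator {0..} r)"
proof (rule measure_eqI_generator_eq[where E="range atMost" and \<Omega>=UNIV and A="\<lambda>n. {..real n}"])
  show "Int_stable (range (atMost :: real \<Rightarrow> real set))"
    by (auto simp: Int_stable_def)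
  have e1: "emeasure (distr lborel borel cmod) {..r} = ennreal (if r < 0 then 0 else pi * r\<^sup>2)" for r
  proof -
    have "emeasure (distr lborel borel cmod) {..r} = emeasure lborel (cball (0::complex) r)"
      by (subst emeasure_distr) (auto simp: cball_def dist_norm intro!: arg_cong[where f="emeasure lborel"])
    also have "\<dots> = ennreal (if r < 0 then 0 else pi * r\<^sup>2)"
      by (auto simp: emeasure_cball unit_ball_vol_2)
    finally show ?thesis .
  qed
  have e2: "emeasure (density lborel (\<lambda>r. ennreal (2 * pi * r) * indicator {0..} r)) {..r}
      = ennreal (if r < 0 then 0 else pi * r\<^sup>2)" for r
  proof (cases "r < 0")
    case True
    then have "(\<lambda>x. ennreal (2 * pi * x) * indicator {0..} x * indicator {..r} x) = (\<lambda>x. 0)"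
      by (auto simp: fun_eq_iff split: split_indicator)
    then show ?thesis using True by (simp add: emeasure_density)
  next
    case False
    have "emeasure (density lborel (\<lambda>r. ennreal (2 * pi * r) * indicator {0..} r)) {..r}
        = (\<integral>\<^sup>+x. ennreal (2 * pi * x) * indicator {0..r} x \<partial>lborel)"
      by (subst emeasure_density) (auto intro!: nn_integral_cong split: split_indicator)
    also have "\<dots> = ennreal (pi * r\<^sup>2 - pi * 0\<^sup>2)"
      using False by (intro nn_integral_FTC_Icc) (auto intro!: derivative_eq_intros)
    finally show ?thesis using False by simp
  qed
  show "emeasure (distr lborel borel cmod) X
      = emeasure (density lborel (\<lambda>r. ennreal (2 * pi * r) * indicator {0..} r)) X"
    if "X \<in> range atMost" for X
    using that e1 e2 by auto
  show "(\<Union>i. {..real i}) = UNIV" by (auto simp: real_arch_simple)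
  show "emeasure (distr lborel borel cmod) {..real i} \<noteq> \<infinity>" for i
    unfolding e1 by simp
qed (auto simp: borel_eq_atMost[where 'a=real])

lemma nn_integral_cmod:
  assumes [measurable]: "h \<in> borel_measurable borel"
  shows "(\<integral>\<^sup>+z. h (cmod z) \<partial>lborel) = (\<integral>\<^sup>+r. ennreal (2 * pi * r) * indicator {0..} r * h r \<partial>lborel)"
proof -
  have "(\<integral>\<^sup>+z. h (cmod z) \<partial>lborel) = (\<integral>\<^sup>+r. h r \<partial>distr lborel borel cmod)"
    by (subst nn_integral_distr) auto
  also have "\<dots> = (\<integral>\<^sup>+r. ennreal (2 * pi * r) * indicator {0..} r * h r \<partial>lborel)"
    unfolding distr_cmod_lborel by (subst nn_integral_density) auto
  finally show ?thesis .
qed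

text \<open>The substitution r = sqrt v * x reduces the radial integral to a half-line Gaussian
  moment. The exponent is n + 1 because the radial density contributes one more factor r.\<close>

lemma nn_integral_cgauss_moment:
  assumes v: "0 < v"
    and c: "has_bochner_integral lborel (\<lambda>x::real. indicator {0..} x *\<^sub>R (exp (- x\<^sup>2) * x ^ (n + 1))) c"
  shows "(\<integral>\<^sup>+z. ennreal (cmod z ^ n * cgauss v z) \<partial>lborel) = ennreal (2 * sqrt v ^ n * c)"
proof -
  define u where "u = sqrt v"
  have u: "0 < u" "v = u\<^sup>2" using v by (auto simp: u_def)
  have "(\<integral>\<^sup>+z. ennreal (cmod z ^ n * cgauss v z) \<partial>lborel)
      = (\<integral>\<^sup>+r. ennreal (2 * pi * r) * indicator {0..} r * ennreal (r ^ n * (exp (- r\<^sup>2 / v) / (pi * v))) \<partial>lborel)"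
    unfolding cgauss_def by (rule nn_integral_cmod) simp
  also have "\<dots> = ennreal \<bar>u\<bar> * (\<integral>\<^sup>+x. ennreal (2 * pi * (0 + u * x)) * indicator {0..} (0 + u * x) *
      ennreal ((0 + u * x) ^ n * (exp (- (0 + u * x)\<^sup>2 / v) / (pi * v))) \<partial>lborel)"
    using u by (intro nn_integral_real_affine) auto
  also have "\<dots> = ennreal u * (\<integral>\<^sup>+x. ennreal (2 * u ^ n / u) * ennreal (indicator {0..} x *\<^sub>R (exp (- x\<^sup>2) * x ^ (n + 1))) \<partial>lborel)"
  proof -
    have "ennreal (2 * pi * (0 + u * x)) * indicator {0..} (0 + u * x) *
        ennreal ((0 + u * x) ^ n * (exp (- (0 + u * x)\<^sup>2 / v) / (pi * v)))
      = ennreal (2 * u ^ n / u) * ennreal (indicator {0..} x *\<^sub>R (exp (- x\<^sup>2) * x ^ (n + 1)))" for x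
    proof (cases "0 \<le> x")
      case True
      have "2 * pi * (u * x) * ((u * x) ^ n * (exp (- (u * x)\<^sup>2 / v) / (pi * v)))
          = 2 * u ^ n / u * (exp (- x\<^sup>2) * x ^ (n + 1))"
        using u by (simp add: power_mult_distrib) (simp add: field_simps power2_eq_square)
      then show ?thesis
        using True u by (simp add: ennreal_mult[symmetric])
    next
      case False
      then show ?thesis using u by (simp add: zero_le_mult_iff)
    qed
    then show ?thesis using u by (simp only: abs_of_pos)
  qed
  also have "\<dots> = ennreal u * (ennreal (2 * u ^ n / u) * ennreal c)"
  proof (subst nn_integral_cmult)
    show "ennreal u * (ennreal (2 * u ^ n / u) * (\<integral>\<^sup>+x. ennreal (indicator {0..} x *\<^sub>R (exp (- x\<^sup>2) * x ^ (n + 1))) \<partial>lborel))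
      = ennreal u * (ennreal (2 * u ^ n / u) * ennreal c)"
      using has_bochner_integral_integral_eq[OF c]
      by (subst nn_integral_eq_integral[OF integrable.intros[OF c]])
        (auto split: split_indicator)
  qed auto
  also have "\<dots> = ennreal (2 * sqrt v ^ n * c)"
  proof -
    have "0 \<le> c"
      unfolding has_bochner_integral_integral_eq[OF c, symmetric]
      by (rule Bochner_Integration.integral_nonneg) (simp split: split_indicator)
    then show ?thesis using u unfolding u_def[symmetric] by (simp add: ennreal_mult[symmetric])
  qed
  finally show ?thesis .
qed

text \<open>The first moment is the source of pi/4 in the mean gain, the second gives all powers,
  and the fourth enters the variance of the noise power.\<close>

lemma nn_integral_cgauss_moments:
  assumes v: "0 < v"
  shows nn_integral_cgauss: "(\<integral>\<^sup>+z. ennreal (cgauss v z) \<partial>lborel) = 1"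
    and nn_integral_cmod_cgauss: "(\<integral>\<^sup>+z. ennreal (cmod z * cgauss v z) \<partial>lborel) = ennreal (sqrt (pi * v) / 2)"
    and nn_integral_cmod2_cgauss: "(\<integral>\<^sup>+z. ennreal ((cmod z)\<^sup>2 * cgauss v z) \<partial>lborel) = ennreal v"
    and nn_integral_cmod4_cgauss: "(\<integral>\<^sup>+z. ennreal (cmod z ^ 4 * cgauss v z) \<partial>lborel) = ennreal (2 * v\<^sup>2)"
proof -
  have s4: "sqrt v ^ 4 = v\<^sup>2"
    using v power_mult[of "sqrt v" 2 2] by simp
  note m = nn_integral_cgauss_moment[OF v]
  show "(\<integral>\<^sup>+z. ennreal (cgauss v z) \<partial>lborel) = 1"
    using m[of 0 "1/2"] gaussian_moment_odd_pos[of 0] by simp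
  show "(\<integral>\<^sup>+z. ennreal (cmod z * cgauss v z) \<partial>lborel) = ennreal (sqrt (pi * v) / 2)"
    using m[of 1 "sqrt pi / 4"] gaussian_moment_even_pos[of 1]
    by (simp add: fact_numeral real_sqrt_mult mult_ac numeral_eq_Suc)
  show "(\<integral>\<^sup>+z. ennreal ((cmod z)\<^sup>2 * cgauss v z) \<partial>lborel) = ennreal v"
    using m[of 2 "1/2"] gaussian_moment_odd_pos[of 1] v by simp
  show "(\<integral>\<^sup>+z. ennreal (cmod z ^ 4 * cgauss v z) \<partial>lborel) = ennreal (2 * v\<^sup>2)"
    using m[of 4 1] gaussian_moment_odd_pos[of 2] v s4 by simp
qed

lemma nn_integral_complex_shift:
  fixes f :: "complex \<Rightarrow> ennreal"
  assumes [measurable]: "f \<in> borel_measurable borel"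
  shows "(\<integral>\<^sup>+x. f (t + x) \<partial>lborel) = (\<integral>\<^sup>+x. f x \<partial>lborel)"
    and "(\<integral>\<^sup>+x. f (x - t) \<partial>lborel) = (\<integral>\<^sup>+x. f x \<partial>lborel)"
    and "(\<integral>\<^sup>+x. f (t - x) \<partial>lborel) = (\<integral>\<^sup>+x. f x \<partial>lborel)"
proof -
  have *: "(\<integral>\<^sup>+x. f (s + c *\<^sub>R x) \<partial>lborel) = (\<integral>\<^sup>+x. f x \<partial>lborel)" if "\<bar>c\<bar> = 1" for s and c :: real
  proof -
    have "(\<integral>\<^sup>+x. f x \<partial>lborel) = (\<integral>\<^sup>+x. f x \<partial>distr lborel borel (\<lambda>x. s + c *\<^sub>R x))"
      using that by (subst lborel_affine[of c s]) (auto simp: density_1)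
    then show ?thesis by (simp add: nn_integral_distr)
  qed
  show "(\<integral>\<^sup>+x. f (t + x) \<partial>lborel) = (\<integral>\<^sup>+x. f x \<partial>lborel)"
    and "(\<integral>\<^sup>+x. f (x - t) \<partial>lborel) = (\<integral>\<^sup>+x. f x \<partial>lborel)"
    and "(\<integral>\<^sup>+x. f (t - x) \<partial>lborel) = (\<integral>\<^sup>+x. f x \<partial>lborel)"
    using *[of 1 t] *[of 1 "- t"] *[of "-1" t] by simp_all
qed

section \<open>Products and convolutions of normal densities\<close>

text \<open>Completing the square. Read as Bayes' rule, prior times likelihood equals marginal times
  posterior: \<open>s\<close> is the variance of the output \<open>z\<close>, and the last factor is
  centred at the linear estimate of \<open>x\<close> from \<open>z\<close> with error variance
  \<open>u * v / s\<close>.\<close>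

lemma cgauss_mult_shift:
  fixes \<alpha> x z :: complex and u v :: real
  assumes u: "0 < u" and v: "0 < v"
  defines "s \<equiv> u + (cmod \<alpha>)\<^sup>2 * v"
  shows "cgauss v x * cgauss u (z - \<alpha> * x)
    = cgauss s z * cgauss (u * v / s) (x - of_real (v / s) * cnj \<alpha> * z)"
proof -
  have s: "0 < s" using u v by (simp add: s_def add_pos_nonneg)
  have *: "(cmod x)\<^sup>2 / v + (cmod (z - \<alpha> * x))\<^sup>2 / u
      = (cmod z)\<^sup>2 / s + (cmod (x - of_real (v / s) * cnj \<alpha> * z))\<^sup>2 / (u * v / s)"
  proof -
    have h: "(cmod (x - of_real (v / s) * cnj \<alpha> * z))\<^sup>2 / (u * v / s)
       = (cmod (of_real s * x - of_real v * cnj \<alpha> * z))\<^sup>2 / (u * v * s)"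
    proof -
      have "of_real s * x - of_real v * cnj \<alpha> * z = of_real s * (x - of_real (v / s) * cnj \<alpha> * z)"
        using s by (simp add: field_simps)
      then have "(cmod (of_real s * x - of_real v * cnj \<alpha> * z))\<^sup>2
          = s\<^sup>2 * (cmod (x - of_real (v / s) * cnj \<alpha> * z))\<^sup>2"
        by (simp only: norm_mult power_mult_distrib) simp
      then show ?thesis using s by (simp only:) (simp add: power2_eq_square)
    qed
    \<comment> \<open>After clearing denominators the identity of exponents is polynomial in real
      and imaginary parts.\<close>
    have "s * u * (cmod x)\<^sup>2 + s * v * (cmod (z - \<alpha> * x))\<^sup>2
        = u * v * (cmod z)\<^sup>2 + (cmod (of_real s * x - of_real v * cnj \<alpha> * z))\<^sup>2"
      unfolding cmod_power2 s_def by simp algebra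
    then have "(s * u * (cmod x)\<^sup>2 + s * v * (cmod (z - \<alpha> * x))\<^sup>2) / (u * v * s)
        = (u * v * (cmod z)\<^sup>2 + (cmod (of_real s * x - of_real v * cnj \<alpha> * z))\<^sup>2) / (u * v * s)"
      by simp
    then show ?thesis unfolding h using u v s by (simp add: add_divide_distrib)
  qed
  show ?thesis
    unfolding cgauss_def using * u v s
    by (simp add: exp_add[symmetric] algebra_simps flip: minus_divide_left)
qed

lemma nn_integral_cgauss_convolution:
  assumes u: "0 < u" and v: "0 < v"
  shows "(\<integral>\<^sup>+x. ennreal (cgauss v x) * ennreal (cgauss u (z - \<alpha> * x)) \<partial>lborel)
    = ennreal (cgauss (u + (cmod \<alpha>)\<^sup>2 * v) z)"
proof -
  define s where "s = u + (cmod \<alpha>)\<^sup>2 * v"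
  have s: "0 < s" using u v by (simp add: s_def add_pos_nonneg)
  have "(\<integral>\<^sup>+x. ennreal (cgauss v x) * ennreal (cgauss u (z - \<alpha> * x)) \<partial>lborel)
     = (\<integral>\<^sup>+x. ennreal (cgauss s z) * ennreal (cgauss (u * v / s) (x - of_real (v / s) * cnj \<alpha> * z)) \<partial>lborel)"
    using cgauss_mult_shift[OF u v, of x z \<alpha> for x] u v s
    by (intro nn_integral_cong) (simp add: ennreal_mult[symmetric] less_imp_le[OF cgauss_pos] s_def[symmetric])
  also have "\<dots> = ennreal (cgauss s z)"
    using nn_integral_complex_shift(2)[of "\<lambda>x. ennreal (cgauss (u * v / s) x)" "of_real (v / s) * cnj \<alpha> * z"]
      nn_integral_cgauss[of "u * v / s"] u v s
    by (simp add: nn_integral_cmult)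
  finally show ?thesis by (simp add: s_def)
qed

section \<open>Complex normal random variables\<close>

lemma complex_normalD:
  assumes "complex_normal M v X"
  shows complex_normal_measurable: "X \<in> borel_measurable M"
    and complex_normal_distributed: "distributed M lborel X (\<lambda>z. ennreal (cgauss v z))"
    and complex_normal_distr: "distr M borel X = density lborel (\<lambda>z. ennreal (cgauss v z))"
proof -
  show *: "distributed M lborel X (\<lambda>z. ennreal (cgauss v z))"
    using assms unfolding complex_normal_def cgauss_def .
  then show "X \<in> borel_measurable M"
    by (simp add: distributed_def)
  show "distr M borel X = density lborel (\<lambda>z. ennreal (cgauss v z))"
    using distributed_distr_eq_density[OF *] by (simp cong: distr_cong)
qed

lemma complex_normalI:
  assumes "X \<in> borel_measurable M" "distr M borel X = density lborel (\<lambda>z. ennreal (cgauss v z))"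
  shows "complex_normal M v X"
  using assms unfolding complex_normal_def cgauss_def distributed_def
  by (simp cong: distr_cong)

lemma complex_normal_moments:
  assumes X: "complex_normal M v X" and v: "0 < v"
  shows expectation_complex_normal: "integral\<^sup>L M X = 0"
    and has_bochner_integral_complex_normal_cmod:
      "has_bochner_integral M (\<lambda>\<omega>. cmod (X \<omega>)) (sqrt (pi * v) / 2)"
    and has_bochner_integral_complex_normal_cmod2:
      "has_bochner_integral M (\<lambda>\<omega>. (cmod (X \<omega>))\<^sup>2) v"
    and has_bochner_integral_complex_normal_cmod4:
      "has_bochner_integral M (\<lambda>\<omega>. cmod (X \<omega>) ^ 4) (2 * v\<^sup>2)"
proof -
  note D = complex_normal_distributed[OF X]
  note [measurable] = complex_normal_measurable[OF X]
  have *: "has_bochner_integral M (\<lambda>\<omega>. h (X \<omega>)) c"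
    if [measurable]: "h \<in> borel_measurable borel" and "\<And>z. 0 \<le> h z" "0 \<le> c"
      and h: "(\<integral>\<^sup>+z. ennreal (h z * cgauss v z) \<partial>lborel) = ennreal c" for h and c :: real
  proof (rule has_bochner_integral_nn_integral)
    have "(\<integral>\<^sup>+\<omega>. ennreal (h (X \<omega>)) \<partial>M) = (\<integral>\<^sup>+z. ennreal (cgauss v z) * ennreal (h z) \<partial>lborel)"
      by (rule distributed_nn_integral[OF D, symmetric]) simp
    also have "\<dots> = ennreal c"
      unfolding h[symmetric] using that v
      by (intro nn_integral_cong) (simp add: ennreal_mult[symmetric] less_imp_le[OF cgauss_pos] mult.commute)
    finally show "(\<integral>\<^sup>+\<omega>. ennreal (h (X \<omega>)) \<partial>M) = ennreal c" .
  qed (use that in auto)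
  show "has_bochner_integral M (\<lambda>\<omega>. cmod (X \<omega>)) (sqrt (pi * v) / 2)"
    using v by (intro *) (auto simp: nn_integral_cmod_cgauss)
  show "has_bochner_integral M (\<lambda>\<omega>. (cmod (X \<omega>))\<^sup>2) v"
    using v by (intro *) (auto simp: nn_integral_cmod2_cgauss)
  show "has_bochner_integral M (\<lambda>\<omega>. cmod (X \<omega>) ^ 4) (2 * v\<^sup>2)"
    using v by (intro *) (auto simp: nn_integral_cmod4_cgauss)
  \<comment> \<open>The reflection \<open>z\<close> to \<open>- z\<close> preserves both Lebesgue
    measure and \<open>cgauss v\<close>, so the mean equals its own negative.\<close>
  have neg: "distr lborel borel uminus = (lborel :: complex measure)"
    using lborel_affine[of "-1" "0::complex"] by (simp add: density_1)
  have X0: "integral\<^sup>L M X = (\<integral>z. cgauss v z *\<^sub>R z \<partial>lborel)"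
  proof -
    have "integral\<^sup>L M X = (\<integral>z. z \<partial>distr M borel X)"
      by (simp add: integral_distr)
    also have "\<dots> = (\<integral>z. cgauss v z *\<^sub>R z \<partial>lborel)"
      unfolding complex_normal_distr[OF X] using v
      by (subst integral_density) (auto simp: less_imp_le[OF cgauss_pos])
    finally show ?thesis .
  qed
  have "integral\<^sup>L M X = (\<integral>z. cgauss v z *\<^sub>R z \<partial>lborel)"
    by (rule X0)
  also have "\<dots> = (\<integral>z. cgauss v (- z) *\<^sub>R (- z) \<partial>lborel)"
    using integral_distr[of uminus lborel borel "\<lambda>z. cgauss v z *\<^sub>R z"] unfolding neg by simp
  also have "\<dots> = - (\<integral>z. cgauss v z *\<^sub>R z \<partial>lborel)"
    by (simp add: cgauss_minus)
  also have "(\<integral>z. cgauss v z *\<^sub>R z \<partial>lborel) = integral\<^sup>L M X"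
    by (rule X0[symmetric])
  finally have e: "integral\<^sup>L M X = - integral\<^sup>L M X" .
  have "2 * integral\<^sup>L M X = 0"
    unfolding mult_2 add_eq_0_iff by (rule e)
  then show "integral\<^sup>L M X = 0"
    by simp
qed

text \<open>For a fixed value of \<open>X\<close> a translation makes the sum itself the integration
  variable; exchanging the integrals leaves the convolution of the two densities. Circular symmetry
  is why only the modulus of \<alpha> survives.\<close>

lemma (in prob_space) complex_normal_add:
  assumes ind: "indep_var borel Z borel X"
    and Z: "complex_normal M u Z" and X: "complex_normal M v X" and u: "0 < u" and v: "0 < v"
  shows "complex_normal M (u + (cmod \<alpha>)\<^sup>2 * v) (\<lambda>\<omega>. Z \<omega> + \<alpha> * X \<omega>)"
proof (rule complex_normalI)
  note [measurable] = complex_normal_measurable[OF X] complex_normal_measurable[OF Z]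
  show "(\<lambda>\<omega>. Z \<omega> + \<alpha> * X \<omega>) \<in> borel_measurable M" by measurable
  define s where "s = u + (cmod \<alpha>)\<^sup>2 * v"
  interpret X: prob_space "distr M borel X" by (rule prob_space_distr) simp
  interpret Z: prob_space "distr M borel Z" by (rule prob_space_distr) simp
  interpret XZ: pair_sigma_finite "distr M borel Z" "distr M borel X" ..
  show "distr M borel (\<lambda>\<omega>. Z \<omega> + \<alpha> * X \<omega>) = density lborel (\<lambda>z. ennreal (cgauss s z))"
  proof (rule measure_eqI)
    fix A assume "A \<in> sets (distr M borel (\<lambda>\<omega>. Z \<omega> + \<alpha> * X \<omega>))"
    then have A [measurable]: "A \<in> sets borel" by simp
    let ?I = "indicator A :: complex \<Rightarrow> ennreal"
    have "emeasure (distr M borel (\<lambda>\<omega>. Z \<omega> + \<alpha> * X \<omega>)) A = (\<integral>\<^sup>+\<omega>. ?I (Z \<omega> + \<alpha> * X \<omega>) \<partial>M)"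
      using nn_integral_distr[of "\<lambda>\<omega>. Z \<omega> + \<alpha> * X \<omega>" M borel ?I] by simp
    also have "\<dots> = (\<integral>\<^sup>+p. ?I (fst p + \<alpha> * snd p) \<partial>distr M (borel \<Otimes>\<^sub>M borel) (\<lambda>\<omega>. (Z \<omega>, X \<omega>)))"
      by (subst nn_integral_distr) auto
    also have "distr M (borel \<Otimes>\<^sub>M borel) (\<lambda>\<omega>. (Z \<omega>, X \<omega>)) = distr M borel Z \<Otimes>\<^sub>M distr M borel X"
      using ind unfolding indep_var_distribution_eq by simp
    also have "(\<integral>\<^sup>+p. ?I (fst p + \<alpha> * snd p) \<partial>(distr M borel Z \<Otimes>\<^sub>M distr M borel X))
        = (\<integral>\<^sup>+x. \<integral>\<^sup>+z. ?I (z + \<alpha> * x) \<partial>distr M borel Z \<partial>distr M borel X)"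
      by (subst XZ.nn_integral_snd[symmetric]) (auto simp: split_beta' measurable_split_conv)
    also have "\<dots> = (\<integral>\<^sup>+x. ennreal (cgauss v x) * (\<integral>\<^sup>+z. ennreal (cgauss u z) * ?I (z + \<alpha> * x) \<partial>lborel) \<partial>lborel)"
      unfolding complex_normal_distr[OF X] complex_normal_distr[OF Z]
      by (simp add: nn_integral_density)
    also have "\<dots> = (\<integral>\<^sup>+x. ennreal (cgauss v x) * (\<integral>\<^sup>+z. ennreal (cgauss u (z - \<alpha> * x)) * ?I z \<partial>lborel) \<partial>lborel)"
      using nn_integral_complex_shift(2)[of "\<lambda>z. ennreal (cgauss u z) * ?I (z + \<alpha> * x)" "\<alpha> * x" for x]
      by simp
    also have "\<dots> = (\<integral>\<^sup>+x. \<integral>\<^sup>+z. ennreal (cgauss v x) * ennreal (cgauss u (z - \<alpha> * x)) * ?I z \<partial>lborel \<partial>lborel)"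
      by (simp add: nn_integral_cmult[symmetric] mult.assoc)
    also have "\<dots> = (\<integral>\<^sup>+z. \<integral>\<^sup>+x. ennreal (cgauss v x) * ennreal (cgauss u (z - \<alpha> * x)) * ?I z \<partial>lborel \<partial>lborel)"
      by (rule lborel_pair.Fubini') simp
    also have "\<dots> = (\<integral>\<^sup>+z. ennreal (cgauss s z) * ?I z \<partial>lborel)"
      using nn_integral_cgauss_convolution[OF u v, of _ \<alpha>]
      by (simp add: nn_integral_multc s_def)
    also have "\<dots> = emeasure (density lborel (\<lambda>z. ennreal (cgauss s z))) A"
      by (simp add: emeasure_density)
    finally show "emeasure (distr M borel (\<lambda>\<omega>. Z \<omega> + \<alpha> * X \<omega>)) A
        = emeasure (density lborel (\<lambda>z. ennreal (cgauss s z))) A" .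
  qed simp
qed

lemma (in prob_space) indep_var_functions:
  assumes "indep_vars M' X I" "A \<inter> B = {}" "A \<subseteq> I" "B \<subseteq> I"
    and "f \<in> measurable (PiM A M') N" "g \<in> measurable (PiM B M') N'"
  shows "indep_var N (\<lambda>\<omega>. f (\<lambda>i\<in>A. X i \<omega>)) N' (\<lambda>\<omega>. g (\<lambda>i\<in>B. X i \<omega>))"
  using indep_var_compose[OF indep_var_restrict[OF assms(1-4)] assms(5,6)] by (simp add: comp_def)

text \<open>The index \<open>i\<close> enters with coefficient 1 so that the variance stays positive
  throughout the induction: the coefficients \<alpha> may vanish, and a degenerate normal law has no
  density. In the network \<open>i\<close> is the noise of the destination.\<close>

lemma (in prob_space) complex_normal_sum:
  assumes "finite J" "i \<notin> J" "indep_vars (\<lambda>_. borel) X (insert i J)"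
    and "complex_normal M u (X i)" "0 < u"
    and "\<And>j. j \<in> J \<Longrightarrow> complex_normal M (v j) (X j)" "\<And>j. j \<in> J \<Longrightarrow> 0 < v j"
  shows "complex_normal M (u + (\<Sum>j\<in>J. (cmod (\<alpha> j))\<^sup>2 * v j)) (\<lambda>\<omega>. X i \<omega> + (\<Sum>j\<in>J. \<alpha> j * X j \<omega>))"
  using assms
proof (induction J)
  case empty
  then show ?case by simp
next
  case (insert j J)
  let ?f = "\<lambda>x :: 'b \<Rightarrow> complex. x i + (\<Sum>j\<in>J. \<alpha> j * x j)"
  have "indep_var borel (\<lambda>\<omega>. ?f (\<lambda>l\<in>insert i J. X l \<omega>)) borel (\<lambda>\<omega>. (\<lambda>x. x j) (\<lambda>l\<in>{j}. X l \<omega>))"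
    using insert.prems insert.hyps
    by (intro indep_var_functions[of "\<lambda>_. borel" X "insert i (insert j J)"]) auto
  also have "(\<lambda>\<omega>. ?f (\<lambda>l\<in>insert i J. X l \<omega>)) = (\<lambda>\<omega>. X i \<omega> + (\<Sum>j\<in>J. \<alpha> j * X j \<omega>))"
    by auto
  also have "(\<lambda>\<omega>. (\<lambda>x. x j) (\<lambda>l\<in>{j}. X l \<omega>)) = X j"
    by auto
  finally have ind: "indep_var borel (\<lambda>\<omega>. X i \<omega> + (\<Sum>j\<in>J. \<alpha> j * X j \<omega>)) borel (X j)" .
  have pos: "0 < u + (\<Sum>j\<in>J. (cmod (\<alpha> j))\<^sup>2 * v j)"
    using insert.prems by (intro add_pos_nonneg sum_nonneg) (auto simp: less_imp_le)
  have IH: "complex_normal M (u + (\<Sum>j\<in>J. (cmod (\<alpha> j))\<^sup>2 * v j)) (\<lambda>\<omega>. X i \<omega> + (\<Sum>j\<in>J. \<alpha> j * X j \<omega>))"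
    using insert.prems by (intro insert.IH) (auto intro: indep_vars_subset)
  show ?case
    using complex_normal_add[OF ind IH _ pos, of "v j" "\<alpha> j"] insert.prems insert.hyps
    by (simp add: add_ac)
qed

section \<open>Mutual information over a Gaussian fading channel\<close>

text \<open>From above \<open>ln b\<close> is bounded by \<open>ln B\<close>; from below ln (a / b)
  <= a / b - 1 bounds it by the integrable function \<open>ln a - a / b\<close>. This has to be
  settled beforehand, since the Bochner integral of a non-integrable function is 0 by
  convention.\<close>

lemma (in prob_space) gibbs_integrable_ln:
  fixes a b :: "'a \<Rightarrow> real"
  assumes [measurable]: "a \<in> borel_measurable M" "b \<in> borel_measurable M"
    and a: "integrable M (\<lambda>x. ln (a x))" "\<And>x. x \<in> space M \<Longrightarrow> 0 < a x"
    and b: "\<And>x. x \<in> space M \<Longrightarrow> 0 < b x" "\<And>x. x \<in> space M \<Longrightarrow> b x \<le> B"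
    and ab: "(\<integral>\<^sup>+x. ennreal (a x / b x) \<partial>M) \<le> 1"
  shows "integrable M (\<lambda>x. ln (b x))"
proof (rule Bochner_Integration.integrable_bound)
  have nn: "AE x in M. 0 \<le> a x / b x"
    using a b by (intro AE_I2) (simp add: less_imp_le)
  have "integrable M (\<lambda>x. a x / b x)"
    using ab by (intro integrableI_nonneg) (auto simp: nn intro: le_less_trans)
  then show "integrable M (\<lambda>x. \<bar>ln (a x)\<bar> + a x / b x + \<bar>ln B\<bar>)"
    using a by auto
  show "AE x in M. norm (ln (b x)) \<le> norm (\<bar>ln (a x)\<bar> + a x / b x + \<bar>ln B\<bar>)"
  proof (rule AE_I2)
    fix x assume x: "x \<in> space M"
    then have p: "0 < a x" "0 < b x" "b x \<le> B" "0 < a x / b x" using a b by auto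
    have "ln (a x / b x) \<le> a x / b x - 1" using p by (intro ln_le_minus_one) auto
    then have "ln (a x) - a x / b x \<le> ln (b x)" using p by (simp add: ln_div)
    moreover have "ln (b x) \<le> ln B" using p by simp
    ultimately show "norm (ln (b x)) \<le> norm (\<bar>ln (a x)\<bar> + a x / b x + \<bar>ln B\<bar>)"
      using p(4) unfolding real_norm_def by linarith
  qed
qed measurable

text \<open>Here \<open>b\<close> plays the true density and \<open>a\<close> a competitor; the last
  premise says that the competitor has total mass at most 1. Integrating ln x <= x - 1 at x = a / b
  is the whole proof. In this form the same lemma serves conditional, marginal and posterior
  densities.\<close>

lemma (in prob_space) gibbs_inequality:
  fixes a b :: "'a \<Rightarrow> real"
  assumes [measurable]: "a \<in> borel_measurable M" "b \<in> borel_measurable M"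
    and a: "integrable M (\<lambda>x. ln (a x))" "\<And>x. x \<in> space M \<Longrightarrow> 0 < a x"
    and b: "integrable M (\<lambda>x. ln (b x))" "\<And>x. x \<in> space M \<Longrightarrow> 0 < b x"
    and ab: "(\<integral>\<^sup>+x. ennreal (a x / b x) \<partial>M) \<le> 1"
  shows "(\<integral>x. ln (a x) \<partial>M) \<le> (\<integral>x. ln (b x) \<partial>M)"
proof -
  have nn: "AE x in M. 0 \<le> a x / b x"
    using a b by (intro AE_I2) (simp add: less_imp_le)
  have i: "integrable M (\<lambda>x. a x / b x)"
    using ab by (intro integrableI_nonneg) (auto simp: nn intro: le_less_trans)
  have le1: "(\<integral>x. a x / b x \<partial>M) \<le> 1"
    using ab nn_integral_eq_integral[OF i nn] by (simp add: ennreal_le_1)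
  have "(\<integral>x. ln (a x) - ln (b x) \<partial>M) \<le> (\<integral>x. a x / b x - 1 \<partial>M)"
  proof (rule integral_mono)
    fix x assume x: "x \<in> space M"
    then have p: "0 < a x" "0 < b x" using a b by auto
    have "ln (a x / b x) \<le> a x / b x - 1" using p by (intro ln_le_minus_one) auto
    then show "ln (a x) - ln (b x) \<le> a x / b x - 1" using p by (simp add: ln_div)
  qed (use i a b in auto)
  also have "\<dots> \<le> 0"
    using i le1 by (simp add: prob_space)
  finally show ?thesis
    using a b by simp
qed

text \<open>The mixed term drops out by symmetry. Since extended nonnegative integrals admit no
  subtraction, the integrand is added to its reflection and the parallelogram law removes the mixed
  term before integrating.\<close>

lemma nn_integral_cgauss_affine:
  assumes v: "0 < v"
  shows "(\<integral>\<^sup>+z. ennreal (cgauss v z) * ennreal ((cmod (\<alpha> + \<beta> * z))\<^sup>2) \<partial>lborel)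
    = ennreal ((cmod \<alpha>)\<^sup>2 + (cmod \<beta>)\<^sup>2 * v)"
proof -
  let ?f = "\<lambda>z. ennreal (cgauss v z) * ennreal ((cmod (\<alpha> + \<beta> * z))\<^sup>2)"
  note pos = less_imp_le[OF cgauss_pos[OF v]]
  have par: "(cmod (\<alpha> + \<beta> * z))\<^sup>2 + (cmod (\<alpha> - \<beta> * z))\<^sup>2 = 2 * (cmod \<alpha>)\<^sup>2 + 2 * (cmod \<beta>)\<^sup>2 * (cmod z)\<^sup>2" for z
    unfolding cmod_power2 by simp algebra
  have "(\<integral>\<^sup>+z. ?f z \<partial>lborel) + (\<integral>\<^sup>+z. ?f z \<partial>lborel)
      = (\<integral>\<^sup>+z. ?f z \<partial>lborel) + (\<integral>\<^sup>+z. ?f (0 - z) \<partial>lborel)"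
    by (subst nn_integral_complex_shift(3)) auto
  also have "\<dots> = (\<integral>\<^sup>+z. ?f z + ?f (0 - z) \<partial>lborel)"
    by (intro nn_integral_add[symmetric]) auto
  also have "\<dots> = (\<integral>\<^sup>+z. ennreal (2 * (cmod \<alpha>)\<^sup>2) * ennreal (cgauss v z)
      + ennreal (2 * (cmod \<beta>)\<^sup>2) * ennreal ((cmod z)\<^sup>2 * cgauss v z) \<partial>lborel)"
  proof (intro nn_integral_cong)
    fix z
    have "?f z + ?f (0 - z) = ennreal (cgauss v z * ((cmod (\<alpha> + \<beta> * z))\<^sup>2 + (cmod (\<alpha> - \<beta> * z))\<^sup>2))"
      using pos by (simp add: cgauss_minus ennreal_mult[symmetric] ennreal_plus[symmetric] distrib_left del: ennreal_plus)
    also have "\<dots> = ennreal (2 * (cmod \<alpha>)\<^sup>2) * ennreal (cgauss v z)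
      + ennreal (2 * (cmod \<beta>)\<^sup>2) * ennreal ((cmod z)\<^sup>2 * cgauss v z)"
      unfolding par using pos
      by (simp add: ennreal_mult[symmetric] ennreal_plus[symmetric] distrib_left mult_ac del: ennreal_plus)
    finally show "?f z + ?f (0 - z) = \<dots>" .
  qed
  also have "\<dots> = ennreal (2 * (cmod \<alpha>)\<^sup>2) + ennreal (2 * (cmod \<beta>)\<^sup>2) * ennreal v"
    using v by (subst nn_integral_add) (auto simp: nn_integral_cmult nn_integral_cgauss nn_integral_cmod2_cgauss)
  also have "\<dots> = ennreal (2 * ((cmod \<alpha>)\<^sup>2 + (cmod \<beta>)\<^sup>2 * v))"
    using v by (simp add: ennreal_mult[symmetric] ennreal_plus[symmetric] distrib_left mult_ac del: ennreal_plus)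
  finally have e: "2 * (\<integral>\<^sup>+z. ?f z \<partial>lborel) = 2 * ennreal ((cmod \<alpha>)\<^sup>2 + (cmod \<beta>)\<^sup>2 * v)"
    using v by (simp add: mult_2[symmetric] ennreal_mult)
  then show ?thesis
    by (subst (asm) ennreal_mult_cancel_left) auto
qed

lemma nn_integral_cgauss_shift:
  assumes "0 < v"
  shows "(\<integral>\<^sup>+z. ennreal (cgauss v (z - t)) \<partial>lborel) = 1"
  using nn_integral_complex_shift(2)[of "\<lambda>z. ennreal (cgauss v z)" t] nn_integral_cgauss[OF assms] by simp

lemma ennreal_mult_divide:
  fixes b c :: real
  assumes "0 < b" "0 \<le> c"
  shows "ennreal b * ennreal (c / b) = ennreal c" "a * ennreal b * ennreal (c / b) = a * ennreal c"
  using assms by (simp_all add: ennreal_mult[symmetric] mult.assoc)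

section \<open>The fading channel with unknown gains\<close>

text \<open>Averaging over \<open>A\<close> and \<open>D\<close> inside the density expresses that
  the gains are unknown and independent of the input. The lower bound \<open>d\<close> on the noise
  power bounds every density by 1 / (pi d), which supplies the upper bounds for the
  logarithms.\<close>

locale gaussian_fading_channel = prob_space +
  fixes A :: "'a \<Rightarrow> complex" and D :: "'a \<Rightarrow> real" and v d :: real and Y S :: "'a \<Rightarrow> complex"
  assumes measurable_A [measurable]: "A \<in> borel_measurable M"
    and measurable_D [measurable]: "D \<in> borel_measurable M"
    and v: "0 < v" and d: "0 < d" and D: "\<And>\<omega>. d \<le> D \<omega>"
    and integrable_A: "integrable M A" and integrable_A2: "integrable M (\<lambda>\<omega>. (cmod (A \<omega>))\<^sup>2)"
    and integrable_D: "integrable M D"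
    and joint: "distributed M (lborel \<Otimes>\<^sub>M lborel) (\<lambda>\<omega>. (Y \<omega>, S \<omega>))
      (\<lambda>(y, s). ennreal (cgauss v s * (\<integral>\<omega>. cgauss (D \<omega>) (y - s * A \<omega>) \<partial>M)))"
begin

lemma D_pos: "0 < D \<omega>"
  using d D[of \<omega>] by simp

definition cond_density :: "complex \<Rightarrow> complex \<Rightarrow> real" where
  "cond_density y s = (\<integral>\<omega>. cgauss (D \<omega>) (y - s * A \<omega>) \<partial>M)"

definition output_density :: "complex \<Rightarrow> real" where
  "output_density y = (\<integral>s. cgauss v s * cond_density y s \<partial>lborel)"

text \<open>
  The law of gains, output and input together: the first component is distributed as \<open>M\<close>, the other
  two as \<open>(Y, S)\<close>.
\<close>

definition ext_law :: "('a \<times> complex \<times> complex) measure" where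
  "ext_law = density (M \<Otimes>\<^sub>M (lborel \<Otimes>\<^sub>M lborel))
     (\<lambda>(\<omega>, y, s). ennreal (cgauss v s) * ennreal (cgauss (D \<omega>) (y - s * A \<omega>)))"

lemma cgauss_D_le: "cgauss (D \<omega>) z \<le> 1 / (pi * d)"
proof -
  have "cgauss (D \<omega>) z \<le> 1 / (pi * D \<omega>)"
    by (rule cgauss_le) (rule D_pos)
  also have "\<dots> \<le> 1 / (pi * d)"
    using d D[of \<omega>] by (intro divide_left_mono) auto
  finally show ?thesis .
qed

lemma integrable_cgauss_D: "integrable M (\<lambda>\<omega>. cgauss (D \<omega>) (y - s * A \<omega>))"
  using cgauss_D_le cgauss_pos[OF D_pos]
  by (intro integrable_const_bound[where B="1 / (pi * d)"] AE_I2) (auto simp: abs_of_pos)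

lemma cond_density_eq:
  "ennreal (cond_density y s) = (\<integral>\<^sup>+\<omega>. ennreal (cgauss (D \<omega>) (y - s * A \<omega>)) \<partial>M)"
  unfolding cond_density_def
  by (rule nn_integral_eq_integral[symmetric, OF integrable_cgauss_D])
    (simp add: less_imp_le[OF cgauss_pos[OF D_pos]])

lemma cond_density_le: "cond_density y s \<le> 1 / (pi * d)"
proof -
  have "cond_density y s \<le> (\<integral>\<omega>. 1 / (pi * d) \<partial>M)"
    unfolding cond_density_def
    by (rule integral_mono[OF integrable_cgauss_D]) (auto simp: cgauss_D_le)
  then show ?thesis by (simp add: prob_space)
qed

lemma cond_density_pos: "0 < cond_density y s"
proof -
  have "(\<integral>\<^sup>+\<omega>. ennreal (cgauss (D \<omega>) (y - s * A \<omega>)) \<partial>M) \<noteq> 0"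
  proof
    assume "(\<integral>\<^sup>+\<omega>. ennreal (cgauss (D \<omega>) (y - s * A \<omega>)) \<partial>M) = 0"
    then have "AE \<omega> in M. ennreal (cgauss (D \<omega>) (y - s * A \<omega>)) = 0"
      by (subst (asm) nn_integral_0_iff_AE) simp_all
    then have "AE \<omega> in M. False"
      by eventually_elim (metis ennreal_eq_0_iff not_le cgauss_pos D_pos)
    then show False by simp
  qed
  then show ?thesis
    unfolding cond_density_eq[symmetric] by (simp add: ennreal_eq_0_iff)
qed

lemma cond_density_measurable [measurable]:
  assumes [measurable]: "f \<in> borel_measurable N" "g \<in> borel_measurable N"
  shows "(\<lambda>x. cond_density (f x) (g x)) \<in> borel_measurable N"
  unfolding cond_density_def by measurable

lemma integrable_cgauss: "integrable lborel (cgauss v)"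
  using v by (intro integrableI_nonneg) (auto simp: nn_integral_cgauss less_imp_le[OF cgauss_pos])

lemma integrable_cond_density: "integrable lborel (\<lambda>s. cgauss v s * cond_density y s)"
proof (rule Bochner_Integration.integrable_bound[OF integrable_mult_left[OF integrable_cgauss]])
  show "AE s in lborel. norm (cgauss v s * cond_density y s) \<le> norm (cgauss v s * (1 / (pi * d)))"
  proof (rule AE_I2)
    fix s :: complex
    have "cgauss v s * cond_density y s \<le> cgauss v s * (1 / (pi * d))"
      using cond_density_le cgauss_pos[OF v, of s] by (intro mult_left_mono) auto
    then show "norm (cgauss v s * cond_density y s) \<le> norm (cgauss v s * (1 / (pi * d)))"
      using cond_density_pos[of y s] cgauss_pos[OF v, of s] d by (simp add: abs_mult)
  qed
qed measurable

lemma output_density_eq: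
  "ennreal (output_density y) = (\<integral>\<^sup>+s. ennreal (cgauss v s) * ennreal (cond_density y s) \<partial>lborel)"
  unfolding output_density_def
  using cond_density_pos cgauss_pos[OF v]
  by (subst nn_integral_eq_integral[symmetric, OF integrable_cond_density])
    (auto simp: less_imp_le ennreal_mult intro!: nn_integral_cong)

lemma output_density_pos: "0 < output_density y"
proof -
  have "(\<integral>\<^sup>+s. ennreal (cgauss v s) * ennreal (cond_density y s) \<partial>lborel) \<noteq> 0"
  proof
    assume "(\<integral>\<^sup>+s. ennreal (cgauss v s) * ennreal (cond_density y s) \<partial>lborel) = 0"
    then have "AE s in lborel. ennreal (cgauss v s) * ennreal (cond_density y s) = 0"
      by (subst (asm) nn_integral_0_iff_AE) simp_all
    then have "AE s::complex in lborel. False"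
      by eventually_elim (metis mult_eq_0_iff ennreal_eq_0_iff not_le cgauss_pos v cond_density_pos)
    then show False by (auto simp: eventually_ae_filter null_sets_def dest: top.extremum_uniqueI)
  qed
  then show ?thesis
    unfolding output_density_eq[symmetric] by (simp add: ennreal_eq_0_iff)
qed

lemma output_density_le: "output_density y \<le> 1 / (pi * d)"
proof -
  have "ennreal (output_density y) \<le> (\<integral>\<^sup>+s. ennreal (cgauss v s) * ennreal (1 / (pi * d)) \<partial>lborel)"
    unfolding output_density_eq
    by (intro nn_integral_mono mult_left_mono ennreal_leI cond_density_le) simp
  also have "\<dots> = ennreal (1 / (pi * d))"
    using v by (simp add: nn_integral_multc nn_integral_cgauss)
  finally show ?thesis using d by (simp add: ennreal_le_iff)
qed

lemma output_density_measurable [measurable]: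
  assumes [measurable]: "f \<in> borel_measurable N"
  shows "(\<lambda>x. output_density (f x)) \<in> borel_measurable N"
proof -
  have [measurable]: "output_density \<in> borel_measurable borel"
    unfolding output_density_def[abs_def] by measurable
  show ?thesis by measurable
qed

lemma sets_ext_law [measurable_cong]: "sets ext_law = sets (M \<Otimes>\<^sub>M (borel \<Otimes>\<^sub>M borel))"
  unfolding ext_law_def by simp

text \<open>The output is replaced by the noise \<open>z = y - s * A \<omega>\<close>. In these
  coordinates gains, input and noise can be integrated one after the other, each against an explicit
  law.\<close>

lemma nn_integral_ext:
  assumes [measurable]: "f \<in> borel_measurable (M \<Otimes>\<^sub>M (borel \<Otimes>\<^sub>M borel))"
  shows "(\<integral>\<^sup>+q. f q \<partial>ext_law) = (\<integral>\<^sup>+\<omega>. \<integral>\<^sup>+s. ennreal (cgauss v s) *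
    (\<integral>\<^sup>+z. ennreal (cgauss (D \<omega>) z) * f (\<omega>, s * A \<omega> + z, s) \<partial>lborel) \<partial>lborel \<partial>M)"
proof -
  have L: "sigma_finite_measure (lborel \<Otimes>\<^sub>M lborel :: (complex \<times> complex) measure)"
    unfolding lborel_prod by (rule sigma_finite_lborel)
  have "(\<integral>\<^sup>+q. f q \<partial>ext_law) = (\<integral>\<^sup>+q. (case q of (\<omega>, y, s) \<Rightarrow>
      ennreal (cgauss v s) * ennreal (cgauss (D \<omega>) (y - s * A \<omega>))) * f q \<partial>(M \<Otimes>\<^sub>M (lborel \<Otimes>\<^sub>M lborel)))"
    unfolding ext_law_def by (rule nn_integral_density) measurable
  also have "\<dots> = (\<integral>\<^sup>+\<omega>. \<integral>\<^sup>+p. (case p of (y, s) \<Rightarrow>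
      ennreal (cgauss v s) * ennreal (cgauss (D \<omega>) (y - s * A \<omega>))) * f (\<omega>, p) \<partial>(lborel \<Otimes>\<^sub>M lborel) \<partial>M)"
    by (subst sigma_finite_measure.nn_integral_fst[OF L, symmetric]) (simp_all add: split_beta')
  also have "\<dots> = (\<integral>\<^sup>+\<omega>. \<integral>\<^sup>+s. \<integral>\<^sup>+y.
      ennreal (cgauss v s) * ennreal (cgauss (D \<omega>) (y - s * A \<omega>)) * f (\<omega>, y, s) \<partial>lborel \<partial>lborel \<partial>M)"
    by (intro nn_integral_cong, subst lborel_pair.nn_integral_snd[symmetric]) (simp_all add: split_beta')
  also have "\<dots> = (\<integral>\<^sup>+\<omega>. \<integral>\<^sup>+s. ennreal (cgauss v s) *
      (\<integral>\<^sup>+y. ennreal (cgauss (D \<omega>) (y - s * A \<omega>)) * f (\<omega>, y, s) \<partial>lborel) \<partial>lborel \<partial>M)"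
    by (intro nn_integral_cong) (simp add: nn_integral_cmult[symmetric] mult.assoc)
  also have "\<dots> = (\<integral>\<^sup>+\<omega>. \<integral>\<^sup>+s. ennreal (cgauss v s) *
      (\<integral>\<^sup>+z. ennreal (cgauss (D \<omega>) z) * f (\<omega>, s * A \<omega> + z, s) \<partial>lborel) \<partial>lborel \<partial>M)"
  proof -
    have "(\<integral>\<^sup>+y. ennreal (cgauss (D \<omega>) (y - s * A \<omega>)) * f (\<omega>, y, s) \<partial>lborel)
      = (\<integral>\<^sup>+z. ennreal (cgauss (D \<omega>) z) * f (\<omega>, s * A \<omega> + z, s) \<partial>lborel)"
      if [measurable]: "\<omega> \<in> space M" for \<omega> s
      by (subst nn_integral_complex_shift(1)[of _ "s * A \<omega>", symmetric]) simp_all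
    then show ?thesis
      by (simp cong: nn_integral_cong)
  qed
  finally show ?thesis .
qed

text \<open>Integrating out the gains first turns the kernel into the mixture
  \<open>cond_density\<close>, which is the density assumed in \<open>joint\<close>. This is the
  link from the extended law back to the actual pair \<open>(Y, S)\<close>.\<close>

lemma nn_integral_ext_output:
  assumes [measurable]: "f \<in> borel_measurable (borel \<Otimes>\<^sub>M borel)"
  shows "(\<integral>\<^sup>+q. f (snd q) \<partial>ext_law) = (\<integral>\<^sup>+y. \<integral>\<^sup>+s. ennreal (cgauss v s) *
    ennreal (cond_density y s) * f (y, s) \<partial>lborel \<partial>lborel)"
    and "(\<integral>\<^sup>+q. f (snd q) \<partial>ext_law) = (\<integral>\<^sup>+\<omega>. f (Y \<omega>, S \<omega>) \<partial>M)"
proof -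
  interpret L: sigma_finite_measure "lborel \<Otimes>\<^sub>M lborel :: (complex \<times> complex) measure"
    unfolding lborel_prod by (rule sigma_finite_lborel)
  interpret MP: pair_sigma_finite M "lborel \<Otimes>\<^sub>M lborel :: (complex \<times> complex) measure" ..
  have "(\<integral>\<^sup>+q. f (snd q) \<partial>ext_law) = (\<integral>\<^sup>+q. (case q of (\<omega>, y, s) \<Rightarrow>
      ennreal (cgauss v s) * ennreal (cgauss (D \<omega>) (y - s * A \<omega>))) * f (snd q) \<partial>(M \<Otimes>\<^sub>M (lborel \<Otimes>\<^sub>M lborel)))"
    unfolding ext_law_def by (rule nn_integral_density) measurable
  also have "\<dots> = (\<integral>\<^sup>+p. \<integral>\<^sup>+\<omega>. (case p of (y, s) \<Rightarrow>
      ennreal (cgauss v s) * ennreal (cgauss (D \<omega>) (y - s * A \<omega>))) * f p \<partial>M \<partial>(lborel \<Otimes>\<^sub>M lborel))"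
    by (subst MP.nn_integral_snd[symmetric]) (simp_all add: split_beta')
  also have "\<dots> = (\<integral>\<^sup>+p. (case p of (y, s) \<Rightarrow>
      ennreal (cgauss v s) * ennreal (cond_density y s)) * f p \<partial>(lborel \<Otimes>\<^sub>M lborel))"
    by (intro nn_integral_cong)
      (simp add: split_beta' nn_integral_cmult nn_integral_multc cond_density_eq)
  finally have *: "(\<integral>\<^sup>+q. f (snd q) \<partial>ext_law) = \<dots>" .
  show "(\<integral>\<^sup>+q. f (snd q) \<partial>ext_law) = (\<integral>\<^sup>+y. \<integral>\<^sup>+s. ennreal (cgauss v s) *
    ennreal (cond_density y s) * f (y, s) \<partial>lborel \<partial>lborel)"
    unfolding * by (subst lborel.nn_integral_fst[symmetric]) (simp_all add: split_beta')
  have "f \<in> borel_measurable (lborel \<Otimes>\<^sub>M lborel)" by measurable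
  from distributed_nn_integral[OF joint this]
  show "(\<integral>\<^sup>+q. f (snd q) \<partial>ext_law) = (\<integral>\<^sup>+\<omega>. f (Y \<omega>, S \<omega>) \<partial>M)"
    unfolding * cond_density_def[symmetric] using v cond_density_pos
    by (simp add: split_beta' ennreal_mult less_imp_le cgauss_pos)
qed

sublocale ext: prob_space ext_law
proof
  have "emeasure ext_law (space ext_law) = (\<integral>\<^sup>+q. 1 \<partial>ext_law)" by simp
  also have "\<dots> = 1"
    by (subst nn_integral_ext) (auto simp: nn_integral_cgauss v D_pos emeasure_space_1)
  finally show "emeasure ext_law (space ext_law) = 1" .
qed


lemma distr_ext_law_fst: "distr ext_law M fst = M"
proof (rule measure_eqI)
  fix B assume "B \<in> sets (distr ext_law M fst)"
  then have [measurable]: "B \<in> sets M" by simp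
  have "emeasure (distr ext_law M fst) B = (\<integral>\<^sup>+q. indicator B (fst q) \<partial>ext_law)"
    using nn_integral_distr[of fst ext_law M "indicator B :: 'a \<Rightarrow> ennreal"] by simp
  also have "\<dots> = emeasure M B"
    by (subst nn_integral_ext) (auto simp: nn_integral_multc nn_integral_cgauss v D_pos)
  finally show "emeasure (distr ext_law M fst) B = emeasure M B" .
qed simp

text \<open>Going through equality of the image measures makes the transfer valid without any
  integrability of \<open>f\<close>.\<close>

lemma integral_ext_output:
  fixes f :: "complex \<times> complex \<Rightarrow> real"
  assumes [measurable]: "f \<in> borel_measurable (borel \<Otimes>\<^sub>M borel)"
  shows "(\<integral>q. f (snd q) \<partial>ext_law) = (\<integral>\<omega>. f (Y \<omega>, S \<omega>) \<partial>M)"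
proof -
  have [measurable]: "(\<lambda>\<omega>. (Y \<omega>, S \<omega>)) \<in> measurable M (borel \<Otimes>\<^sub>M borel)"
    using distributed_measurable[OF joint]
    by (simp cong: measurable_cong_sets sets_pair_measure_cong)
  have "distr ext_law (borel \<Otimes>\<^sub>M borel) snd = distr M (borel \<Otimes>\<^sub>M borel) (\<lambda>\<omega>. (Y \<omega>, S \<omega>))"
  proof (rule measure_eqI)
    fix B assume "B \<in> sets (distr ext_law (borel \<Otimes>\<^sub>M borel) snd)"
    then have [measurable]: "B \<in> sets (borel \<Otimes>\<^sub>M borel)" by simp
    let ?I = "indicator B :: complex \<times> complex \<Rightarrow> ennreal"
    have "emeasure (distr ext_law (borel \<Otimes>\<^sub>M borel) snd) B = (\<integral>\<^sup>+q. ?I (snd q) \<partial>ext_law)"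
      using nn_integral_distr[of snd ext_law "borel \<Otimes>\<^sub>M borel" ?I] by simp
    also have "\<dots> = (\<integral>\<^sup>+\<omega>. ?I (Y \<omega>, S \<omega>) \<partial>M)"
      by (rule nn_integral_ext_output) measurable
    also have "\<dots> = emeasure (distr M (borel \<Otimes>\<^sub>M borel) (\<lambda>\<omega>. (Y \<omega>, S \<omega>))) B"
      using nn_integral_distr[of "\<lambda>\<omega>. (Y \<omega>, S \<omega>)" M "borel \<Otimes>\<^sub>M borel" ?I] by simp
    finally show "emeasure (distr ext_law (borel \<Otimes>\<^sub>M borel) snd) B
        = emeasure (distr M (borel \<Otimes>\<^sub>M borel) (\<lambda>\<omega>. (Y \<omega>, S \<omega>))) B" .
  qed simp
  then show ?thesis
    using integral_distr[of snd ext_law "borel \<Otimes>\<^sub>M borel" f]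
      integral_distr[of "\<lambda>\<omega>. (Y \<omega>, S \<omega>)" M "borel \<Otimes>\<^sub>M borel" f] by simp
qed

lemma integrable_affine_A: "integrable M (\<lambda>\<omega>. (cmod (\<alpha> + \<beta> * A \<omega>))\<^sup>2)"
proof (rule Bochner_Integration.integrable_bound)
  show "integrable M (\<lambda>\<omega>. 2 * (cmod \<alpha>)\<^sup>2 + 2 * (cmod \<beta>)\<^sup>2 * (cmod (A \<omega>))\<^sup>2)"
    using integrable_A2 by simp
  show "AE \<omega> in M. norm ((cmod (\<alpha> + \<beta> * A \<omega>))\<^sup>2) \<le> norm (2 * (cmod \<alpha>)\<^sup>2 + 2 * (cmod \<beta>)\<^sup>2 * (cmod (A \<omega>))\<^sup>2)"
  proof (rule AE_I2)
    fix \<omega>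
    have "(cmod (\<alpha> + \<beta> * A \<omega>))\<^sup>2 + (cmod (\<alpha> - \<beta> * A \<omega>))\<^sup>2 = 2 * (cmod \<alpha>)\<^sup>2 + 2 * (cmod \<beta>)\<^sup>2 * (cmod (A \<omega>))\<^sup>2"
      unfolding cmod_power2 by simp algebra
    then have "(cmod (\<alpha> + \<beta> * A \<omega>))\<^sup>2 \<le> 2 * (cmod \<alpha>)\<^sup>2 + 2 * (cmod \<beta>)\<^sup>2 * (cmod (A \<omega>))\<^sup>2"
      using zero_le_power2[of "cmod (\<alpha> - \<beta> * A \<omega>)"] by linarith
    then show "norm ((cmod (\<alpha> + \<beta> * A \<omega>))\<^sup>2) \<le> norm (2 * (cmod \<alpha>)\<^sup>2 + 2 * (cmod \<beta>)\<^sup>2 * (cmod (A \<omega>))\<^sup>2)"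
      by simp
  qed
qed measurable

text \<open>One formula covers three powers: (\<alpha>, \<beta>) = (0, 1) gives the output, (1, 0)
  the input, and (1, -c) the error of the linear estimate \<open>c * y\<close> of the input.\<close>

lemma has_bochner_integral_quadratic:
  "has_bochner_integral ext_law (\<lambda>q. (cmod (\<alpha> * snd (snd q) + \<beta> * fst (snd q)))\<^sup>2)
     (v * (\<integral>\<omega>. (cmod (\<alpha> + \<beta> * A \<omega>))\<^sup>2 \<partial>M) + (cmod \<beta>)\<^sup>2 * (\<integral>\<omega>. D \<omega> \<partial>M))"
proof (rule has_bochner_integral_nn_integral)
  have Dnn: "0 \<le> D \<omega>" for \<omega> using D_pos[of \<omega>] by simp
  have "(\<integral>\<^sup>+q. ennreal ((cmod (\<alpha> * snd (snd q) + \<beta> * fst (snd q)))\<^sup>2) \<partial>ext_law)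
      = (\<integral>\<^sup>+\<omega>. \<integral>\<^sup>+s. ennreal (cgauss v s) * (\<integral>\<^sup>+z. ennreal (cgauss (D \<omega>) z) *
          ennreal ((cmod (s * (\<alpha> + \<beta> * A \<omega>) + \<beta> * z))\<^sup>2) \<partial>lborel) \<partial>lborel \<partial>M)"
    by (subst nn_integral_ext) (simp_all add: algebra_simps)
  also have "\<dots> = (\<integral>\<^sup>+\<omega>. \<integral>\<^sup>+s. ennreal (cgauss v s) *
          ennreal ((cmod (s * (\<alpha> + \<beta> * A \<omega>)))\<^sup>2 + (cmod \<beta>)\<^sup>2 * D \<omega>) \<partial>lborel \<partial>M)"
    by (simp only: nn_integral_cgauss_affine[OF D_pos])
  also have "\<dots> = (\<integral>\<^sup>+\<omega>. \<integral>\<^sup>+s. ennreal ((cmod (\<alpha> + \<beta> * A \<omega>))\<^sup>2) * ennreal ((cmod s)\<^sup>2 * cgauss v s)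
          + ennreal ((cmod \<beta>)\<^sup>2 * D \<omega>) * ennreal (cgauss v s) \<partial>lborel \<partial>M)"
    using Dnn less_imp_le[OF cgauss_pos[OF v]]
    unfolding norm_mult power_mult_distrib
    by (intro nn_integral_cong)
      (simp add: ennreal_mult[symmetric] ennreal_plus[symmetric] distrib_left mult_ac del: ennreal_plus)
  also have "\<dots> = (\<integral>\<^sup>+\<omega>. ennreal (v * (cmod (\<alpha> + \<beta> * A \<omega>))\<^sup>2 + (cmod \<beta>)\<^sup>2 * D \<omega>) \<partial>M)"
    using v Dnn
    by (intro nn_integral_cong)
      (simp add: nn_integral_add nn_integral_cmult nn_integral_cgauss nn_integral_cmod2_cgauss,
       simp add: ennreal_mult[symmetric] mult.commute)
  also have "\<dots> = ennreal (\<integral>\<omega>. v * (cmod (\<alpha> + \<beta> * A \<omega>))\<^sup>2 + (cmod \<beta>)\<^sup>2 * D \<omega> \<partial>M)"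
    using v Dnn integrable_affine_A integrable_D by (intro nn_integral_eq_integral) auto
  also have "(\<integral>\<omega>. v * (cmod (\<alpha> + \<beta> * A \<omega>))\<^sup>2 + (cmod \<beta>)\<^sup>2 * D \<omega> \<partial>M)
      = v * (\<integral>\<omega>. (cmod (\<alpha> + \<beta> * A \<omega>))\<^sup>2 \<partial>M) + (cmod \<beta>)\<^sup>2 * (\<integral>\<omega>. D \<omega> \<partial>M)"
    using integrable_affine_A integrable_D by simp
  finally show "(\<integral>\<^sup>+q. ennreal ((cmod (\<alpha> * snd (snd q) + \<beta> * fst (snd q)))\<^sup>2) \<partial>ext_law)
      = ennreal (v * (\<integral>\<omega>. (cmod (\<alpha> + \<beta> * A \<omega>))\<^sup>2 \<partial>M) + (cmod \<beta>)\<^sup>2 * (\<integral>\<omega>. D \<omega> \<partial>M))" .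
  show "0 \<le> v * (\<integral>\<omega>. (cmod (\<alpha> + \<beta> * A \<omega>))\<^sup>2 \<partial>M) + (cmod \<beta>)\<^sup>2 * (\<integral>\<omega>. D \<omega> \<partial>M)"
    using v Dnn by (intro add_nonneg_nonneg mult_nonneg_nonneg Bochner_Integration.integral_nonneg) auto
qed (auto intro!: AE_I2)

lemma integrable_ln_D: "integrable M (\<lambda>\<omega>. ln (D \<omega>))"
proof (rule Bochner_Integration.integrable_bound)
  show "integrable M (\<lambda>\<omega>. D \<omega> + \<bar>ln d\<bar>)"
    using integrable_D by simp
  show "AE \<omega> in M. norm (ln (D \<omega>)) \<le> norm (D \<omega> + \<bar>ln d\<bar>)"
  proof (rule AE_I2)
    fix \<omega>
    have "ln d \<le> ln (D \<omega>)" "ln (D \<omega>) \<le> D \<omega> - 1"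
      using d D[of \<omega>] D_pos[of \<omega>] by (auto intro: ln_le_minus_one)
    then show "norm (ln (D \<omega>)) \<le> norm (D \<omega> + \<bar>ln d\<bar>)"
      using D_pos[of \<omega>] unfolding real_norm_def by linarith
  qed
qed measurable

text \<open>Up to sign this is the conditional differential entropy of the output given input and
  gains. The final 1 is the mean of the squared noise divided by its own variance.\<close>

lemma has_bochner_integral_ln_cgauss_D:
  "has_bochner_integral ext_law
     (\<lambda>q. ln (cgauss (D (fst q)) (fst (snd q) - snd (snd q) * A (fst q))))
     (- ln pi - (\<integral>\<omega>. ln (D \<omega>) \<partial>M) - 1)"
proof -
  have 1: "has_bochner_integral ext_law
     (\<lambda>q. (cmod (fst (snd q) - snd (snd q) * A (fst q)))\<^sup>2 / D (fst q)) 1"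
  proof (rule has_bochner_integral_nn_integral)
    have "(\<integral>\<^sup>+z. ennreal (cgauss (D \<omega>) z) * ennreal ((cmod z)\<^sup>2 / D \<omega>) \<partial>lborel) = 1" for \<omega>
    proof -
      have "(\<integral>\<^sup>+z. ennreal (cgauss (D \<omega>) z) * ennreal ((cmod z)\<^sup>2 / D \<omega>) \<partial>lborel)
          = (\<integral>\<^sup>+z. ennreal (1 / D \<omega>) * ennreal ((cmod z)\<^sup>2 * cgauss (D \<omega>) z) \<partial>lborel)"
        using D_pos[of \<omega>] cgauss_pos[OF D_pos, of \<omega>]
        by (intro nn_integral_cong) (simp add: ennreal_mult[symmetric] less_imp_le mult_ac)
      also have "\<dots> = 1"
        using D_pos[of \<omega>] by (simp add: nn_integral_cmult nn_integral_cmod2_cgauss ennreal_mult[symmetric])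
      finally show ?thesis .
    qed
    then show "(\<integral>\<^sup>+q. ennreal ((cmod (fst (snd q) - snd (snd q) * A (fst q)))\<^sup>2 / D (fst q)) \<partial>ext_law) = ennreal 1"
      by (subst nn_integral_ext) (simp_all add: nn_integral_cgauss v emeasure_space_1)
  qed (auto intro!: AE_I2 simp: D_pos less_imp_le)
  have 2: "has_bochner_integral ext_law (\<lambda>q. ln (D (fst q))) (\<integral>\<omega>. ln (D \<omega>) \<partial>M)"
  proof -
    have "integrable (distr ext_law M fst) (\<lambda>\<omega>. ln (D \<omega>))"
      unfolding distr_ext_law_fst by (rule integrable_ln_D)
    then have "integrable ext_law (\<lambda>q. ln (D (fst q)))"
      by (subst (asm) integrable_distr_eq) auto
    moreover have "(\<integral>q. ln (D (fst q)) \<partial>ext_law) = (\<integral>\<omega>. ln (D \<omega>) \<partial>distr ext_law M fst)"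
      by (subst integral_distr) auto
    ultimately show ?thesis
      unfolding distr_ext_law_fst by (simp add: has_bochner_integral_iff)
  qed
  have 3: "has_bochner_integral ext_law (\<lambda>q. - ln pi) (- ln pi)"
    using ext.prob_space by (simp add: has_bochner_integral_iff)
  have "has_bochner_integral ext_law (\<lambda>q. - ln pi - ln (D (fst q))
      - (cmod (fst (snd q) - snd (snd q) * A (fst q)))\<^sup>2 / D (fst q))
     (- ln pi - (\<integral>\<omega>. ln (D \<omega>) \<partial>M) - 1)"
    by (intro has_bochner_integral_diff 1 2 3)
  then show ?thesis
    using D_pos[THEN less_imp_neq, symmetric] by (simp add: ln_cgauss D_pos ln_mult)
qed

lemma nn_integral_cond_density: "(\<integral>\<^sup>+y. ennreal (cond_density y s) \<partial>lborel) = 1"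
proof -
  interpret MP: pair_sigma_finite M "lborel :: complex measure" ..
  have "(\<integral>\<^sup>+y. ennreal (cond_density y s) \<partial>lborel)
      = (\<integral>\<^sup>+\<omega>. \<integral>\<^sup>+y. ennreal (cgauss (D \<omega>) (y - s * A \<omega>)) \<partial>lborel \<partial>M)"
    unfolding cond_density_eq by (rule MP.Fubini') measurable
  then show ?thesis
    by (simp add: nn_integral_cgauss_shift D_pos emeasure_space_1)
qed

lemma nn_integral_output_density: "(\<integral>\<^sup>+y. ennreal (output_density y) \<partial>lborel) = 1"
proof -
  have "(\<integral>\<^sup>+y. ennreal (output_density y) \<partial>lborel)
      = (\<integral>\<^sup>+s. \<integral>\<^sup>+y. ennreal (cgauss v s) * ennreal (cond_density y s) \<partial>lborel \<partial>lborel)"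
    unfolding output_density_eq by (rule lborel_pair.Fubini') measurable
  then show ?thesis
    by (simp add: nn_integral_cmult nn_integral_cond_density nn_integral_cgauss v)
qed

section \<open>Mutual information and its two bounds\<close>

lemma mutual_information_eq_extended:
  "mutual_information 2 borel borel Y S
    = (\<integral>q. log 2 (cond_density (fst (snd q)) (snd (snd q)) / output_density (fst (snd q))) \<partial>ext_law)"
proof -
  interpret information_space M 2 by unfold_locales simp
  let ?Pxy = "\<lambda>p. cgauss v (snd p) * cond_density (fst p) (snd p)"
  have j: "distributed M (lborel \<Otimes>\<^sub>M lborel) (\<lambda>\<omega>. (Y \<omega>, S \<omega>)) (\<lambda>p. ennreal (?Pxy p))"
    using joint by (simp add: cond_density_def split_beta')
  have nn: "0 \<le> cgauss v s" "0 \<le> cond_density y s" "0 \<le> output_density y" for y s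
    by (simp_all add: less_imp_le cgauss_pos v cond_density_pos output_density_pos)
  have Y: "distributed M lborel Y (\<lambda>y. ennreal (output_density y))"
    using distr_marginal1[OF sigma_finite_lborel sigma_finite_lborel j] nn
    by (simp add: output_density_eq ennreal_mult)
  have S: "distributed M lborel S (\<lambda>s. ennreal (cgauss v s))"
    using distr_marginal2[OF sigma_finite_lborel sigma_finite_lborel j] nn
    by (simp add: ennreal_mult nn_integral_cmult nn_integral_cond_density)
  \<comment> \<open>The definition only uses the measurable sets of the two target measures, and
    these are the same for \<open>borel\<close> and \<open>lborel\<close>; the density formula needs
    the latter.\<close>
  have "mutual_information 2 borel borel Y S = mutual_information 2 lborel lborel Y S"
    unfolding mutual_information_def
    by (intro arg_cong2[where f="KL_divergence 2"] arg_cong2[where f="(\<Otimes>\<^sub>M)"] distr_cong refl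
      sets_pair_measure_cong) simp_all
  also have "\<dots> = (\<integral>p. ?Pxy p * log 2 (?Pxy p / (output_density (fst p) * cgauss v (snd p))) \<partial>(lborel \<Otimes>\<^sub>M lborel))"
    by (rule mutual_information_distr[OF sigma_finite_lborel sigma_finite_lborel Y _ S _ j]) (simp_all add: nn)
  also have "\<dots> = (\<integral>p. ?Pxy p * log 2 (cond_density (fst p) (snd p) / output_density (fst p)) \<partial>(lborel \<Otimes>\<^sub>M lborel))"
    using cgauss_pos[OF v] by (simp add: less_imp_neq[symmetric])
  also have "\<dots> = (\<integral>\<omega>. log 2 (cond_density (fst (Y \<omega>, S \<omega>)) (snd (Y \<omega>, S \<omega>)) / output_density (fst (Y \<omega>, S \<omega>))) \<partial>M)"
    by (rule distributed_integral[OF j]) (auto simp: nn)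
  also have "\<dots> = (\<integral>q. log 2 (cond_density (fst (snd q)) (snd (snd q)) / output_density (fst (snd q))) \<partial>ext_law)"
    by (rule integral_ext_output[symmetric]) measurable
  finally show ?thesis .
qed


abbreviation (input) "mean_noise \<equiv> \<integral>\<omega>. D \<omega> \<partial>M"

definition output_power :: real where
  "output_power = v * (\<integral>\<omega>. (cmod (A \<omega>))\<^sup>2 \<partial>M) + mean_noise"

lemma mean_noise_pos: "0 < mean_noise"
proof -
  have "d = (\<integral>\<omega>. d \<partial>M)" by (simp add: prob_space)
  also have "\<dots> \<le> mean_noise" using D integrable_D by (intro integral_mono) auto
  finally show ?thesis using d by simp
qed

lemma output_power_pos: "0 < output_power"
  unfolding output_power_def using v mean_noise_pos
  by (intro add_nonneg_pos mult_nonneg_nonneg Bochner_Integration.integral_nonneg) auto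

lemma has_bochner_integral_output_power:
  "has_bochner_integral ext_law (\<lambda>q. (cmod (fst (snd q)))\<^sup>2) output_power"
  using has_bochner_integral_quadratic[of 0 1] by (simp add: output_power_def)

lemma has_bochner_integral_input_power:
  "has_bochner_integral ext_law (\<lambda>q. (cmod (snd (snd q)))\<^sup>2) v"
  using has_bochner_integral_quadratic[of 1 0] by (simp add: prob_space)

lemma has_bochner_integral_ln_cgauss:
  assumes "0 < u" and "has_bochner_integral ext_law (\<lambda>q. (cmod (f q))\<^sup>2) w"
  shows "has_bochner_integral ext_law (\<lambda>q. ln (cgauss u (f q))) (- ln (pi * u) - w / u)"
proof -
  have "has_bochner_integral ext_law (\<lambda>q. - ln (pi * u)) (- ln (pi * u))"
    using ext.prob_space by (simp add: has_bochner_integral_iff)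
  moreover have "has_bochner_integral ext_law (\<lambda>q. (cmod (f q))\<^sup>2 / u) (w / u)"
    using assms by (intro has_bochner_integral_divide_zero) auto
  ultimately have "has_bochner_integral ext_law (\<lambda>q. - ln (pi * u) - (cmod (f q))\<^sup>2 / u) (- ln (pi * u) - w / u)"
    by (rule has_bochner_integral_diff)
  then show ?thesis using assms(1) by (simp add: ln_cgauss)
qed

text \<open>Any competitor with integrable logarithm serves for Gibbs' inequality. The normal law of
  the output power is taken for every input, because its logarithm is a second moment already known
  to be finite.\<close>

lemma integrable_ln_cond_density:
  "integrable ext_law (\<lambda>q. ln (cond_density (fst (snd q)) (snd (snd q))))"
proof (rule ext.gibbs_integrable_ln[where a="\<lambda>q. cgauss output_power (fst (snd q))" and B="1 / (pi * d)"])
  have "(\<integral>\<^sup>+q. ennreal (cgauss output_power (fst (snd q)) / cond_density (fst (snd q)) (snd (snd q))) \<partial>ext_law)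
    = (\<integral>\<^sup>+y. \<integral>\<^sup>+s. ennreal (cgauss v s) * ennreal (cgauss output_power y) \<partial>lborel \<partial>lborel)"
    by (subst nn_integral_ext_output(1))
      (simp_all add: ennreal_mult_divide cond_density_pos less_imp_le cgauss_pos v output_power_pos)
  also have "\<dots> = 1"
    by (simp add: nn_integral_multc nn_integral_cgauss v output_power_pos)
  finally show "(\<integral>\<^sup>+q. ennreal (cgauss output_power (fst (snd q)) / cond_density (fst (snd q)) (snd (snd q))) \<partial>ext_law) \<le> 1"
    by simp
qed (use has_bochner_integral_ln_cgauss[OF output_power_pos has_bochner_integral_output_power] in
  \<open>auto simp: has_bochner_integral_iff cgauss_pos output_power_pos cond_density_pos cond_density_le\<close>)

lemma nn_integral_cgauss_output_density:
  "(\<integral>\<^sup>+q. ennreal (cgauss output_power (fst (snd q)) / output_density (fst (snd q))) \<partial>ext_law) = 1"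
proof -
  have "(\<integral>\<^sup>+q. ennreal (cgauss output_power (fst (snd q)) / output_density (fst (snd q))) \<partial>ext_law)
    = (\<integral>\<^sup>+y. ennreal (output_density y) * ennreal (cgauss output_power y / output_density y) \<partial>lborel)"
    by (subst nn_integral_ext_output(1)) (simp_all add: nn_integral_multc output_density_eq)
  also have "\<dots> = 1"
    by (simp add: ennreal_mult_divide output_density_pos less_imp_le cgauss_pos output_power_pos nn_integral_cgauss)
  finally show ?thesis .
qed

lemma integrable_ln_output_density: "integrable ext_law (\<lambda>q. ln (output_density (fst (snd q))))"
proof (rule ext.gibbs_integrable_ln[where a="\<lambda>q. cgauss output_power (fst (snd q))" and B="1 / (pi * d)"])
  show "integrable ext_law (\<lambda>q. ln (cgauss output_power (fst (snd q))))"
    by (rule integrable.intros[OF has_bochner_integral_ln_cgauss[OF output_power_pos has_bochner_integral_output_power]])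
  show "(\<integral>\<^sup>+q. ennreal (cgauss output_power (fst (snd q)) / output_density (fst (snd q))) \<partial>ext_law) \<le> 1"
    by (simp only: nn_integral_cgauss_output_density order_refl)
qed (simp_all add: cgauss_pos output_power_pos output_density_pos output_density_le)

lemma mutual_information_eq_ln:
  "mutual_information 2 borel borel Y S * ln 2
    = (\<integral>q. ln (cond_density (fst (snd q)) (snd (snd q))) \<partial>ext_law)
      - (\<integral>q. ln (output_density (fst (snd q))) \<partial>ext_law)"
  unfolding mutual_information_eq_extended log_def
  using integrable_ln_cond_density integrable_ln_output_density
    cond_density_pos[THEN less_imp_neq, symmetric] output_density_pos[THEN less_imp_neq, symmetric]
  by (simp add: ln_div cond_density_pos output_density_pos)

text \<open>Two entropy inequalities: revealing the gains does not increase the conditional entropy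
  of the output, and among laws of given power the normal one has the largest entropy. The terms ln
  pi and 1 occur in both entropies and cancel.\<close>

lemma mutual_information_le:
  "mutual_information 2 borel borel Y S * ln 2 \<le> ln output_power - (\<integral>\<omega>. ln (D \<omega>) \<partial>M)"
proof -
  let ?k = "\<lambda>q. cgauss (D (fst q)) (fst (snd q) - snd (snd q) * A (fst q))"
  note k = has_bochner_integral_ln_cgauss_D[unfolded has_bochner_integral_iff]
  note g = has_bochner_integral_ln_cgauss[OF output_power_pos has_bochner_integral_output_power,
      unfolded has_bochner_integral_iff]
  have "(\<integral>\<^sup>+q. ennreal (cond_density (fst (snd q)) (snd (snd q)) / ?k q) \<partial>ext_law)
    = (\<integral>\<^sup>+\<omega>. \<integral>\<^sup>+s. ennreal (cgauss v s) * (\<integral>\<^sup>+z. ennreal (cond_density (s * A \<omega> + z) s) \<partial>lborel) \<partial>lborel \<partial>M)"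
    by (subst nn_integral_ext)
      (simp_all add: ennreal_mult_divide cgauss_pos D_pos less_imp_le cond_density_pos)
  also have "\<dots> = 1"
    using nn_integral_complex_shift(1)[of "\<lambda>z. ennreal (cond_density z s)" "s * A \<omega>" for s \<omega>]
    by (simp add: nn_integral_cond_density nn_integral_cgauss v emeasure_space_1)
  finally have "(\<integral>q. ln (cond_density (fst (snd q)) (snd (snd q))) \<partial>ext_law) \<le> (\<integral>q. ln (?k q) \<partial>ext_law)"
    using k integrable_ln_cond_density
    by (intro ext.gibbs_inequality) (auto simp: cgauss_pos D_pos cond_density_pos)
  moreover have "(\<integral>q. ln (cgauss output_power (fst (snd q))) \<partial>ext_law) \<le> (\<integral>q. ln (output_density (fst (snd q))) \<partial>ext_law)"
    using g integrable_ln_output_density nn_integral_cgauss_output_density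
    by (intro ext.gibbs_inequality) (auto simp: cgauss_pos output_power_pos output_density_pos)
  ultimately show ?thesis
    using k g output_power_pos unfolding mutual_information_eq_ln by (simp add: ln_mult)
qed

text \<open>The true posterior \<open>?b\<close> of the input is compared with a normal density
  \<open>?a\<close> around \<open>c * y\<close> of variance \<open>e\<close>. As \<open>e\<close> is
  exactly the mean square error of that estimate, the quadratic term of \<open>ln ?a\<close> has
  mean 1 and cancels the 1 in the entropy of the input. The total mass of the competitor is computed
  with the true output law.\<close>

lemma mutual_information_ge:
  fixes c :: real
  defines "e \<equiv> v * (\<integral>\<omega>. (cmod (1 - of_real c * A \<omega>))\<^sup>2 \<partial>M) + c\<^sup>2 * mean_noise"
  assumes e: "0 < e"
  shows "ln (v / e) \<le> mutual_information 2 borel borel Y S * ln 2"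
proof -
  have q: "has_bochner_integral ext_law (\<lambda>q. (cmod (snd (snd q) - of_real c * fst (snd q)))\<^sup>2) e"
    using has_bochner_integral_quadratic[of 1 "- of_real c"] by (simp add: e_def)
  let ?a = "\<lambda>q :: 'a \<times> complex \<times> complex. cgauss e (snd (snd q) - of_real c * fst (snd q))"
  let ?b = "\<lambda>q :: 'a \<times> complex \<times> complex. cgauss v (snd (snd q)) * cond_density (fst (snd q)) (snd (snd q)) / output_density (fst (snd q))"
  note a = has_bochner_integral_ln_cgauss[OF e q, unfolded has_bochner_integral_iff]
  note s = has_bochner_integral_ln_cgauss[OF v has_bochner_integral_input_power, unfolded has_bochner_integral_iff]
  note pos = cgauss_pos[OF v] cgauss_pos[OF e] cond_density_pos output_density_pos
  have ln_b: "ln (?b q) = ln (cgauss v (snd (snd q))) + ln (cond_density (fst (snd q)) (snd (snd q)))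
      - ln (output_density (fst (snd q)))" for q
    using pos[THEN less_imp_neq, symmetric] pos by (simp add: ln_mult ln_div)
  have "(\<integral>\<^sup>+q. ennreal (?a q / ?b q) \<partial>ext_law)
     = (\<integral>\<^sup>+y. \<integral>\<^sup>+s. ennreal (output_density y) * ennreal (cgauss e (s - of_real c * y)) \<partial>lborel \<partial>lborel)"
  proof -
    have "ennreal (cgauss v s) * ennreal (cond_density y s) *
        ennreal (cgauss e (s - of_real c * y) / (cgauss v s * cond_density y s / output_density y))
      = ennreal (output_density y) * ennreal (cgauss e (s - of_real c * y))" for y s
      using pos[THEN less_imp_neq, symmetric] pos[THEN less_imp_le]
      by (simp add: ennreal_mult[symmetric])
    then show ?thesis
      by (subst nn_integral_ext_output(1)) simp_all
  qed
  also have "\<dots> = 1"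
    by (simp add: nn_integral_cmult nn_integral_cgauss_shift e nn_integral_output_density)
  finally have "(\<integral>q. ln (?a q) \<partial>ext_law) \<le> (\<integral>q. ln (?b q) \<partial>ext_law)"
    using a s integrable_ln_cond_density integrable_ln_output_density
    by (intro ext.gibbs_inequality) (auto simp: pos ln_b)
  also have "\<dots> = - ln (pi * v) - v / v + mutual_information 2 borel borel Y S * ln 2"
    unfolding ln_b mutual_information_eq_ln using s integrable_ln_cond_density integrable_ln_output_density
    by simp
  finally show ?thesis
    using a e v by (simp add: ln_mult ln_div)
qed

lemma mutual_information_ge_snr:
  assumes mu: "(\<integral>\<omega>. Re (A \<omega>) \<partial>M) = \<mu>"
  shows "ln (output_power / (output_power - v * \<mu>\<^sup>2)) \<le> mutual_information 2 borel borel Y S * ln 2"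
    and "0 < output_power - v * \<mu>\<^sup>2"
proof -
  define a2 where "a2 = (\<integral>\<omega>. (cmod (A \<omega>))\<^sup>2 \<partial>M)"
  \<comment> \<open>The minimiser over real \<open>c\<close> of the mean square error
    \<open>v - 2 * c * v * \<mu> + c\<^sup>2 * output_power\<close>.\<close>
  define c where "c = v * \<mu> / output_power"
  have sq: "(\<integral>\<omega>. (cmod (1 - of_real c * A \<omega>))\<^sup>2 \<partial>M) = 1 - 2 * c * \<mu> + c\<^sup>2 * a2" for c
  proof -
    have "(cmod (1 - of_real c * A \<omega>))\<^sup>2 = 1 - 2 * c * Re (A \<omega>) + c\<^sup>2 * (cmod (A \<omega>))\<^sup>2" for \<omega>
      unfolding cmod_power2 by simp algebra
    then show ?thesis
      using integrable_A integrable_A2 mu by (simp add: a2_def prob_space)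
  qed
  have p: "output_power = v * a2 + mean_noise"
    by (simp add: output_power_def a2_def)
  have e: "v * (\<integral>\<omega>. (cmod (1 - of_real c * A \<omega>))\<^sup>2 \<partial>M) + c\<^sup>2 * mean_noise
      = v * (output_power - v * \<mu>\<^sup>2) / output_power"
  proof -
    have "v * (1 - 2 * c * \<mu> + c\<^sup>2 * a2) + c\<^sup>2 * mean_noise = v - 2 * c * v * \<mu> + c\<^sup>2 * output_power"
      unfolding p by (simp add: algebra_simps)
    also have "\<dots> = v * (output_power - v * \<mu>\<^sup>2) / output_power"
      unfolding c_def using output_power_pos by (simp add: field_simps power2_eq_square)
    finally show ?thesis unfolding sq .
  qed
  have nn: "0 \<le> v * (\<integral>\<omega>. (cmod (1 - of_real c * A \<omega>))\<^sup>2 \<partial>M)"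
    using v by (intro mult_nonneg_nonneg Bochner_Integration.integral_nonneg) auto
  \<comment> \<open>The positivity of the remaining noise
    \<open>output_power - v * \<mu>\<^sup>2\<close> is read off from that of the error: for c = 0
    the error is \<open>v\<close>, otherwise the noise contributes at least c^2 times its
    mean.\<close>
  have pos: "0 < v * (\<integral>\<omega>. (cmod (1 - of_real c * A \<omega>))\<^sup>2 \<partial>M) + c\<^sup>2 * mean_noise"
  proof (cases "c = 0")
    case True
    then show ?thesis using v by (simp add: prob_space)
  next
    case False
    then show ?thesis using nn mean_noise_pos by (intro add_nonneg_pos) auto
  qed
  then show "0 < output_power - v * \<mu>\<^sup>2"
    unfolding e using v output_power_pos by (simp add: zero_less_divide_iff zero_less_mult_iff)
  have "v / (v * (output_power - v * \<mu>\<^sup>2) / output_power) = output_power / (output_power - v * \<mu>\<^sup>2)"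
    using v by simp
  with mutual_information_ge[OF pos]
  show "ln (output_power / (output_power - v * \<mu>\<^sup>2)) \<le> mutual_information 2 borel borel Y S * ln 2"
    unfolding e by simp
qed

end

section \<open>Linear fading\<close>

text \<open>Fubini on the product law, pulled back to two copies of the sample space. With
  \<open>X\<close> the gains, freezing them at \<omega>' replaces conditional expectation in what
  follows.\<close>

lemma (in prob_space) nn_integral_indep_pair:
  assumes ind: "indep_var S X T Y" and [measurable]: "f \<in> borel_measurable (S \<Otimes>\<^sub>M T)"
  shows "(\<integral>\<^sup>+\<omega>. f (X \<omega>, Y \<omega>) \<partial>M) = (\<integral>\<^sup>+\<omega>'. \<integral>\<^sup>+\<omega>. f (X \<omega>', Y \<omega>) \<partial>M \<partial>M)"
proof -
  have [measurable]: "X \<in> measurable M S" "Y \<in> measurable M T"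
    and eq: "distr M S X \<Otimes>\<^sub>M distr M T Y = distr M (S \<Otimes>\<^sub>M T) (\<lambda>\<omega>. (X \<omega>, Y \<omega>))"
    using ind unfolding indep_var_distribution_eq by auto
  interpret Y: prob_space "distr M T Y" by (rule prob_space_distr) simp
  have "(\<integral>\<^sup>+\<omega>. f (X \<omega>, Y \<omega>) \<partial>M) = (\<integral>\<^sup>+p. f p \<partial>(distr M S X \<Otimes>\<^sub>M distr M T Y))"
    unfolding eq by (subst nn_integral_distr) simp_all
  also have "\<dots> = (\<integral>\<^sup>+x. \<integral>\<^sup>+y. f (x, y) \<partial>distr M T Y \<partial>distr M S X)"
    by (rule Y.nn_integral_fst[symmetric]) simp
  also have "\<dots> = (\<integral>\<^sup>+\<omega>'. \<integral>\<^sup>+y. f (X \<omega>', y) \<partial>distr M T Y \<partial>M)"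
    by (subst nn_integral_distr) simp_all
  also have "\<dots> = (\<integral>\<^sup>+\<omega>'. \<integral>\<^sup>+\<omega>. f (X \<omega>', Y \<omega>) \<partial>M \<partial>M)"
    by (intro nn_integral_cong, subst nn_integral_distr) (auto intro!: measurable_compose[OF _ assms(2)] measurable_Pair1' dest: measurable_space[OF \<open>X \<in> measurable M S\<close>])
  finally show ?thesis .
qed

lemma (in prob_space) complex_normal_pair_nn_integral:
  assumes ind: "indep_var borel Z borel S"
    and Z: "complex_normal M u Z" and S: "complex_normal M v S"
    and [measurable]: "f \<in> borel_measurable (borel \<Otimes>\<^sub>M borel)"
  shows "(\<integral>\<^sup>+\<omega>. f (Z \<omega>, S \<omega>) \<partial>M)
    = (\<integral>\<^sup>+s. \<integral>\<^sup>+z. ennreal (cgauss v s) * ennreal (cgauss u z) * f (z, s) \<partial>lborel \<partial>lborel)"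
proof -
  note [measurable] = complex_normal_measurable[OF Z] complex_normal_measurable[OF S]
  have "(\<integral>\<^sup>+\<omega>. f (Z \<omega>, S \<omega>) \<partial>M) = (\<integral>\<^sup>+\<omega>'. \<integral>\<^sup>+\<omega>. f (Z \<omega>', S \<omega>) \<partial>M \<partial>M)"
    by (rule nn_integral_indep_pair[OF ind]) simp
  also have "\<dots> = (\<integral>\<^sup>+\<omega>'. \<integral>\<^sup>+s. ennreal (cgauss v s) * f (Z \<omega>', s) \<partial>lborel \<partial>M)"
    by (subst distributed_nn_integral[OF complex_normal_distributed[OF S]]) simp_all
  also have "\<dots> = (\<integral>\<^sup>+z. ennreal (cgauss u z) * (\<integral>\<^sup>+s. ennreal (cgauss v s) * f (z, s) \<partial>lborel) \<partial>lborel)"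
    by (subst distributed_nn_integral[OF complex_normal_distributed[OF Z], symmetric]) simp_all
  also have "\<dots> = (\<integral>\<^sup>+z. \<integral>\<^sup>+s. ennreal (cgauss v s) * ennreal (cgauss u z) * f (z, s) \<partial>lborel \<partial>lborel)"
    by (simp add: nn_integral_cmult[symmetric] mult_ac)
  also have "\<dots> = (\<integral>\<^sup>+s. \<integral>\<^sup>+z. ennreal (cgauss v s) * ennreal (cgauss u z) * f (z, s) \<partial>lborel \<partial>lborel)"
    by (rule lborel_pair.Fubini') simp
  finally show ?thesis .
qed

text \<open>Conditionally on the gains \<open>G\<close>, the interference and noise form a single complex normal variable.\<close>

lemma (in prob_space) distributed_linear_fading:
  fixes X :: "'i \<Rightarrow> 'a \<Rightarrow> complex" and G :: "'a \<Rightarrow> 'i \<Rightarrow> complex"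
    and a :: "('i \<Rightarrow> complex) \<Rightarrow> complex" and \<alpha> :: "'i \<Rightarrow> ('i \<Rightarrow> complex) \<Rightarrow> complex"
  assumes J: "finite J" "i \<notin> J" "l \<notin> insert i J" "insert l (insert i J) \<subseteq> I"
    and indG: "indep_var N G (PiM I (\<lambda>_. borel)) (\<lambda>\<omega>. \<lambda>j\<in>I. X j \<omega>)"
    and ind: "indep_vars (\<lambda>_. borel) X I"
    and i: "complex_normal M u (X i)" "0 < u"
    and l: "complex_normal M v (X l)" "0 < v"
    and XJ: "\<And>j. j \<in> J \<Longrightarrow> complex_normal M (w j) (X j)" "\<And>j. j \<in> J \<Longrightarrow> 0 < w j"
    and [measurable]: "a \<in> borel_measurable N" "\<And>j. \<alpha> j \<in> borel_measurable N"
  defines "Y \<equiv> \<lambda>\<omega>. X l \<omega> * a (G \<omega>) + (X i \<omega> + (\<Sum>j\<in>J. \<alpha> j (G \<omega>) * X j \<omega>))"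
    and "D \<equiv> \<lambda>\<omega>. u + (\<Sum>j\<in>J. (cmod (\<alpha> j (G \<omega>)))\<^sup>2 * w j)"
  shows "distributed M (lborel \<Otimes>\<^sub>M lborel) (\<lambda>\<omega>. (Y \<omega>, X l \<omega>))
    (\<lambda>(y, s). ennreal (cgauss v s * (\<integral>\<omega>. cgauss (D \<omega>) (y - s * a (G \<omega>)) \<partial>M)))"
proof -
  let ?g = "\<lambda>\<omega> y s. cgauss (D \<omega>) (y - s * a (G \<omega>))"
    and ?L = "lborel \<Otimes>\<^sub>M lborel :: (complex \<times> complex) measure"
  have [measurable]: "G \<in> measurable M N" using indG by (rule indep_var_rv1)
  have mX [measurable]: "X j \<in> borel_measurable M" if "j \<in> insert l (insert i J)" for j
    using that J ind by (auto simp: indep_vars_def)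
  have [measurable]: "X l \<in> borel_measurable M" "X i \<in> borel_measurable M" by (auto intro: mX)
  have [measurable]: "Y \<in> borel_measurable M" unfolding Y_def by measurable
  have [measurable]: "D \<in> borel_measurable M" unfolding D_def by measurable
  have uD: "u \<le> D \<omega>" for \<omega>
    unfolding D_def using XJ by (auto intro!: sum_nonneg simp: less_imp_le)
  then have Dpos: "0 < D \<omega>" for \<omega> using i(2) less_le_trans by blast
  define h where "h = (\<lambda>p :: ('i \<Rightarrow> complex) \<times> ('i \<Rightarrow> complex). (snd p l * a (fst p) + (snd p i + (\<Sum>j\<in>J. \<alpha> j (fst p) * snd p j)), snd p l))"
  have [measurable]: "(\<lambda>p. snd p j) \<in> borel_measurable (N \<Otimes>\<^sub>M PiM I (\<lambda>_. borel :: complex measure))"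
    if "j \<in> insert l (insert i J)" for j
    using that J by (intro measurable_compose[OF measurable_snd] measurable_component_singleton) auto
  have h [measurable]: "h \<in> measurable (N \<Otimes>\<^sub>M PiM I (\<lambda>_. borel)) (borel \<Otimes>\<^sub>M borel)"
    unfolding h_def by measurable (use J in auto)
  have YX: "(Y \<omega>, X l \<omega>) = h (G \<omega>, \<lambda>j\<in>I. X j \<omega>)" for \<omega>
    using J unfolding h_def Y_def by (auto intro!: sum.cong)
  have main: "(\<integral>\<^sup>+\<omega>. f (Y \<omega>, X l \<omega>) \<partial>M) = (\<integral>\<^sup>+p. ennreal (cgauss v (snd p)) *
      (\<integral>\<^sup>+\<omega>. ennreal (?g \<omega> (fst p) (snd p)) \<partial>M) * f p \<partial>?L)"
    if [measurable]: "f \<in> borel_measurable (borel \<Otimes>\<^sub>M borel)" for f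
  proof -
    have "(\<integral>\<^sup>+\<omega>. f (Y \<omega>, X l \<omega>) \<partial>M) = (\<integral>\<^sup>+\<omega>'. \<integral>\<^sup>+\<omega>. f (h (G \<omega>', \<lambda>j\<in>I. X j \<omega>)) \<partial>M \<partial>M)"
      unfolding YX by (rule nn_integral_indep_pair[OF indG]) measurable
    also have "\<dots> = (\<integral>\<^sup>+\<omega>'. \<integral>\<^sup>+s. \<integral>\<^sup>+y. ennreal (cgauss v s) * ennreal (?g \<omega>' y s) * f (y, s) \<partial>lborel \<partial>lborel \<partial>M)"
    proof (rule nn_integral_cong)
      fix \<omega>'
      \<comment> \<open>With the gains frozen at \<omega>' all coefficients are constants, so
        destination noise and interference add up to one normal variable of variance
        \<open>D \<omega>'\<close>, independent of the signal.\<close>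
      let ?c = "\<lambda>j. \<alpha> j (G \<omega>')"
      define Z where "Z \<omega> = X i \<omega> + (\<Sum>j\<in>J. ?c j * X j \<omega>)" for \<omega>
      have Z: "complex_normal M (D \<omega>') Z"
        unfolding D_def Z_def using J i XJ
        by (intro complex_normal_sum) (auto intro: indep_vars_subset[OF ind])
      let ?F = "\<lambda>x :: 'i \<Rightarrow> complex. x i + (\<Sum>j\<in>J. ?c j * x j)"
      have "indep_var borel (\<lambda>\<omega>. ?F (\<lambda>k\<in>insert i J. X k \<omega>)) borel (\<lambda>\<omega>. (\<lambda>x. x l) (\<lambda>k\<in>{l}. X k \<omega>))"
        using J by (intro indep_var_functions[OF ind]) auto
      also have "(\<lambda>\<omega>. ?F (\<lambda>k\<in>insert i J. X k \<omega>)) = Z"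
        by (auto simp: Z_def)
      also have "(\<lambda>\<omega>. (\<lambda>x. x l) (\<lambda>k\<in>{l}. X k \<omega>)) = X l"
        by auto
      finally have iZ: "indep_var borel Z borel (X l)" .
      have "(\<integral>\<^sup>+\<omega>. f (h (G \<omega>', \<lambda>j\<in>I. X j \<omega>)) \<partial>M) = (\<integral>\<^sup>+\<omega>. (\<lambda>(z, s). f (s * a (G \<omega>') + z, s)) (Z \<omega>, X l \<omega>) \<partial>M)"
        using J unfolding h_def Z_def by (intro nn_integral_cong) (auto simp: subset_iff intro!: arg_cong[where f=f] sum.cong)
      also have "\<dots> = (\<integral>\<^sup>+s. \<integral>\<^sup>+z. ennreal (cgauss v s) * ennreal (cgauss (D \<omega>') z) * f (s * a (G \<omega>') + z, s) \<partial>lborel \<partial>lborel)"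
        by (subst complex_normal_pair_nn_integral[OF iZ Z l(1)]) simp_all
      also have "\<dots> = (\<integral>\<^sup>+s. \<integral>\<^sup>+y. ennreal (cgauss v s) * ennreal (?g \<omega>' y s) * f (y, s) \<partial>lborel \<partial>lborel)"
      proof (rule nn_integral_cong)
        fix s
        show "(\<integral>\<^sup>+z. ennreal (cgauss v s) * ennreal (cgauss (D \<omega>') z) * f (s * a (G \<omega>') + z, s) \<partial>lborel)
          = (\<integral>\<^sup>+y. ennreal (cgauss v s) * ennreal (?g \<omega>' y s) * f (y, s) \<partial>lborel)"
          by (subst nn_integral_complex_shift(1)[of _ "s * a (G \<omega>')", symmetric]) simp_all
      qed
      finally show "(\<integral>\<^sup>+\<omega>. f (h (G \<omega>', \<lambda>j\<in>I. X j \<omega>)) \<partial>M) = \<dots>" .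
    qed
    also have "\<dots> = (\<integral>\<^sup>+\<omega>'. \<integral>\<^sup>+p. ennreal (cgauss v (snd p)) * ennreal (?g \<omega>' (fst p) (snd p)) * f p \<partial>?L \<partial>M)"
      by (intro nn_integral_cong, subst lborel_pair.nn_integral_snd[symmetric]) simp_all
    \<comment> \<open>Moving the gains to the inner integral produces the mixture density.\<close>
    also have "\<dots> = (\<integral>\<^sup>+p. \<integral>\<^sup>+\<omega>'. ennreal (cgauss v (snd p)) * ennreal (?g \<omega>' (fst p) (snd p)) * f p \<partial>M \<partial>?L)"
    proof -
      have L: "sigma_finite_measure ?L"
        unfolding lborel_prod by (rule sigma_finite_lborel)
      interpret MP: pair_sigma_finite ?L M
        by (rule pair_sigma_finite.intro[OF L]) unfold_locales
      show ?thesis by (rule MP.Fubini') measurable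
    qed
    also have "\<dots> = (\<integral>\<^sup>+p. ennreal (cgauss v (snd p)) *
      (\<integral>\<^sup>+\<omega>. ennreal (?g \<omega> (fst p) (snd p)) \<partial>M) * f p \<partial>?L)"
      by (intro nn_integral_cong) (simp add: nn_integral_cmult nn_integral_multc)
    finally show ?thesis .
  qed
  have conv: "(\<integral>\<^sup>+\<omega>. ennreal (?g \<omega> y s) \<partial>M) = ennreal (\<integral>\<omega>. ?g \<omega> y s \<partial>M)" for y s
  proof (rule nn_integral_eq_integral)
    show "integrable M (\<lambda>\<omega>. ?g \<omega> y s)"
    proof (intro integrable_const_bound[where B="1 / (pi * u)"] AE_I2)
      fix \<omega>
      have "?g \<omega> y s \<le> 1 / (pi * D \<omega>)"
        by (rule cgauss_le[OF Dpos])
      also have "\<dots> \<le> 1 / (pi * u)"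
        using uD[of \<omega>] i(2) by (intro divide_left_mono) auto
      finally show "norm (?g \<omega> y s) \<le> 1 / (pi * u)"
        using cgauss_pos[OF Dpos] by (simp add: less_imp_le)
    qed measurable
  qed (simp add: less_imp_le cgauss_pos Dpos)
  have [measurable]: "(\<lambda>p. \<integral>\<omega>. ?g \<omega> (fst p) (snd p) \<partial>M) \<in> borel_measurable (borel \<Otimes>\<^sub>M borel)"
    by measurable
  show ?thesis
    unfolding distributed_def
  proof (intro conjI measure_eqI)
    show "(\<lambda>\<omega>. (Y \<omega>, X l \<omega>)) \<in> measurable M ?L" by measurable
    show "(\<lambda>(y, s). ennreal (cgauss v s * (\<integral>\<omega>. ?g \<omega> y s \<partial>M))) \<in> borel_measurable ?L"
      by (simp add: split_beta')
    fix B assume "B \<in> sets (distr M ?L (\<lambda>\<omega>. (Y \<omega>, X l \<omega>)))"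
    then have [measurable]: "B \<in> sets (borel \<Otimes>\<^sub>M borel)" by (simp cong: sets_pair_measure_cong)
    then have B: "B \<in> sets ?L" by (simp cong: sets_pair_measure_cong)
    let ?I = "indicator B :: complex \<times> complex \<Rightarrow> ennreal"
    have "emeasure (distr M ?L (\<lambda>\<omega>. (Y \<omega>, X l \<omega>))) B = (\<integral>\<^sup>+\<omega>. ?I (Y \<omega>, X l \<omega>) \<partial>M)"
      using nn_integral_distr[of "\<lambda>\<omega>. (Y \<omega>, X l \<omega>)" M "lborel \<Otimes>\<^sub>M lborel" ?I] B by simp
    also have "\<dots> = (\<integral>\<^sup>+p. (case p of (y, s) \<Rightarrow> ennreal (cgauss v s * (\<integral>\<omega>. ?g \<omega> y s \<partial>M))) * ?I p \<partial>?L)"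
      using l(2) by (subst main) (auto simp: conv split_beta' ennreal_mult' less_imp_le cgauss_pos intro!: nn_integral_cong)
    also have "\<dots> = emeasure (density ?L (\<lambda>(y, s). ennreal (cgauss v s * (\<integral>\<omega>. ?g \<omega> y s \<partial>M)))) B"
      using B by (subst emeasure_density) (auto simp: split_beta')
    finally show "emeasure (distr M ?L (\<lambda>\<omega>. (Y \<omega>, X l \<omega>))) B = \<dots>" .
  qed simp
qed

section \<open>Square integrability and independence\<close>

text \<open>The two notions differ only at 0, where \<open>Arg\<close> is 0 and hence the phase is
  1, whereas \<open>sgn\<close> is 0. Measurability is inherited from \<open>sgn\<close>.\<close>

lemma phase_eq: "phase z = (if z = 0 then 1 else sgn z)"
proof (cases "z = 0")
  case False
  have "of_real (cmod z) * phase z = z"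
    unfolding phase_def by (rule Arg_eq[OF False, symmetric])
  then have "phase z = z / of_real (cmod z)"
    using False by (metis nonzero_mult_div_cancel_left norm_eq_zero of_real_eq_0_iff)
  then show ?thesis
    using False by (simp add: sgn_eq)
qed (simp add: phase_def Arg_zero)

lemma phase_measurable [measurable]: "phase \<in> borel_measurable borel"
  unfolding phase_eq[abs_def] by measurable

lemma norm_phase [simp]: "cmod (phase z) = 1"
  by (simp add: phase_def)

text \<open>The source of coherent combining: a relay that compensates the phase of a gain replaces
  it by its modulus, which has positive mean.\<close>

lemma cnj_phase_mult: "cnj (phase z) * z = of_real (cmod z)"
proof (cases "z = 0")
  case False
  have "cnj (phase z) * z = (z * cnj z) / of_real (cmod z)"
    using False by (simp add: phase_eq sgn_eq)
  also have "\<dots> = of_real (cmod z)"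
    using False unfolding complex_norm_square[symmetric] by (simp add: power2_eq_square)
  finally show ?thesis .
qed simp

section \<open>Square-integrable functions\<close>

definition in_L2 :: "'a measure \<Rightarrow> ('a \<Rightarrow> 'b::{real_normed_field, banach, second_countable_topology}) \<Rightarrow> bool" where
  "in_L2 M f \<longleftrightarrow> f \<in> borel_measurable M \<and> integrable M (\<lambda>x. (norm (f x))\<^sup>2)"

lemma in_L2_measurable: "in_L2 M f \<Longrightarrow> f \<in> borel_measurable M"
  by (simp add: in_L2_def)

lemma in_L2_norm: "in_L2 M f \<Longrightarrow> integrable M (\<lambda>x. (norm (f x))\<^sup>2)"
  by (simp add: in_L2_def)

lemma in_L2_mult:
  assumes f: "in_L2 M f" and g: "in_L2 M g"
  shows "integrable M (\<lambda>x. f x * g x)"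
proof (rule Bochner_Integration.integrable_bound)
  note [measurable] = in_L2_measurable[OF f] in_L2_measurable[OF g]
  show "integrable M (\<lambda>x. (norm (f x))\<^sup>2 + (norm (g x))\<^sup>2)"
    using f g by (simp add: in_L2_norm)
  show "(\<lambda>x. f x * g x) \<in> borel_measurable M" by measurable
  show "AE x in M. norm (f x * g x) \<le> norm ((norm (f x))\<^sup>2 + (norm (g x))\<^sup>2)"
  proof (rule AE_I2)
    fix x
    have "2 * (norm (f x) * norm (g x)) \<le> (norm (f x))\<^sup>2 + (norm (g x))\<^sup>2"
      using sum_squares_bound[of "norm (f x)" "norm (g x)"] by simp
    moreover have "0 \<le> norm (f x) * norm (g x)" by simp
    ultimately show "norm (f x * g x) \<le> norm ((norm (f x))\<^sup>2 + (norm (g x))\<^sup>2)"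
      unfolding norm_mult real_norm_def by linarith
  qed
qed

lemma in_L2_add:
  assumes f: "in_L2 M f" and g: "in_L2 M g"
  shows "in_L2 M (\<lambda>x. f x + g x)"
proof -
  note [measurable] = in_L2_measurable[OF f] in_L2_measurable[OF g]
  have "integrable M (\<lambda>x. (norm (f x + g x))\<^sup>2)"
  proof (rule Bochner_Integration.integrable_bound)
    show "integrable M (\<lambda>x. 2 * (norm (f x))\<^sup>2 + 2 * (norm (g x))\<^sup>2)"
      using f g by (simp add: in_L2_norm)
    show "(\<lambda>x. (norm (f x + g x))\<^sup>2) \<in> borel_measurable M" by measurable
    show "AE x in M. norm ((norm (f x + g x))\<^sup>2) \<le> norm (2 * (norm (f x))\<^sup>2 + 2 * (norm (g x))\<^sup>2)"
    proof (rule AE_I2)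
      fix x
      have "(norm (f x + g x))\<^sup>2 \<le> (norm (f x) + norm (g x))\<^sup>2"
        by (intro power_mono norm_triangle_ineq) simp
      also have "\<dots> \<le> 2 * (norm (f x))\<^sup>2 + 2 * (norm (g x))\<^sup>2"
        using sum_squares_bound[of "norm (f x)" "norm (g x)"] by (simp add: power2_sum)
      finally show "norm ((norm (f x + g x))\<^sup>2) \<le> norm (2 * (norm (f x))\<^sup>2 + 2 * (norm (g x))\<^sup>2)"
        by simp
    qed
  qed
  then show ?thesis by (simp add: in_L2_def)
qed

lemma in_L2_cmult:
  "in_L2 M f \<Longrightarrow> in_L2 M (\<lambda>x. c * f x)"
  by (auto simp: in_L2_def norm_mult power_mult_distrib)

lemma in_L2_zero: "in_L2 M (\<lambda>x. 0)"
  by (simp add: in_L2_def)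

lemma in_L2_sum:
  "(\<And>i. i \<in> I \<Longrightarrow> in_L2 M (f i)) \<Longrightarrow> in_L2 M (\<lambda>x. \<Sum>i\<in>I. f i x)"
  by (induction I rule: infinite_finite_induct) (simp_all add: in_L2_zero in_L2_add)

lemma cnj_measurable [measurable]: "cnj \<in> borel_measurable borel"
  by (intro borel_measurable_continuous_onI continuous_intros)

lemma in_L2_cnj: "in_L2 M f \<Longrightarrow> in_L2 M (\<lambda>x. cnj (f x))"
  by (auto simp: in_L2_def)

lemma in_L2_Re:
  assumes f: "in_L2 M f"
  shows "in_L2 M (\<lambda>x. Re (f x))"
proof -
  note [measurable] = in_L2_measurable[OF f]
  have "integrable M (\<lambda>x. (norm (Re (f x)))\<^sup>2)"
    by (rule Bochner_Integration.integrable_bound[OF in_L2_norm[OF f]])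
      (auto simp: cmod_power2)
  then show ?thesis by (simp add: in_L2_def)
qed

lemma (in prob_space) in_L2_const: "in_L2 M (\<lambda>x. c)"
  by (simp add: in_L2_def)

lemma (in prob_space) in_L2_imp_integrable:
  "in_L2 M f \<Longrightarrow> integrable M f"
  using in_L2_mult[OF in_L2_const, of f 1] by simp

section \<open>Independence through generated sigma-algebras\<close>

text \<open>The sigma-algebras generated by \<open>f\<close> and \<open>g\<close> are contained in
  those of \<open>X\<close> and \<open>Y\<close>. Independence can then be derived from
  measurability alone, without writing \<open>f\<close> and \<open>g\<close> as explicit
  compositions.\<close>

lemma (in prob_space) indep_var_vimage_algebra:
  assumes ind: "indep_var S X T Y"
    and f: "f \<in> measurable (vimage_algebra (space M) X S) S'"
    and g: "g \<in> measurable (vimage_algebra (space M) Y T) T'"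
  shows "indep_var S' f T' g"
proof -
  have X: "X \<in> measurable M S" and Y: "Y \<in> measurable M T"
    using ind by (blast dest: indep_var_rv1 indep_var_rv2)+
  have sub: "sets (vimage_algebra (space M) Z R) \<subseteq> sets M" if "Z \<in> measurable M R" for Z and R :: "'d measure"
    unfolding sets_vimage_algebra
    using that by (intro sets.sigma_sets_subset) (auto intro: measurable_sets)
  have gen: "sigma_sets (space M) {f -` A \<inter> space M |A. A \<in> sets R'} \<subseteq> sets (vimage_algebra (space M) Z R)"
    if "f \<in> measurable (vimage_algebra (space M) Z R) R'" for f Z and R R' :: "'d measure"
    using measurable_sets[OF that] sets.sigma_sets_subset[of "{f -` A \<inter> space M |A. A \<in> sets R'}" "vimage_algebra (space M) Z R"]
    by auto
  have meas: "h \<in> measurable M R'" if "h \<in> measurable (vimage_algebra (space M) Z R) R'" "Z \<in> measurable M R"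
    for h Z and R :: "'d measure" and R' :: "'e measure"
    using that(1) sub[OF that(2)] unfolding measurable_def by auto
  show ?thesis
    unfolding indep_var_eq indep_set_def
  proof (intro conjI)
    show "f \<in> measurable M S'" "g \<in> measurable M T'"
      using meas X Y f g by auto
    have "indep_sets (case_bool (sigma_sets (space M) {X -` A \<inter> space M |A. A \<in> sets S})
        (sigma_sets (space M) {Y -` A \<inter> space M |A. A \<in> sets T})) UNIV"
      using ind unfolding indep_var_eq indep_set_def by simp
    then show "indep_sets (case_bool (sigma_sets (space M) {f -` A \<inter> space M |A. A \<in> sets S'})
        (sigma_sets (space M) {g -` A \<inter> space M |A. A \<in> sets T'})) UNIV"
    proof (rule indep_sets_mono_sets)
      show "case_bool (sigma_sets (space M) {f -` A \<inter> space M |A. A \<in> sets S'})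
          (sigma_sets (space M) {g -` A \<inter> space M |A. A \<in> sets T'}) b
        \<subseteq> case_bool (sigma_sets (space M) {X -` A \<inter> space M |A. A \<in> sets S})
          (sigma_sets (space M) {Y -` A \<inter> space M |A. A \<in> sets T}) b" for b
        using measurable_sets[OF f] measurable_sets[OF g]
          sets.sigma_sets_subset[of "{f -` A \<inter> space M |A. A \<in> sets S'}" "vimage_algebra (space M) X S"]
          sets.sigma_sets_subset[of "{g -` A \<inter> space M |A. A \<in> sets T'}" "vimage_algebra (space M) Y T"]
        by (auto simp: sets_vimage_algebra split: bool.splits)
    qed
  qed
qed

locale independent_family = prob_space +
  fixes X :: "'i \<Rightarrow> 'a \<Rightarrow> complex" and I :: "'i set"
  assumes indep: "indep_vars (\<lambda>_. borel) X I"
begin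

text \<open>The sigma-algebra generated by the variables with index in \<open>B\<close>:
  measurability with respect to it means depending on these variables only.\<close>

definition generated :: "'i set \<Rightarrow> 'a measure" where
  "generated B = vimage_algebra (space M) (\<lambda>\<omega>. \<lambda>i\<in>B. X i \<omega>) (PiM B (\<lambda>_. borel))"

lemma measurable_generated: "i \<in> B \<Longrightarrow> X i \<in> borel_measurable (generated B)"
proof -
  assume i: "i \<in> B"
  have "(\<lambda>\<omega>. (\<lambda>i\<in>B. X i \<omega>) i) \<in> borel_measurable (generated B)"
    unfolding generated_def
    by (rule measurable_compose[OF measurable_vimage_algebra1 measurable_component_singleton[OF i]])
      (auto simp: space_PiM)
  then show ?thesis using i by simp
qed

lemma indep_var_generated:
  assumes "A \<inter> B = {}" "A \<subseteq> I" "B \<subseteq> I" "f \<in> borel_measurable (generated A)" "g \<in> borel_measurable (generated B)"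
  shows "indep_var borel f borel g"
  using indep_var_vimage_algebra[OF indep_var_restrict[OF indep assms(1-3)]] assms(4,5)
  unfolding generated_def by blast

lemma
  fixes f g :: "'a \<Rightarrow> 'b::{real_normed_field, banach, second_countable_topology}"
  assumes AB: "A \<inter> B = {}" "A \<subseteq> I" "B \<subseteq> I" "f \<in> borel_measurable (generated A)" "g \<in> borel_measurable (generated B)"
    and "integrable M f" "integrable M g"
  shows expectation_indep_mult: "(\<integral>\<omega>. f \<omega> * g \<omega> \<partial>M) = (\<integral>\<omega>. f \<omega> \<partial>M) * (\<integral>\<omega>. g \<omega> \<partial>M)"
    and integrable_indep_mult: "integrable M (\<lambda>\<omega>. f \<omega> * g \<omega>)"
  using indep_var_lebesgue_integral[OF indep_var_generated[OF AB]] indep_var_integrable[OF indep_var_generated[OF AB]]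
    assms(6,7) by auto

text \<open>A product of two square-integrable functions is in general only integrable; under
  independence the squared norms factor as well.\<close>

lemma in_L2_indep_mult:
  fixes f g :: "'a \<Rightarrow> 'b::{real_normed_field, banach, second_countable_topology}"
  assumes AB: "A \<inter> B = {}" "A \<subseteq> I" "B \<subseteq> I" and m [measurable]: "f \<in> borel_measurable (generated A)" "g \<in> borel_measurable (generated B)"
    and f: "in_L2 M f" and g: "in_L2 M g"
  shows "in_L2 M (\<lambda>\<omega>. f \<omega> * g \<omega>)"
proof -
  have "integrable M (\<lambda>\<omega>. (norm (f \<omega>))\<^sup>2 * (norm (g \<omega>))\<^sup>2)"
    using f g by (intro integrable_indep_mult[OF AB]) (auto simp: in_L2_norm)
  then show ?thesis
    using f g by (auto simp: in_L2_def norm_mult power_mult_distrib)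
qed

end

section \<open>Moments of the relay sums\<close>

text \<open>The destination \<open>m\<close> is fixed, so \<open>C a k\<close> and
  \<open>c k\<close> are the coefficients of relay \<open>k\<close> towards it for source
  \<open>a\<close> and for the relay noise, and \<open>s\<close> is the noise power. The variance
  estimate sees the coefficients through the upper bounds \<open>Cmax\<close> and
  \<open>cmax\<close> only.\<close>

locale relay_rows = independent_family \<Omega> X "gain_labels M K"
  for \<Omega> :: "'a measure" and X :: "label \<Rightarrow> 'a \<Rightarrow> complex" and M K :: nat +
  fixes m :: nat and p :: "nat \<Rightarrow> nat" and C :: "nat \<Rightarrow> nat \<Rightarrow> real" and c :: "nat \<Rightarrow> real"
    and Cmax cmax s :: real
  assumes gain: "\<And>i. i \<in> gain_labels M K \<Longrightarrow> complex_normal \<Omega> 1 (X i)"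
    and m: "m \<in> {1..M}" and p: "\<And>k. k \<in> {1..K} \<Longrightarrow> p k \<in> {1..M}"
    and C: "\<And>a k. a \<in> {1..M} \<Longrightarrow> k \<in> {1..K} \<Longrightarrow> 0 \<le> C a k"
      "\<And>a k. a \<in> {1..M} \<Longrightarrow> k \<in> {1..K} \<Longrightarrow> C a k \<le> Cmax"
    and c: "\<And>k. k \<in> {1..K} \<Longrightarrow> 0 \<le> c k" "\<And>k. k \<in> {1..K} \<Longrightarrow> c k \<le> cmax"
    and s: "0 \<le> s"
begin

text \<open>
  \<open>w a k\<close> is the coefficient with which relay \<open>k\<close> forwards the signal of source \<open>a\<close> to destination
  \<open>m\<close>, and \<open>S n a\<close> below is the sum over the first \<open>n\<close> relays. The conditional noise power at the
  destination is \<open>s + Q K / K\<close>, and \<open>Q n\<close> minus its mean is a martingale in \<open>n\<close> with orthogonal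
  increments: \<open>L n\<close> is the cross term between relay \<open>n + 1\<close> and the earlier ones.
\<close>

definition w :: "nat \<Rightarrow> nat \<Rightarrow> 'a \<Rightarrow> complex" where
  "w a k \<omega> = of_real (C a k) * cnj (phase (X (Dst_gain (p k) k) \<omega>)) * X (Dst_gain m k) \<omega> *
     cnj (phase (X (Src_gain k (p k)) \<omega>)) * X (Src_gain k a) \<omega>"

text \<open>All gains that touch relay \<open>k\<close>. Distinct relays have disjoint rows and are
  therefore independent, whereas the coefficients of different sources within one row share the gain
  towards \<open>m\<close>.\<close>

definition row :: "nat \<Rightarrow> label set" where
  "row k = Src_gain k ` {1..M} \<union> (\<lambda>a. Dst_gain a k) ` {1..M}"

definition past :: "nat \<Rightarrow> label set" where
  "past n = (\<Union>k\<in>{1..n}. row k)"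

lemma row_subset: "k \<in> {1..K} \<Longrightarrow> row k \<subseteq> gain_labels M K"
  by (auto simp: row_def gain_labels_def)

lemma past_subset: "n \<le> K \<Longrightarrow> past n \<subseteq> gain_labels M K"
  using row_subset by (fastforce simp: past_def)

lemma past_row_disjoint: "past n \<inter> row (Suc n) = {}" "row (Suc n) \<inter> past n = {}"
  by (auto simp: past_def row_def)

lemma Src_gain_in: "k \<in> {1..K} \<Longrightarrow> a \<in> {1..M} \<Longrightarrow> Src_gain k a \<in> gain_labels M K"
  and Dst_gain_in: "k \<in> {1..K} \<Longrightarrow> a \<in> {1..M} \<Longrightarrow> Dst_gain a k \<in> gain_labels M K"
  by (auto simp: gain_labels_def)

section \<open>Moments of a single relay coefficient\<close>

lemma measurable_X: "i \<in> gain_labels M K \<Longrightarrow> X i \<in> borel_measurable \<Omega>"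
  using gain complex_normal_measurable by blast

lemma expectation_X: "i \<in> gain_labels M K \<Longrightarrow> expectation (X i) = 0"
  using gain expectation_complex_normal by fastforce

lemma cmod_X_moment:
  "i \<in> gain_labels M K \<Longrightarrow> has_bochner_integral \<Omega> (\<lambda>\<omega>. cmod (X i \<omega>)) (sqrt pi / 2)"
  "i \<in> gain_labels M K \<Longrightarrow> has_bochner_integral \<Omega> (\<lambda>\<omega>. (cmod (X i \<omega>))\<^sup>2) 1"
  "i \<in> gain_labels M K \<Longrightarrow> has_bochner_integral \<Omega> (\<lambda>\<omega>. cmod (X i \<omega>) ^ 4) 2"
  using has_bochner_integral_complex_normal_cmod[OF gain, of i] has_bochner_integral_complex_normal_cmod2[OF gain, of i]
    has_bochner_integral_complex_normal_cmod4[OF gain, of i] by auto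

lemma in_L2_X: "i \<in> gain_labels M K \<Longrightarrow> in_L2 \<Omega> (X i)"
  using cmod_X_moment(2)[of i] measurable_X[of i] by (auto simp: in_L2_def has_bochner_integral_iff)

lemma norm_w: "cmod (w a k \<omega>) = \<bar>C a k\<bar> * (cmod (X (Dst_gain m k) \<omega>) * cmod (X (Src_gain k a) \<omega>))"
  by (simp add: w_def norm_mult)

lemma measurable_w_generated:
  assumes "k \<in> {1..K}" "a \<in> {1..M}" "row k \<subseteq> B"
  shows "w a k \<in> borel_measurable (generated B)"
proof -
  have "{Dst_gain (p k) k, Dst_gain m k, Src_gain k (p k), Src_gain k a} \<subseteq> B"
    using assms p[OF assms(1)] m by (auto simp: row_def)
  then have [measurable]: "X (Dst_gain (p k) k) \<in> borel_measurable (generated B)"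
    "X (Dst_gain m k) \<in> borel_measurable (generated B)" "X (Src_gain k (p k)) \<in> borel_measurable (generated B)"
    "X (Src_gain k a) \<in> borel_measurable (generated B)"
    by (auto intro: measurable_generated)
  show ?thesis unfolding w_def[abs_def] by measurable
qed

lemma measurable_w:
  assumes "k \<in> {1..K}" "a \<in> {1..M}"
  shows "w a k \<in> borel_measurable \<Omega>"
proof -
  have [measurable]: "X (Dst_gain (p k) k) \<in> borel_measurable \<Omega>"
    "X (Dst_gain m k) \<in> borel_measurable \<Omega>" "X (Src_gain k (p k)) \<in> borel_measurable \<Omega>"
    "X (Src_gain k a) \<in> borel_measurable \<Omega>"
    using assms p[OF assms(1)] m by (auto intro!: measurable_X Src_gain_in Dst_gain_in)
  show ?thesis unfolding w_def[abs_def] by measurable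
qed

lemma
  fixes f g :: "complex \<Rightarrow> 'b::{real_normed_field, banach, second_countable_topology}"
  assumes ij: "i \<in> gain_labels M K" "j \<in> gain_labels M K" "i \<noteq> j"
    and [measurable]: "f \<in> borel_measurable borel" "g \<in> borel_measurable borel"
    and int: "integrable \<Omega> (\<lambda>\<omega>. f (X i \<omega>))" "integrable \<Omega> (\<lambda>\<omega>. g (X j \<omega>))"
  shows expectation_two_gains: "expectation (\<lambda>\<omega>. f (X i \<omega>) * g (X j \<omega>)) = expectation (\<lambda>\<omega>. f (X i \<omega>)) * expectation (\<lambda>\<omega>. g (X j \<omega>))"
    and integrable_two_gains: "integrable \<Omega> (\<lambda>\<omega>. f (X i \<omega>) * g (X j \<omega>))"
proof -
  have [measurable]: "X i \<in> borel_measurable (generated {i})" "X j \<in> borel_measurable (generated {j})"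
    by (auto intro: measurable_generated)
  have d: "{i} \<inter> {j} = {}" "{i} \<subseteq> gain_labels M K" "{j} \<subseteq> gain_labels M K"
    using ij by auto
  have m: "(\<lambda>\<omega>. f (X i \<omega>)) \<in> borel_measurable (generated {i})" "(\<lambda>\<omega>. g (X j \<omega>)) \<in> borel_measurable (generated {j})"
    by measurable
  show "expectation (\<lambda>\<omega>. f (X i \<omega>) * g (X j \<omega>)) = expectation (\<lambda>\<omega>. f (X i \<omega>)) * expectation (\<lambda>\<omega>. g (X j \<omega>))"
    and "integrable \<Omega> (\<lambda>\<omega>. f (X i \<omega>) * g (X j \<omega>))"
    using expectation_indep_mult[OF d m int] integrable_indep_mult[OF d m int] .
qed

lemma has_bochner_integral_norm_w:
  assumes k: "k \<in> {1..K}" and a: "a \<in> {1..M}"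
  shows "has_bochner_integral \<Omega> (\<lambda>\<omega>. (cmod (w a k \<omega>))\<^sup>2) ((C a k)\<^sup>2)"
proof -
  note f = cmod_X_moment(2)[OF Dst_gain_in[OF k m], unfolded has_bochner_integral_iff]
  note h = cmod_X_moment(2)[OF Src_gain_in[OF k a], unfolded has_bochner_integral_iff]
  have i: "integrable \<Omega> (\<lambda>\<omega>. (cmod (X (Dst_gain m k) \<omega>))\<^sup>2 * (cmod (X (Src_gain k a) \<omega>))\<^sup>2)"
    using f h k m a by (intro integrable_two_gains[where f="\<lambda>z. (cmod z)\<^sup>2" and g="\<lambda>z. (cmod z)\<^sup>2"] Dst_gain_in Src_gain_in) auto
  have "expectation (\<lambda>\<omega>. (cmod (X (Dst_gain m k) \<omega>))\<^sup>2 * (cmod (X (Src_gain k a) \<omega>))\<^sup>2) = 1 * 1"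
    using f h k m a by (subst expectation_two_gains[where f="\<lambda>z. (cmod z)\<^sup>2" and g="\<lambda>z. (cmod z)\<^sup>2"]) (auto intro: Dst_gain_in Src_gain_in)
  with i show ?thesis
    unfolding norm_w has_bochner_integral_iff
    by (simp add: power_mult_distrib)
qed

lemma in_L2_w: "k \<in> {1..K} \<Longrightarrow> a \<in> {1..M} \<Longrightarrow> in_L2 \<Omega> (w a k)"
  using has_bochner_integral_norm_w[of k a] measurable_w[of k a]
  by (auto simp: in_L2_def has_bochner_integral_iff)

text \<open>Both coefficients carry the same two phase factors, which cancel in
  \<open>w a k * cnj (w b k)\<close>. For a different from b there remains the squared modulus of
  the gain towards \<open>m\<close> times a product of two independent centred source gains,
  although each phase may itself depend on one of these.\<close>

lemma expectation_w_cross: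
  assumes k: "k \<in> {1..K}" and a: "a \<in> {1..M}" and b: "b \<in> {1..M}"
  shows "expectation (\<lambda>\<omega>. w a k \<omega> * cnj (w b k \<omega>)) = (if a = b then of_real ((C a k)\<^sup>2) else 0)"
proof (cases "a = b")
  case True
  have "expectation (\<lambda>\<omega>. w a k \<omega> * cnj (w a k \<omega>)) = of_real (expectation (\<lambda>\<omega>. (cmod (w a k \<omega>))\<^sup>2))"
    unfolding complex_norm_square[symmetric] by (rule integral_complex_of_real)
  then show ?thesis
    using True has_bochner_integral_norm_w[OF k a] by (simp add: has_bochner_integral_iff)
next
  case False
  let ?f = "\<lambda>\<omega>. of_real (C a k * C b k * (cmod (X (Dst_gain m k) \<omega>))\<^sup>2) :: complex"
  let ?ha = "X (Src_gain k a)" and ?hb = "\<lambda>\<omega>. cnj (X (Src_gain k b) \<omega>)"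
  have ph: "cnj (phase z) * phase z = 1" for z
    using complex_norm_square[of "phase z"] by (simp add: mult.commute)
  have e: "w a k \<omega> * cnj (w b k \<omega>) = ?f \<omega> * (?ha \<omega> * ?hb \<omega>)" for \<omega>
  proof -
    have "w a k \<omega> * cnj (w b k \<omega>) = of_real (C a k * C b k) *
       (cnj (phase (X (Dst_gain (p k) k) \<omega>)) * phase (X (Dst_gain (p k) k) \<omega>)) *
       (cnj (phase (X (Src_gain k (p k)) \<omega>)) * phase (X (Src_gain k (p k)) \<omega>)) *
       (X (Dst_gain m k) \<omega> * cnj (X (Dst_gain m k) \<omega>)) * (?ha \<omega> * ?hb \<omega>)"
      by (simp add: w_def)
    then show ?thesis
      unfolding ph of_real_mult complex_norm_square by simp
  qed
  have [measurable]: "X (Dst_gain m k) \<in> borel_measurable (generated {Dst_gain m k})"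
    "X (Src_gain k a) \<in> borel_measurable (generated {Src_gain k a, Src_gain k b})"
    "X (Src_gain k b) \<in> borel_measurable (generated {Src_gain k a, Src_gain k b})"
    by (auto intro: measurable_generated)
  have d2: "{Dst_gain m k} \<inter> {Src_gain k a, Src_gain k b} = {}" "{Dst_gain m k} \<subseteq> gain_labels M K"
    "{Src_gain k a, Src_gain k b} \<subseteq> gain_labels M K"
    using k a b m by (auto intro: Src_gain_in Dst_gain_in)
  have ia: "integrable \<Omega> ?ha" and ib: "integrable \<Omega> ?hb"
    using in_L2_imp_integrable[OF in_L2_X[OF Src_gain_in[OF k a]]]
      in_L2_imp_integrable[OF in_L2_X[OF Src_gain_in[OF k b]]] by simp_all
  have "expectation (\<lambda>\<omega>. ?ha \<omega> * ?hb \<omega>) = expectation ?ha * expectation ?hb"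
    using k a b False ia ib by (intro expectation_two_gains[where f="\<lambda>z. z" and g=cnj] Src_gain_in) auto
  then have e0: "expectation (\<lambda>\<omega>. ?ha \<omega> * ?hb \<omega>) = 0"
    using expectation_X[OF Src_gain_in[OF k a]] by simp
  have i2: "integrable \<Omega> (\<lambda>\<omega>. ?ha \<omega> * ?hb \<omega>)"
    using k a b False ia ib by (intro integrable_two_gains[where f="\<lambda>z. z" and g=cnj] Src_gain_in) auto
  have if': "integrable \<Omega> ?f"
    by (intro integrable_of_real integrable_mult_right integrable.intros[OF cmod_X_moment(2)[OF Dst_gain_in[OF k m]]])
  have "expectation (\<lambda>\<omega>. ?f \<omega> * (?ha \<omega> * ?hb \<omega>)) = 0"
    by (subst expectation_indep_mult[OF d2 _ _ if' i2]) (simp_all add: e0)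
  then show ?thesis using False unfolding e by simp
qed

text \<open>If the relay serves another pair, its gain towards \<open>m\<close> is centred and
  independent of the other factors. If it serves \<open>m\<close> but the source is another one, the
  gain from that source is. Only in the remaining case do both phases fit, and two independent
  moduli of mean sqrt pi / 2 are multiplied.\<close>

lemma expectation_w:
  assumes k: "k \<in> {1..K}" and a: "a \<in> {1..M}"
  shows "expectation (w a k) = (if a = m \<and> p k = m then of_real (C a k * (pi / 4)) else 0)"
proof -
  have pk: "p k \<in> {1..M}" using p k by blast
  let ?Dp = "Dst_gain (p k) k" and ?Dm = "Dst_gain m k" and ?Sp = "Src_gain k (p k)" and ?Sa = "Src_gain k a"
  have in_gain: "?Dp \<in> gain_labels M K" "?Dm \<in> gain_labels M K" "?Sp \<in> gain_labels M K" "?Sa \<in> gain_labels M K"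
    using k a m pk by (auto intro: Src_gain_in Dst_gain_in)
  note [measurable] = in_gain[THEN measurable_X]
  have gen [measurable]:
    "X ?Dm \<in> borel_measurable (generated {?Dm})" "X ?Dp \<in> borel_measurable (generated {?Dp, ?Sp, ?Sa})"
    "X ?Sp \<in> borel_measurable (generated {?Dp, ?Sp, ?Sa})" "X ?Sa \<in> borel_measurable (generated {?Dp, ?Sp, ?Sa})"
    "X ?Sa \<in> borel_measurable (generated {?Sa})" "X ?Dp \<in> borel_measurable (generated {?Dp, ?Dm, ?Sp})"
    "X ?Dm \<in> borel_measurable (generated {?Dp, ?Dm, ?Sp})" "X ?Sp \<in> borel_measurable (generated {?Dp, ?Dm, ?Sp})"
    by (auto intro: measurable_generated)
  note iX = in_gain[THEN in_L2_X, THEN in_L2_imp_integrable]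
  consider "p k \<noteq> m" | "p k = m" "a \<noteq> m" | "p k = m" "a = m" by blast
  then show ?thesis
  proof cases
    case 1
    let ?g = "\<lambda>\<omega>. of_real (C a k) * cnj (phase (X ?Dp \<omega>)) * cnj (phase (X ?Sp \<omega>)) * X ?Sa \<omega>"
    have ig: "integrable \<Omega> ?g"
    proof (rule Bochner_Integration.integrable_bound)
      show "integrable \<Omega> (\<lambda>\<omega>. C a k * cmod (X ?Sa \<omega>))" using iX(4) by auto
    qed (auto simp: norm_mult abs_mult)
    have "w a k = (\<lambda>\<omega>. X ?Dm \<omega> * ?g \<omega>)"
      by (auto simp: w_def)
    moreover have "expectation (\<lambda>\<omega>. X ?Dm \<omega> * ?g \<omega>) = expectation (X ?Dm) * expectation ?g"
      using 1 in_gain iX ig by (intro expectation_indep_mult[where A="{?Dm}" and B="{?Dp, ?Sp, ?Sa}"]) auto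
    ultimately show ?thesis
      using 1 in_gain by (simp add: expectation_X)
  next
    case 2
    let ?g = "\<lambda>\<omega>. of_real (C a k) * cnj (phase (X ?Dp \<omega>)) * X ?Dm \<omega> * cnj (phase (X ?Sp \<omega>))"
    have ig: "integrable \<Omega> ?g"
    proof (rule Bochner_Integration.integrable_bound)
      show "integrable \<Omega> (\<lambda>\<omega>. C a k * cmod (X ?Dm \<omega>))" using iX(2) by auto
    qed (auto simp: norm_mult abs_mult)
    have "w a k = (\<lambda>\<omega>. X ?Sa \<omega> * ?g \<omega>)"
      by (auto simp: w_def)
    moreover have "expectation (\<lambda>\<omega>. X ?Sa \<omega> * ?g \<omega>) = expectation (X ?Sa) * expectation ?g"
    proof (rule expectation_indep_mult[where A="{?Sa}" and B="{?Dp, ?Dm, ?Sp}"])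
      show "{?Sa} \<inter> {?Dp, ?Dm, ?Sp} = {}" using 2 by auto
      show "?g \<in> borel_measurable (generated {?Dp, ?Dm, ?Sp})" by measurable
    qed (use in_gain iX(4) ig gen(5) in simp_all)
    ultimately show ?thesis
      using 2 in_gain by (simp add: expectation_X)
  next
    case 3
    let ?f = "\<lambda>\<omega>. cmod (X ?Dm \<omega>)" and ?h = "\<lambda>\<omega>. cmod (X ?Sa \<omega>)"
    note fh = cmod_X_moment(1)[OF in_gain(2), unfolded has_bochner_integral_iff]
      cmod_X_moment(1)[OF in_gain(4), unfolded has_bochner_integral_iff]
    have "w a k \<omega> = of_real (C a k * (?f \<omega> * ?h \<omega>))" for \<omega>
    proof -
      have "w a k \<omega> = of_real (C a k) * (cnj (phase (X ?Dm \<omega>)) * X ?Dm \<omega>) * (cnj (phase (X ?Sa \<omega>)) * X ?Sa \<omega>)"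
        using 3 by (simp add: w_def)
      then show ?thesis unfolding cnj_phase_mult by simp
    qed
    then have "expectation (w a k) = expectation (\<lambda>\<omega>. of_real (C a k * (?f \<omega> * ?h \<omega>)))"
      by (intro Bochner_Integration.integral_cong) auto
    also have "\<dots> = of_real (expectation (\<lambda>\<omega>. C a k * (?f \<omega> * ?h \<omega>)))"
      by (rule integral_complex_of_real)
    also have "expectation (\<lambda>\<omega>. C a k * (?f \<omega> * ?h \<omega>)) = C a k * (sqrt pi / 2 * (sqrt pi / 2))"
    proof -
      have "expectation (\<lambda>\<omega>. ?f \<omega> * ?h \<omega>) = expectation ?f * expectation ?h"
        using in_gain fh by (intro expectation_indep_mult[where A="{?Dm}" and B="{?Sa}"]) auto
      then show ?thesis using fh by simp
    qed
    finally show ?thesis using 3 by simp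
  qed
qed


section \<open>The conditional noise power as a sum over relays\<close>

definition others :: "nat set" where "others = {1..M} - {m}"

definition r :: "nat \<Rightarrow> 'a \<Rightarrow> real" where
  "r k \<omega> = s * (c k)\<^sup>2 * (cmod (X (Dst_gain m k) \<omega>))\<^sup>2"

definition q :: "nat \<Rightarrow> 'a \<Rightarrow> real" where
  "q k \<omega> = (\<Sum>a\<in>others. (cmod (w a k \<omega>))\<^sup>2) / real M + r k \<omega>"

definition S :: "nat \<Rightarrow> nat \<Rightarrow> 'a \<Rightarrow> complex" where
  "S n a \<omega> = (\<Sum>k=1..n. w a k \<omega>)"

definition Q :: "nat \<Rightarrow> 'a \<Rightarrow> real" where
  "Q n \<omega> = (\<Sum>a\<in>others. (cmod (S n a \<omega>))\<^sup>2) / real M + (\<Sum>k=1..n. r k \<omega>)"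

definition L :: "nat \<Rightarrow> 'a \<Rightarrow> real" where
  "L n \<omega> = 2 / real M * Re (\<Sum>a\<in>others. w a (Suc n) \<omega> * cnj (S n a \<omega>))"

lemma M_pos: "0 < M" and others_subset: "a \<in> others \<Longrightarrow> a \<in> {1..M}" and finite_others: "finite others"
  and card_others: "card others = M - 1"
  using m by (auto simp: others_def)

lemma S_Suc: "S (Suc n) a \<omega> = S n a \<omega> + w a (Suc n) \<omega>"
  by (simp add: S_def)

lemma cmod_add_power2: "(cmod (x + y))\<^sup>2 = (cmod x)\<^sup>2 + 2 * Re (y * cnj x) + (cmod y)\<^sup>2"
  unfolding cmod_power2 by simp algebra

lemma Q_Suc: "Q (Suc n) \<omega> = Q n \<omega> + L n \<omega> + q (Suc n) \<omega>"
  unfolding Q_def L_def q_def S_Suc cmod_add_power2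
  by (simp add: sum.distrib add_divide_distrib sum_distrib_left sum_divide_distrib)

lemma measurable_r_generated:
  assumes "k \<in> {1..K}" "row k \<subseteq> B"
  shows "r k \<in> borel_measurable (generated B)"
proof -
  have "Dst_gain m k \<in> B" using assms m by (auto simp: row_def)
  then have [measurable]: "X (Dst_gain m k) \<in> borel_measurable (generated B)"
    by (rule measurable_generated)
  show ?thesis unfolding r_def[abs_def] by measurable
qed

lemma measurable_q_generated:
  assumes "k \<in> {1..K}"
  shows "q k \<in> borel_measurable (generated (row k))"
proof -
  have [measurable]: "r k \<in> borel_measurable (generated (row k))"
    using assms by (intro measurable_r_generated) auto
  have [measurable]: "w a k \<in> borel_measurable (generated (row k))" if "a \<in> others" for a
    using assms others_subset[OF that] by (intro measurable_w_generated) auto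
  show ?thesis unfolding q_def[abs_def] by measurable
qed

lemma measurable_S_generated:
  assumes "n \<le> K" "a \<in> {1..M}"
  shows "S n a \<in> borel_measurable (generated (past n))"
proof -
  have [measurable]: "w a k \<in> borel_measurable (generated (past n))" if "k \<in> {1..n}" for k
    using assms that by (intro measurable_w_generated) (auto simp: past_def)
  show ?thesis unfolding S_def[abs_def] by measurable
qed

lemma measurable_Q_generated:
  assumes "n \<le> K"
  shows "Q n \<in> borel_measurable (generated (past n))"
proof -
  have [measurable]: "r k \<in> borel_measurable (generated (past n))" if "k \<in> {1..n}" for k
    using assms that by (intro measurable_r_generated) (auto simp: past_def)
  have [measurable]: "S n a \<in> borel_measurable (generated (past n))" if "a \<in> others" for a
    using assms others_subset[OF that] by (intro measurable_S_generated) auto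
  show ?thesis unfolding Q_def[abs_def] by measurable
qed

lemma has_bochner_integral_r:
  assumes k: "k \<in> {1..K}"
  shows "has_bochner_integral \<Omega> (r k) (s * (c k)\<^sup>2)"
proof -
  have "has_bochner_integral \<Omega> (\<lambda>\<omega>. s * (c k)\<^sup>2 * (cmod (X (Dst_gain m k) \<omega>))\<^sup>2) (s * (c k)\<^sup>2 * 1)"
    by (rule has_bochner_integral_mult_right) (rule cmod_X_moment(2)[OF Dst_gain_in[OF k m]])
  then show ?thesis by (simp add: r_def[abs_def])
qed

lemma has_bochner_integral_q:
  assumes k: "k \<in> {1..K}"
  shows "has_bochner_integral \<Omega> (q k) ((\<Sum>a\<in>others. (C a k)\<^sup>2) / real M + s * (c k)\<^sup>2)"
  unfolding q_def[abs_def] using k others_subset M_pos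
  by (intro has_bochner_integral_add has_bochner_integral_r has_bochner_integral_divide_zero
      has_bochner_integral_sum has_bochner_integral_norm_w) auto

text \<open>Origin of the constants: (x + y)^2 <= 2 x^2 + 2 y^2, times the fourth moment 2 of the
  gain towards the destination; the \<open>Cmax\<close> part has one more factor 2, the fourth
  moment of a source gain.\<close>

definition B1 :: real where "B1 = 8 * Cmax ^ 4 + 4 * s\<^sup>2 * cmax ^ 4"

text \<open>The gain towards \<open>m\<close> factors out of every summand of \<open>q k\<close>;
  the rest is an average over the sources plus a constant and is independent of it. Hence the bound
  does not depend on the number of sources.\<close>

lemma q_square:
  assumes k: "k \<in> {1..K}"
  shows in_L2_q: "in_L2 \<Omega> (q k)"
    and expectation_q_square: "expectation (\<lambda>\<omega>. (q k \<omega>)\<^sup>2) \<le> B1"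
proof -
  let ?f = "\<lambda>\<omega>. cmod (X (Dst_gain m k) \<omega>) ^ 4"
  let ?h = "\<lambda>a \<omega>. cmod (X (Src_gain k a) \<omega>)"
  let ?H = "\<lambda>\<omega>. 2 * (Cmax ^ 4 / real M * (\<Sum>a\<in>{1..M}. ?h a \<omega> ^ 4)) + 2 * (s\<^sup>2 * cmax ^ 4)"
  have Cm: "0 \<le> C a k" "C a k \<le> Cmax" if "a \<in> {1..M}" for a using C k that by auto
  have cm: "0 \<le> c k" "c k \<le> cmax" using c k by auto
  have le: "(q k \<omega>)\<^sup>2 \<le> ?f \<omega> * ?H \<omega>" for \<omega>
  proof -
    define F where "F = (cmod (X (Dst_gain m k) \<omega>))\<^sup>2"
    define T where "T = (\<Sum>a\<in>{1..M}. (?h a \<omega>)\<^sup>2)"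
    have F: "0 \<le> F" by (simp add: F_def)
    have T: "0 \<le> T" by (simp add: T_def sum_nonneg)
    have "(\<Sum>a\<in>others. (cmod (w a k \<omega>))\<^sup>2) \<le> (\<Sum>a\<in>{1..M}. (cmod (w a k \<omega>))\<^sup>2)"
      by (intro sum_mono2) (auto dest: others_subset)
    also have "\<dots> \<le> (\<Sum>a\<in>{1..M}. Cmax\<^sup>2 * F * (?h a \<omega>)\<^sup>2)"
    proof (rule sum_mono)
      fix a assume a: "a \<in> {1..M}"
      have "(C a k)\<^sup>2 \<le> Cmax\<^sup>2" using Cm[OF a] by (intro power_mono) auto
      then show "(cmod (w a k \<omega>))\<^sup>2 \<le> Cmax\<^sup>2 * F * (?h a \<omega>)\<^sup>2"
        unfolding norm_w power_mult_distrib F_def using F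
        by (simp add: mult_right_mono mult.assoc)
    qed
    also have "\<dots> = Cmax\<^sup>2 * F * T"
      by (simp add: T_def sum_distrib_left)
    finally have 1: "(\<Sum>a\<in>others. (cmod (w a k \<omega>))\<^sup>2) / real M \<le> Cmax\<^sup>2 * F * T / real M"
      by (rule divide_right_mono) simp
    have "(c k)\<^sup>2 \<le> cmax\<^sup>2" using cm by (intro power_mono) auto
    then have "s * (c k)\<^sup>2 \<le> s * cmax\<^sup>2" using s by (rule mult_left_mono)
    then have 2: "r k \<omega> \<le> s * cmax\<^sup>2 * F"
      unfolding r_def F_def by (rule mult_right_mono) simp
    have q: "q k \<omega> \<le> F * (Cmax\<^sup>2 * T / real M + s * cmax\<^sup>2)"
      unfolding q_def using 1 2 by (simp add: algebra_simps)
    have q0: "0 \<le> q k \<omega>"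
      unfolding q_def r_def using s by (intro add_nonneg_nonneg divide_nonneg_nonneg sum_nonneg mult_nonneg_nonneg) auto
    have "(q k \<omega>)\<^sup>2 \<le> (F * (Cmax\<^sup>2 * T / real M + s * cmax\<^sup>2))\<^sup>2"
      using q q0 by (rule power_mono)
    also have "\<dots> = F\<^sup>2 * (Cmax\<^sup>2 * T / real M + s * cmax\<^sup>2)\<^sup>2"
      by (rule power_mult_distrib)
    also have "\<dots> \<le> F\<^sup>2 * ?H \<omega>"
    proof (rule mult_left_mono)
      have "(Cmax\<^sup>2 * T / real M + s * cmax\<^sup>2)\<^sup>2 \<le> 2 * (Cmax\<^sup>2 * T / real M)\<^sup>2 + 2 * (s * cmax\<^sup>2)\<^sup>2"
        using sum_squares_bound[of "Cmax\<^sup>2 * T / real M" "s * cmax\<^sup>2"] by (simp add: power2_sum)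
      also have "(Cmax\<^sup>2 * T / real M)\<^sup>2 = Cmax ^ 4 * T\<^sup>2 / (real M)\<^sup>2"
        by (simp add: power_divide power_mult_distrib)
      \<comment> \<open>Cauchy-Schwarz over the sources; the factor M it produces cancels against
        one of the two in the denominator.\<close>
      also have "Cmax ^ 4 * T\<^sup>2 / (real M)\<^sup>2 \<le> Cmax ^ 4 * ((\<Sum>a\<in>{1..M}. ((?h a \<omega>)\<^sup>2)\<^sup>2) * real M) / (real M)\<^sup>2"
        using sum_squared_le_sum_of_squares[of "\<lambda>a. (?h a \<omega>)\<^sup>2" "{1..M}"]
        unfolding T_def by (intro divide_right_mono mult_left_mono) auto
      also have "\<dots> = Cmax ^ 4 / real M * (\<Sum>a\<in>{1..M}. ?h a \<omega> ^ 4)"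
        using M_pos by (simp add: power2_eq_square power4_eq_xxxx mult.assoc)
      finally show "(Cmax\<^sup>2 * T / real M + s * cmax\<^sup>2)\<^sup>2 \<le> ?H \<omega>"
        by (simp add: power_mult_distrib)
    qed simp
    finally show ?thesis by (simp add: F_def)
  qed
  let ?A = "{Dst_gain m k}" and ?B = "Src_gain k ` {1..M}"
  have [measurable]: "X (Dst_gain m k) \<in> borel_measurable (generated ?A)"
    "a \<in> {1..M} \<Longrightarrow> X (Src_gain k a) \<in> borel_measurable (generated ?B)" for a
    by (auto intro: measurable_generated)
  have mf: "?f \<in> borel_measurable (generated ?A)" by measurable
  have mH: "?H \<in> borel_measurable (generated ?B)" by measurable
  have d: "?A \<inter> ?B = {}" "?A \<subseteq> gain_labels M K" "?B \<subseteq> gain_labels M K"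
    using k m by (auto intro: Src_gain_in Dst_gain_in)
  note f = cmod_X_moment(3)[OF Dst_gain_in[OF k m]]
  have H: "has_bochner_integral \<Omega> ?H (2 * (Cmax ^ 4 / real M * (\<Sum>a\<in>{1..M}. 2)) + 2 * (s\<^sup>2 * cmax ^ 4))"
  proof (intro has_bochner_integral_add has_bochner_integral_mult_right has_bochner_integral_sum)
    show "has_bochner_integral \<Omega> (\<lambda>\<omega>. ?h a \<omega> ^ 4) 2" if "a \<in> {1..M}" for a
      by (rule cmod_X_moment(3)[OF Src_gain_in[OF k that]])
    show "has_bochner_integral \<Omega> (\<lambda>\<omega>. cmax ^ 4) (cmax ^ 4)"
      by (simp add: has_bochner_integral_iff prob_space)
  qed
  have int: "integrable \<Omega> (\<lambda>\<omega>. ?f \<omega> * ?H \<omega>)"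
    using f H by (intro integrable_indep_mult[OF d mf mH]) (auto simp: has_bochner_integral_iff)
  have qm: "q k \<in> borel_measurable \<Omega>"
    using has_bochner_integral_q[OF k] by (auto simp: has_bochner_integral_iff)
  have qi: "integrable \<Omega> (\<lambda>\<omega>. (q k \<omega>)\<^sup>2)"
    using qm le by (intro Bochner_Integration.integrable_bound[OF int] AE_I2) (auto intro: order_trans[OF _ abs_ge_self])
  then show "in_L2 \<Omega> (q k)"
    using qm by (simp add: in_L2_def)
  have "expectation (\<lambda>\<omega>. (q k \<omega>)\<^sup>2) \<le> expectation (\<lambda>\<omega>. ?f \<omega> * ?H \<omega>)"
    using le by (intro integral_mono qi int)
  also have "\<dots> = expectation ?f * expectation ?H"
    using f H by (intro expectation_indep_mult[OF d mf mH]) (auto simp: has_bochner_integral_iff)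
  also have "\<dots> = B1"
    unfolding has_bochner_integral_integral_eq[OF f] has_bochner_integral_integral_eq[OF H] B1_def
    using M_pos by simp
  finally show "expectation (\<lambda>\<omega>. (q k \<omega>)\<^sup>2) \<le> B1" .
qed

section \<open>Second moments of the relay sums and of the cross terms\<close>

text \<open>Mean square equals squared mean plus the sum of the variances, by induction on the
  relays: the row of the new relay is independent of the earlier ones, so the mixed term is the
  product of the means.\<close>

lemma S_moments:
  assumes a: "a \<in> {1..M}" and n: "n \<le> K"
  shows in_L2_S: "in_L2 \<Omega> (S n a)"
    and expectation_S: "expectation (S n a) = (\<Sum>k=1..n. expectation (w a k))"
    and expectation_S_square: "expectation (\<lambda>\<omega>. (cmod (S n a \<omega>))\<^sup>2)
      = (cmod (expectation (S n a)))\<^sup>2 + (\<Sum>k=1..n. (C a k)\<^sup>2 - (cmod (expectation (w a k)))\<^sup>2)"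
proof -
  have si: "in_L2 \<Omega> (S n a)" if "n \<le> K" for n
    unfolding S_def[abs_def] using that a by (intro in_L2_sum in_L2_w) auto
  then show "in_L2 \<Omega> (S n a)" using n by blast
  have es: "expectation (S n a) = (\<Sum>k=1..n. expectation (w a k))" if "n \<le> K" for n
    unfolding S_def[abs_def] using that a
    by (intro Bochner_Integration.integral_sum in_L2_imp_integrable in_L2_w) auto
  then show "expectation (S n a) = (\<Sum>k=1..n. expectation (w a k))" using n by blast
  show "expectation (\<lambda>\<omega>. (cmod (S n a \<omega>))\<^sup>2)
      = (cmod (expectation (S n a)))\<^sup>2 + (\<Sum>k=1..n. (C a k)\<^sup>2 - (cmod (expectation (w a k)))\<^sup>2)"
    using n
  proof (induction n)
    case 0
    then show ?case by (simp add: S_def)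
  next
    case (Suc n)
    then have n: "n \<le> K" "Suc n \<in> {1..K}" by auto
    let ?w = "w a (Suc n)"
    note sw = in_L2_w[OF n(2) a] and sS = si[OF n(1)]
    note iw = has_bochner_integral_norm_w[OF n(2) a, unfolded has_bochner_integral_iff]
    have wm: "?w \<in> borel_measurable (generated (row (Suc n)))"
      using n a by (intro measurable_w_generated) auto
    have Sm [measurable]: "S n a \<in> borel_measurable (generated (past n))"
      using n a by (intro measurable_S_generated) auto
    have Sm': "(\<lambda>\<omega>. cnj (S n a \<omega>)) \<in> borel_measurable (generated (past n))" by measurable
    have ix: "integrable \<Omega> (\<lambda>\<omega>. ?w \<omega> * cnj (S n a \<omega>))"
      using in_L2_mult[OF sw in_L2_cnj[OF sS]] .
    have "expectation (\<lambda>\<omega>. ?w \<omega> * cnj (S n a \<omega>)) = expectation ?w * expectation (\<lambda>\<omega>. cnj (S n a \<omega>))"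
      using sw sS n
      by (intro expectation_indep_mult[OF past_row_disjoint(2) row_subset past_subset wm Sm'])
        (auto intro: in_L2_imp_integrable)
    then have x: "expectation (\<lambda>\<omega>. ?w \<omega> * cnj (S n a \<omega>)) = expectation ?w * cnj (expectation (S n a))"
      by simp
    define y where "y \<omega> = Re (?w \<omega> * cnj (S n a \<omega>))" for \<omega>
    have iy: "integrable \<Omega> y" "expectation y = Re (expectation (\<lambda>\<omega>. ?w \<omega> * cnj (S n a \<omega>)))"
      unfolding y_def[abs_def] by (rule integrable_Re[OF ix], rule integral_Re[OF ix])
    have "expectation (\<lambda>\<omega>. (cmod (S (Suc n) a \<omega>))\<^sup>2)
        = expectation (\<lambda>\<omega>. (cmod (S n a \<omega>))\<^sup>2 + 2 * y \<omega> + (cmod (?w \<omega>))\<^sup>2)"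
      unfolding S_Suc cmod_add_power2 y_def ..
    also have "\<dots> = expectation (\<lambda>\<omega>. (cmod (S n a \<omega>))\<^sup>2) + 2 * expectation y + (C a (Suc n))\<^sup>2"
      using iy(1) iw in_L2_norm[OF sS] by simp
    also have "expectation y = Re (expectation (\<lambda>\<omega>. ?w \<omega> * cnj (S n a \<omega>)))"
      by (rule iy)
    also have "expectation (\<lambda>\<omega>. (cmod (S n a \<omega>))\<^sup>2) + 2 * Re (expectation (\<lambda>\<omega>. ?w \<omega> * cnj (S n a \<omega>))) + (C a (Suc n))\<^sup>2 = (cmod (expectation (S n a) + expectation ?w))\<^sup>2
        + (\<Sum>k=1..Suc n. (C a k)\<^sup>2 - (cmod (expectation (w a k)))\<^sup>2)"
      unfolding x cmod_add_power2 Suc.IH[OF n(1)] by simp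
    also have "expectation (S n a) + expectation ?w = expectation (S (Suc n) a)"
      using es[OF n(1)] es[OF Suc.prems] by simp
    finally show ?case .
  qed
qed

lemma expectation_S_others:
  assumes a: "a \<in> others" and n: "n \<le> K"
  shows "expectation (S n a) = 0" "expectation (\<lambda>\<omega>. (cmod (S n a \<omega>))\<^sup>2) = (\<Sum>k=1..n. (C a k)\<^sup>2)"
proof -
  have w0: "expectation (w a k) = 0" if "k \<in> {1..n}" for k
    using a n that by (subst expectation_w) (auto simp: others_def)
  then show 1: "expectation (S n a) = 0"
    using n others_subset[OF a] by (subst expectation_S) auto
  show "expectation (\<lambda>\<omega>. (cmod (S n a \<omega>))\<^sup>2) = (\<Sum>k=1..n. (C a k)\<^sup>2)"
    using n others_subset[OF a] w0 by (subst expectation_S_square) (auto simp: 1)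
qed


definition T :: "nat \<Rightarrow> 'a \<Rightarrow> complex" where
  "T n \<omega> = (\<Sum>a\<in>others. w a (Suc n) \<omega> * cnj (S n a \<omega>))"

lemma L_eq: "L n \<omega> = 2 / real M * Re (T n \<omega>)"
  by (simp add: L_def T_def)

text \<open>In the double sum for the squared modulus each term factors into a part from the new row
  and a part from the past, and \<open>expectation_w_cross\<close> annihilates the row part off the
  diagonal. Thus M terms remain instead of M^2; after division by M^2 in \<open>L\<close> this is
  the gain of 1/M in the variance of \<open>D\<close>.\<close>

lemma T_moments:
  assumes n: "Suc n \<le> K"
  shows in_L2_T: "in_L2 \<Omega> (T n)"
    and expectation_T_square: "expectation (\<lambda>\<omega>. (cmod (T n \<omega>))\<^sup>2) \<le> real M * real n * Cmax ^ 4"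
proof -
  have n': "n \<le> K" "Suc n \<in> {1..K}" using n by auto
  note d = past_row_disjoint(2) row_subset[OF n'(2)] past_subset[OF n'(1)]
  have wm: "w a (Suc n) \<in> borel_measurable (generated (row (Suc n)))" if "a \<in> others" for a
    using n' others_subset[OF that] by (intro measurable_w_generated) auto
  have Sm: "S n a \<in> borel_measurable (generated (past n))" if "a \<in> others" for a
    using n' others_subset[OF that] by (intro measurable_S_generated) auto
  have Sm': "(\<lambda>\<omega>. cnj (S n a \<omega>)) \<in> borel_measurable (generated (past n))" if "a \<in> others" for a
    using Sm[OF that] by measurable
  note sw = in_L2_w[OF n'(2) others_subset]
  note sS = in_L2_S[OF others_subset n'(1)]
  show "in_L2 \<Omega> (T n)"
    unfolding T_def[abs_def]
    by (intro in_L2_sum in_L2_indep_mult[OF d wm Sm'] sw in_L2_cnj sS)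
  let ?ww = "\<lambda>a b \<omega>. w a (Suc n) \<omega> * cnj (w b (Suc n) \<omega>)" and ?SS = "\<lambda>a b \<omega>. cnj (S n a \<omega>) * S n b \<omega>"
  have e: "of_real ((cmod (T n \<omega>))\<^sup>2) = (\<Sum>a\<in>others. \<Sum>b\<in>others.
      ?ww a b \<omega> * ?SS a b \<omega>)" for \<omega>
    unfolding complex_norm_square T_def cnj_sum sum_product
    by (intro sum.cong refl) simp
  have ww: "integrable \<Omega> (?ww a b)" if "a \<in> others" "b \<in> others" for a b
    using that by (intro in_L2_mult in_L2_cnj sw)
  have SS: "integrable \<Omega> (?SS a b)" if "a \<in> others" "b \<in> others" for a b
    using that by (intro in_L2_mult in_L2_cnj sS)
  have wwm: "(?ww a b) \<in> borel_measurable (generated (row (Suc n)))"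
    if "a \<in> others" "b \<in> others" for a b
    using wm[OF that(1)] wm[OF that(2)] by measurable
  have SSm: "(?SS a b) \<in> borel_measurable (generated (past n))"
    if "a \<in> others" "b \<in> others" for a b
    using Sm[OF that(1)] Sm[OF that(2)] by measurable
  have "complex_of_real (expectation (\<lambda>\<omega>. (cmod (T n \<omega>))\<^sup>2)) = expectation (\<lambda>\<omega>. complex_of_real ((cmod (T n \<omega>))\<^sup>2))"
    by (rule integral_complex_of_real[symmetric])
  also have "\<dots> = (\<Sum>a\<in>others. \<Sum>b\<in>others. expectation (\<lambda>\<omega>.
      ?ww a b \<omega> * ?SS a b \<omega>))"
    unfolding e by (subst Bochner_Integration.integral_sum, (intro Bochner_Integration.integrable_sum integrable_indep_mult[OF d wwm SSm ww SS], assumption+),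
        intro sum.cong refl Bochner_Integration.integral_sum integrable_indep_mult[OF d wwm SSm ww SS])
  also have "\<dots> = (\<Sum>a\<in>others. \<Sum>b\<in>others. if a = b then
      of_real ((C a (Suc n))\<^sup>2 * expectation (\<lambda>\<omega>. (cmod (S n a \<omega>))\<^sup>2)) else 0)"
  proof (intro sum.cong refl)
    fix a b assume ab: "a \<in> others" "b \<in> others"
    have "expectation (\<lambda>\<omega>. ?ww a b \<omega> * ?SS a b \<omega>)
      = expectation (?ww a b) * expectation (?SS a b)"
      using ab by (intro expectation_indep_mult[OF d wwm SSm ww SS])
    also have "\<dots> = (if a = b then of_real ((C a (Suc n))\<^sup>2) else 0) * expectation (?SS a b)"
      unfolding expectation_w_cross[OF n'(2) others_subset[OF ab(1)] others_subset[OF ab(2)]] ..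
    also have "\<dots> = (if a = b then of_real ((C a (Suc n))\<^sup>2 * expectation (\<lambda>\<omega>. (cmod (S n a \<omega>))\<^sup>2)) else 0)"
    proof -
      have "expectation (\<lambda>\<omega>. cnj (S n a \<omega>) * S n a \<omega>) = of_real (expectation (\<lambda>\<omega>. (cmod (S n a \<omega>))\<^sup>2))"
        unfolding integral_complex_of_real[symmetric] complex_norm_square by (simp add: mult.commute)
      then show ?thesis by (cases "a = b") simp_all
    qed
    finally show "expectation (\<lambda>\<omega>. ?ww a b \<omega> * ?SS a b \<omega>) = \<dots>" .
  qed
  also have "\<dots> = of_real (\<Sum>a\<in>others. (C a (Suc n))\<^sup>2 * expectation (\<lambda>\<omega>. (cmod (S n a \<omega>))\<^sup>2))"
    using finite_others by simp
  finally have "expectation (\<lambda>\<omega>. (cmod (T n \<omega>))\<^sup>2) = (\<Sum>a\<in>others. (C a (Suc n))\<^sup>2 * expectation (\<lambda>\<omega>. (cmod (S n a \<omega>))\<^sup>2))"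
    by (simp only: of_real_eq_iff)
  also have "\<dots> \<le> (\<Sum>a\<in>others. Cmax\<^sup>2 * (real n * Cmax\<^sup>2))"
  proof (intro sum_mono mult_mono)
    fix a assume a: "a \<in> others"
    have C2: "(C a k)\<^sup>2 \<le> Cmax\<^sup>2" if "k \<in> {1..K}" for k
      using C[OF others_subset[OF a] that] by (intro power_mono) auto
    show "(C a (Suc n))\<^sup>2 \<le> Cmax\<^sup>2" using C2 n' by blast
    have "(\<Sum>k=1..n. (C a k)\<^sup>2) \<le> (\<Sum>k=1..n. Cmax\<^sup>2)"
      using n' by (intro sum_mono C2) auto
    then show "expectation (\<lambda>\<omega>. (cmod (S n a \<omega>))\<^sup>2) \<le> real n * Cmax\<^sup>2"
      unfolding expectation_S_others(2)[OF a n'(1)] by simp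
  qed auto
  also have "\<dots> = real (card others) * (real n * Cmax ^ 4)"
    by (simp add: power2_eq_square power4_eq_xxxx mult_ac)
  also have "\<dots> \<le> real M * (real n * Cmax ^ 4)"
    using card_others by (intro mult_right_mono) auto
  finally show "expectation (\<lambda>\<omega>. (cmod (T n \<omega>))\<^sup>2) \<le> real M * real n * Cmax ^ 4"
    by simp
qed

lemma L_moments:
  assumes n: "Suc n \<le> K"
  shows in_L2_L: "in_L2 \<Omega> (L n)"
    and expectation_L_square: "expectation (\<lambda>\<omega>. (L n \<omega>)\<^sup>2) \<le> 4 * real n * Cmax ^ 4 / real M"
proof -
  note sT = in_L2_T[OF n]
  show sL: "in_L2 \<Omega> (L n)"
    unfolding L_eq[abs_def] by (intro in_L2_cmult in_L2_Re sT)
  have "expectation (\<lambda>\<omega>. (L n \<omega>)\<^sup>2) \<le> expectation (\<lambda>\<omega>. 4 / (real M)\<^sup>2 * (cmod (T n \<omega>))\<^sup>2)"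
  proof (rule integral_mono)
    show "integrable \<Omega> (\<lambda>\<omega>. (L n \<omega>)\<^sup>2)" using in_L2_norm[OF sL] by simp
    show "integrable \<Omega> (\<lambda>\<omega>. 4 / (real M)\<^sup>2 * (cmod (T n \<omega>))\<^sup>2)" using in_L2_norm[OF sT] by simp
    show "(L n \<omega>)\<^sup>2 \<le> 4 / (real M)\<^sup>2 * (cmod (T n \<omega>))\<^sup>2" for \<omega>
    proof -
      have "(Re (T n \<omega>))\<^sup>2 \<le> (cmod (T n \<omega>))\<^sup>2" by (simp add: cmod_power2)
      then show ?thesis
        unfolding L_eq power_mult_distrib power_divide by (simp add: divide_right_mono mult_left_mono)
    qed
  qed
  also have "\<dots> \<le> 4 / (real M)\<^sup>2 * (real M * real n * Cmax ^ 4)"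
    using expectation_T_square[OF n] by (simp add: divide_right_mono)
  also have "\<dots> = 4 * real n * Cmax ^ 4 / real M"
    using M_pos by (simp add: power2_eq_square)
  finally show "expectation (\<lambda>\<omega>. (L n \<omega>)\<^sup>2) \<le> 4 * real n * Cmax ^ 4 / real M" .
qed

section \<open>Orthogonality of the increments and variance of the noise power\<close>

text \<open>Common core of the next two lemmas: each summand is a row factor times a past factor, so
  it suffices that one of them is centred.\<close>

lemma expectation_cross_zero:
  assumes n: "Suc n \<le> K"
    and f: "\<And>a. a \<in> others \<Longrightarrow> f a \<in> borel_measurable (generated (row (Suc n)))"
      "\<And>a. a \<in> others \<Longrightarrow> integrable \<Omega> (f a)"
    and h: "\<And>a. a \<in> others \<Longrightarrow> h a \<in> borel_measurable (generated (past n))"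
      "\<And>a. a \<in> others \<Longrightarrow> integrable \<Omega> (h a)"
    and zero: "\<And>a. a \<in> others \<Longrightarrow> expectation (f a) = 0 \<or> expectation (h a) = 0"
  shows "expectation (\<lambda>\<omega>. 2 / real M * Re (\<Sum>a\<in>others. f a \<omega> * h a \<omega> :: complex)) = 0"
proof -
  note d = past_row_disjoint(2) row_subset past_subset
  have *: "integrable \<Omega> (\<lambda>\<omega>. f a \<omega> * h a \<omega>) \<and> expectation (\<lambda>\<omega>. f a \<omega> * h a \<omega>) = 0"
    if a: "a \<in> others" for a
    using integrable_indep_mult[OF d f(1)[OF a] h(1)[OF a] f(2)[OF a] h(2)[OF a]]
      expectation_indep_mult[OF d f(1)[OF a] h(1)[OF a] f(2)[OF a] h(2)[OF a]] zero[OF a] n by auto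
  then have i: "integrable \<Omega> (\<lambda>\<omega>. \<Sum>a\<in>others. f a \<omega> * h a \<omega>)"
    by (intro Bochner_Integration.integrable_sum) blast
  have "expectation (\<lambda>\<omega>. 2 / real M * Re (\<Sum>a\<in>others. f a \<omega> * h a \<omega>))
      = 2 / real M * Re (expectation (\<lambda>\<omega>. \<Sum>a\<in>others. f a \<omega> * h a \<omega>))"
    by (subst integral_Re[OF i, symmetric]) (rule integral_mult_right_zero)
  also have "expectation (\<lambda>\<omega>. \<Sum>a\<in>others. f a \<omega> * h a \<omega>) = 0"
    using * by (subst Bochner_Integration.integral_sum) auto
  finally show ?thesis by simp
qed

text \<open>The function \<open>g\<close> joins the past factor, and the new coefficient of an
  interfering source is centred whichever pair its relay serves.\<close>

lemma expectation_L_past: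
  assumes n: "Suc n \<le> K" and g: "in_L2 \<Omega> g" "g \<in> borel_measurable (generated (past n))"
  shows "expectation (\<lambda>\<omega>. g \<omega> * L n \<omega>) = 0"
proof -
  have si: "in_L2 \<Omega> (\<lambda>\<omega>. complex_of_real (g \<omega>))"
    using g by (auto simp: in_L2_def)
  have e: "g \<omega> * Re (T n \<omega>) = Re (\<Sum>a\<in>others. w a (Suc n) \<omega> * (of_real (g \<omega>) * cnj (S n a \<omega>)))" for \<omega>
    by (simp add: T_def sum_distrib_left algebra_simps)
  have gL: "g \<omega> * L n \<omega> = 2 / real M * Re (\<Sum>a\<in>others. w a (Suc n) \<omega> * (of_real (g \<omega>) * cnj (S n a \<omega>)))" for \<omega>
    unfolding L_eq e[symmetric] by (rule mult.left_commute)
  show ?thesis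
    unfolding gL
  proof (rule expectation_cross_zero[OF n])
    fix a assume a: "a \<in> others"
    note a' = others_subset[OF a]
    have [measurable]: "S n a \<in> borel_measurable (generated (past n))"
      using n a' by (intro measurable_S_generated) auto
    show "(\<lambda>\<omega>. of_real (g \<omega>) * cnj (S n a \<omega>)) \<in> borel_measurable (generated (past n))"
      using g(2) by measurable
    show "integrable \<Omega> (\<lambda>\<omega>. of_real (g \<omega>) * cnj (S n a \<omega>))"
      using n a' by (intro in_L2_mult si in_L2_cnj in_L2_S) auto
    show "expectation (w a (Suc n)) = 0 \<or> expectation (\<lambda>\<omega>. of_real (g \<omega>) * cnj (S n a \<omega>)) = 0"
      using a n by (subst expectation_w) (auto simp: others_def)
  qed (use n others_subset in \<open>auto intro!: measurable_w_generated in_L2_imp_integrable in_L2_w\<close>)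
qed

text \<open>Now \<open>g\<close> joins the row factor, which need not remain centred; instead the
  partial sum \<open>S n a\<close> of an interfering source is.\<close>

lemma expectation_L_row:
  assumes n: "Suc n \<le> K" and g: "in_L2 \<Omega> g" "g \<in> borel_measurable (generated (row (Suc n)))"
  shows "expectation (\<lambda>\<omega>. g \<omega> * L n \<omega>) = 0"
proof -
  have si: "in_L2 \<Omega> (\<lambda>\<omega>. complex_of_real (g \<omega>))"
    using g by (auto simp: in_L2_def)
  have e: "g \<omega> * Re (T n \<omega>) = Re (\<Sum>a\<in>others. (of_real (g \<omega>) * w a (Suc n) \<omega>) * cnj (S n a \<omega>))" for \<omega>
    by (simp add: T_def sum_distrib_left algebra_simps)
  have gL: "g \<omega> * L n \<omega> = 2 / real M * Re (\<Sum>a\<in>others. (of_real (g \<omega>) * w a (Suc n) \<omega>) * cnj (S n a \<omega>))" for \<omega>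
    unfolding L_eq e[symmetric] by (rule mult.left_commute)
  show ?thesis
    unfolding gL
  proof (rule expectation_cross_zero[OF n])
    fix a assume a: "a \<in> others"
    note a' = others_subset[OF a]
    have n': "n \<le> K" "Suc n \<in> {1..K}" using n by auto
    have [measurable]: "w a (Suc n) \<in> borel_measurable (generated (row (Suc n)))"
      using n' a' by (intro measurable_w_generated) auto
    show "(\<lambda>\<omega>. of_real (g \<omega>) * w a (Suc n) \<omega>) \<in> borel_measurable (generated (row (Suc n)))"
      using g(2) by measurable
    show "integrable \<Omega> (\<lambda>\<omega>. of_real (g \<omega>) * w a (Suc n) \<omega>)"
      using n' a' by (intro in_L2_mult si in_L2_w)
    have [measurable]: "S n a \<in> borel_measurable (generated (past n))"
      using n' a' by (intro measurable_S_generated)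
    show "(\<lambda>\<omega>. cnj (S n a \<omega>)) \<in> borel_measurable (generated (past n))"
      by measurable
    show "integrable \<Omega> (\<lambda>\<omega>. cnj (S n a \<omega>))"
      using n' a' by (intro in_L2_imp_integrable in_L2_cnj in_L2_S)
    show "expectation (\<lambda>\<omega>. of_real (g \<omega>) * w a (Suc n) \<omega>) = 0 \<or> expectation (\<lambda>\<omega>. cnj (S n a \<omega>)) = 0"
      using expectation_S_others(1)[OF a n'(1)] by simp
  qed
qed

text \<open>The deviation after one more relay splits into the earlier deviation, the cross term and
  the deviation of the new diagonal term. These are pairwise orthogonal, so their mean squares
  add.\<close>

lemma Q_moments:
  assumes n: "n \<le> K"
  shows "in_L2 \<Omega> (Q n)"
    and "expectation (Q n) = (\<Sum>k=1..n. expectation (q k))"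
    and "expectation (\<lambda>\<omega>. (Q n \<omega> - expectation (Q n))\<^sup>2) \<le> real n * B1 + 4 * Cmax ^ 4 / real M * (real n)\<^sup>2"
  using n
proof (induction n)
  case 0
  {
    case 1 then show ?case by (simp add: Q_def[abs_def] S_def in_L2_const)
  next
    case 2 then show ?case by (simp add: Q_def[abs_def] S_def)
  next
    case 3 then show ?case by (simp add: Q_def[abs_def] S_def)
  }
next
  case (Suc n)
  have sQ: "in_L2 \<Omega> (Q n)" if "Suc n \<le> K" using Suc.IH(1) that by simp
  have eQ: "Q (Suc n) = (\<lambda>\<omega>. Q n \<omega> + L n \<omega> + q (Suc n) \<omega>)"
    by (simp add: Q_Suc fun_eq_iff)
  have sq: "in_L2 \<Omega> (q (Suc n))" if "Suc n \<le> K"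
    using that by (intro in_L2_q) auto
  have EL: "expectation (L n) = 0" if "Suc n \<le> K"
    using expectation_L_past[OF that in_L2_const[of 1]] by simp
  have EQ: "expectation (Q (Suc n)) = expectation (Q n) + expectation (q (Suc n))" if "Suc n \<le> K"
    unfolding eQ using that EL
    by (simp add: in_L2_imp_integrable sQ sq in_L2_L)
  {
    case 1
    show ?case unfolding eQ
      using 1 by (intro in_L2_add sQ sq in_L2_L)
  next
    case 2
    then show ?case using EQ[OF 2] Suc.IH(2) by simp
  next
    case 3
    then have n: "n \<le> K" "Suc n \<in> {1..K}" by auto
    note d = past_row_disjoint(1) past_subset[OF n(1)] row_subset[OF n(2)]
    define A where "A \<omega> = Q n \<omega> - expectation (Q n)" for \<omega>
    define G where "G \<omega> = q (Suc n) \<omega> - expectation (q (Suc n))" for \<omega>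
    have sA: "in_L2 \<Omega> A" and sG: "in_L2 \<Omega> G" and sL: "in_L2 \<Omega> (L n)"
      using in_L2_add[OF sQ[OF 3] in_L2_const[of "- expectation (Q n)"]]
        in_L2_add[OF sq[OF 3] in_L2_const[of "- expectation (q (Suc n))"]]
        in_L2_L[OF 3]
      by (simp_all add: A_def[abs_def] G_def[abs_def])
    have mA: "A \<in> borel_measurable (generated (past n))"
      using measurable_Q_generated[OF n(1)] unfolding A_def[abs_def] by measurable
    have mG: "G \<in> borel_measurable (generated (row (Suc n)))"
      using measurable_q_generated[OF n(2)] unfolding G_def[abs_def] by measurable
    have iA: "integrable \<Omega> A" and iG: "integrable \<Omega> G"
      using sA sG by (auto intro: in_L2_imp_integrable)
    have "expectation A = 0"
      unfolding A_def[abs_def] using sQ[OF 3] by (simp add: in_L2_imp_integrable prob_space)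
    then have AG: "expectation (\<lambda>\<omega>. A \<omega> * G \<omega>) = 0"
      using expectation_indep_mult[OF d mA mG iA iG] by simp
    have AL: "expectation (\<lambda>\<omega>. A \<omega> * L n \<omega>) = 0" by (rule expectation_L_past[OF 3 sA mA])
    have GL: "expectation (\<lambda>\<omega>. G \<omega> * L n \<omega>) = 0" by (rule expectation_L_row[OF 3 sG mG])
    have i2: "integrable \<Omega> (\<lambda>\<omega>. (A \<omega>)\<^sup>2)" "integrable \<Omega> (\<lambda>\<omega>. (L n \<omega>)\<^sup>2)" "integrable \<Omega> (\<lambda>\<omega>. (G \<omega>)\<^sup>2)"
      using in_L2_norm[OF sA] in_L2_norm[OF sL] in_L2_norm[OF sG] by auto
    note ix = in_L2_mult[OF sA sL] in_L2_mult[OF sA sG] in_L2_mult[OF sG sL]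
    have "expectation (\<lambda>\<omega>. (Q (Suc n) \<omega> - expectation (Q (Suc n)))\<^sup>2) = expectation (\<lambda>\<omega>. (A \<omega>)\<^sup>2 + (L n \<omega>)\<^sup>2 + (G \<omega>)\<^sup>2
        + 2 * (A \<omega> * L n \<omega>) + 2 * (A \<omega> * G \<omega>) + 2 * (G \<omega> * L n \<omega>))"
      unfolding EQ[OF 3] unfolding eQ A_def G_def
      by (intro Bochner_Integration.integral_cong refl) (simp add: power2_eq_square algebra_simps)
    also have "\<dots> = expectation (\<lambda>\<omega>. (A \<omega>)\<^sup>2) + expectation (\<lambda>\<omega>. (L n \<omega>)\<^sup>2) + expectation (\<lambda>\<omega>. (G \<omega>)\<^sup>2)"
      using i2 ix AL AG GL by simp
    also have "expectation (\<lambda>\<omega>. (A \<omega>)\<^sup>2) \<le> real n * B1 + 4 * Cmax ^ 4 / real M * (real n)\<^sup>2"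
      using Suc.IH(3)[OF n(1)] by (simp add: A_def)
    also have "expectation (\<lambda>\<omega>. (L n \<omega>)\<^sup>2) \<le> 4 * real n * Cmax ^ 4 / real M"
      by (rule expectation_L_square[OF 3])
    also have "expectation (\<lambda>\<omega>. (G \<omega>)\<^sup>2) \<le> B1"
    proof -
      have "expectation (\<lambda>\<omega>. (G \<omega>)\<^sup>2) = expectation (\<lambda>\<omega>. (q (Suc n) \<omega>)\<^sup>2) - (expectation (q (Suc n)))\<^sup>2"
        unfolding G_def using variance_eq[of "q (Suc n)"] sq[OF 3] in_L2_norm[OF sq[OF 3]]
        by (simp add: in_L2_imp_integrable)
      also have "\<dots> \<le> B1"
        using expectation_q_square[OF n(2)] zero_le_power2[of "expectation (q (Suc n))"] by linarith
      finally show ?thesis .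
    qed
    finally have "expectation (\<lambda>\<omega>. (Q (Suc n) \<omega> - expectation (Q (Suc n)))\<^sup>2)
      \<le> real n * B1 + 4 * Cmax ^ 4 / real M * (real n)\<^sup>2 + 4 * real n * Cmax ^ 4 / real M + B1"
      by simp
    also have "\<dots> \<le> real (Suc n) * B1 + 4 * Cmax ^ 4 / real M * (real (Suc n))\<^sup>2"
    proof -
      \<comment> \<open>The cross term of step n adds a multiple of n, and n^2 + n <= (n +
        1)^2.\<close>
      have "4 * Cmax ^ 4 / real M * ((real n)\<^sup>2 + real n) \<le> 4 * Cmax ^ 4 / real M * (real (Suc n))\<^sup>2"
        by (intro mult_left_mono) (auto simp: power2_eq_square algebra_simps)
      then show ?thesis by (simp add: algebra_simps add_divide_distrib)
    qed
    finally show ?case .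
  }
qed

end

section \<open>The asymptotic comparison\<close>

text \<open>With X the maximum divided by M^3 one has K / M^3 <= X and 1 / M <= M^(-\<delta>) X, so
  every additive error of order 1/M is negligible relative to X, uniformly in K. Half of \<epsilon>
  pays for the error inside the logarithm, and two quarters for moving the error outside the
  logarithm into it.\<close>

lemma rate_bound_absorb:
  fixes a \<beta> \<epsilon> \<delta> :: real
  assumes a: "0 < a" and \<beta>: "0 \<le> \<beta>" and \<epsilon>: "0 < \<epsilon>" and \<delta>: "0 < \<delta>"
  shows "eventually (\<lambda>M. \<forall>K\<ge>0. ln (1 + a * (pi\<^sup>2 / 16 * (K / real M ^ 3) + 1 / real M) / (1 - 1 / real M)) + \<beta> / real M
    \<le> ln (1 + pi\<^sup>2 / 16 * a * (max K (real M powr (2 + \<delta>)) / real M ^ 3) * (1 + \<epsilon>))) sequentially"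
proof -
  define b where "b = pi\<^sup>2 / 16 * a"
  have b: "0 < b" using a by (simp add: b_def)
  have p: "(\<lambda>M. real M powr (- \<delta>)) \<longlonglongrightarrow> 0"
    using \<delta> by (intro tendsto_neg_powr filterlim_real_sequentially) auto
  have i: "(\<lambda>M. 1 / real M) \<longlonglongrightarrow> 0" by (rule lim_1_over_n)
  have "(\<lambda>M. (pi\<^sup>2 / 16 + real M powr (- \<delta>)) / (1 - 1 / real M)) \<longlonglongrightarrow> (pi\<^sup>2 / 16 + 0) / (1 - 0)"
    by (intro tendsto_intros p i) simp
  moreover have "(pi\<^sup>2 / 16 + 0) / (1 - 0) < pi\<^sup>2 / 16 * (1 + \<epsilon> / 2)"
    using \<epsilon> by (simp add: field_simps)
  ultimately have e1: "\<forall>\<^sub>F M in sequentially. (pi\<^sup>2 / 16 + real M powr (- \<delta>)) / (1 - 1 / real M) < pi\<^sup>2 / 16 * (1 + \<epsilon> / 2)"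
    by (rule order_tendstoD(2))
  have "(\<lambda>M. \<beta> * (1 / real M)) \<longlonglongrightarrow> \<beta> * 0" by (intro tendsto_intros i)
  \<comment> \<open>The bound 1 permits the quadratic estimate of the exponential; the other one is
    solved from \<open>2 * \<eta> * (1 + \<epsilon> / 2) \<le> \<epsilon> / 4\<close>.\<close>
  then have e2: "\<forall>\<^sub>F M in sequentially. \<beta> * (1 / real M) < min 1 (\<epsilon> / 4 / (2 * (1 + \<epsilon> / 2)))"
    by (rule order_tendstoD(2)) (use \<epsilon> in auto)
  have "(\<lambda>M. 2 * \<beta> * real M powr (- \<delta>)) \<longlonglongrightarrow> 2 * \<beta> * 0" by (intro tendsto_intros p)
  then have e3: "\<forall>\<^sub>F M in sequentially. 2 * \<beta> * real M powr (- \<delta>) < b * \<epsilon> / 4"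
    by (rule order_tendstoD(2)) (use \<epsilon> b in auto)
  have e4: "\<forall>\<^sub>F M in sequentially. 2 \<le> M" by (rule eventually_ge_at_top)
  show ?thesis
    using e1 e2 e3 e4
  proof eventually_elim
    case (elim M)
    show ?case
    proof (intro allI impI)
      fix K :: real assume K: "0 \<le> K"
      define X where "X = max K (real M powr (2 + \<delta>)) / real M ^ 3"
      let ?u = "a * (pi\<^sup>2 / 16 * (K / real M ^ 3) + 1 / real M) / (1 - 1 / real M)"
      define \<eta> where "\<eta> = \<beta> / real M"
      have M: "2 \<le> real M" using elim(4) by simp
      have iM: "0 < 1 - 1 / real M" using M by (simp add: field_simps)
      have X1: "K / real M ^ 3 \<le> X" unfolding X_def by (intro divide_right_mono) auto
      have X2: "1 / real M \<le> real M powr (- \<delta>) * X"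
      proof -
        have "real M powr (2 + \<delta>) = real M powr 2 * real M powr \<delta>" by (rule powr_add)
        also have "real M powr 2 = (real M)\<^sup>2" using M by simp
        finally have "real M powr (- \<delta>) * (real M powr (2 + \<delta>) / real M ^ 3) = 1 / real M"
          using M by (simp add: powr_minus field_simps power2_eq_square power3_eq_cube)
        then have "1 / real M = real M powr (- \<delta>) * (real M powr (2 + \<delta>) / real M ^ 3)" ..
        also have "\<dots> \<le> real M powr (- \<delta>) * X"
          unfolding X_def by (intro mult_left_mono divide_right_mono) auto
        finally show ?thesis .
      qed
      have X0: "0 < X"
        unfolding X_def using M by (intro divide_pos_pos) (auto simp: less_max_iff_disj)
      have "?u
          \<le> a * (pi\<^sup>2 / 16 * X + real M powr (- \<delta>) * X) / (1 - 1 / real M)"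
        using a iM X1 X2 by (intro divide_right_mono mult_left_mono add_mono) auto
      also have "\<dots> = a * X * ((pi\<^sup>2 / 16 + real M powr (- \<delta>)) / (1 - 1 / real M))"
        by (simp add: algebra_simps)
      also have "\<dots> \<le> a * X * (pi\<^sup>2 / 16 * (1 + \<epsilon> / 2))"
        using elim(1) a X0 by (intro mult_left_mono) auto
      also have "\<dots> = b * X * (1 + \<epsilon> / 2)" by (simp add: b_def)
      finally have s: "?u \<le> b * X * (1 + \<epsilon> / 2)" .
      have s0: "0 \<le> ?u"
        using a K iM by (intro divide_nonneg_nonneg mult_nonneg_nonneg add_nonneg_nonneg) auto
      have \<eta>: "0 \<le> \<eta>" "\<eta> \<le> 1" "2 * \<eta> * (1 + \<epsilon> / 2) \<le> \<epsilon> / 4"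
      proof -
        show "0 \<le> \<eta>" using \<beta> by (simp add: \<eta>_def)
        have *: "\<eta> < min 1 (\<epsilon> / 4 / (2 * (1 + \<epsilon> / 2)))" using elim(2) by (simp add: \<eta>_def)
        then show "\<eta> \<le> 1" by simp
        have "\<eta> \<le> \<epsilon> / 4 / (2 * (1 + \<epsilon> / 2))" using * by simp
        then have "\<eta> * (2 * (1 + \<epsilon> / 2)) \<le> \<epsilon> / 4"
          using \<epsilon> by (subst (asm) pos_le_divide_eq) auto
        then show "2 * \<eta> * (1 + \<epsilon> / 2) \<le> \<epsilon> / 4" by (simp add: mult_ac)
      qed
      have \<eta>X: "2 * \<eta> \<le> b * X * (\<epsilon> / 4)"
      proof -
        have "2 * \<eta> = 2 * \<beta> * (1 / real M)" by (simp add: \<eta>_def)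
        also have "\<dots> \<le> 2 * \<beta> * (real M powr (- \<delta>) * X)" using \<beta> X2 by (intro mult_left_mono) auto
        also have "\<dots> = (2 * \<beta> * real M powr (- \<delta>)) * X" by simp
        also have "\<dots> \<le> (b * \<epsilon> / 4) * X" using elim(3) X0 by (intro mult_right_mono) auto
        finally show ?thesis by (simp add: mult_ac)
      qed
      have ex: "exp \<eta> \<le> 1 + 2 * \<eta>"
      proof -
        have "exp \<eta> \<le> 1 + \<eta> + \<eta>\<^sup>2" using \<eta> by (intro exp_bound) auto
        also have "\<eta>\<^sup>2 \<le> \<eta>" using \<eta> by (simp add: power2_eq_square mult_left_le)
        finally show ?thesis by simp
      qed
      have bX: "0 \<le> b * X" using b X0 by simp
      \<comment> \<open>The additive error \<eta> becomes the factor exp \<eta> inside the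
        logarithm. Expanding the product leaves 2 \<eta> and a mixed term, each at most a quarter of
        \<epsilon> times \<open>b * X\<close>.\<close>
      have "(1 + ?u) * exp \<eta>
          \<le> (1 + b * X * (1 + \<epsilon> / 2)) * (1 + 2 * \<eta>)"
        using s s0 ex \<eta> by (intro mult_mono) auto
      also have "\<dots> = 1 + b * X * (1 + \<epsilon> / 2) + 2 * \<eta> + b * X * (2 * \<eta> * (1 + \<epsilon> / 2))"
        by (simp add: algebra_simps)
      also have "\<dots> \<le> 1 + b * X * (1 + \<epsilon> / 2) + b * X * (\<epsilon> / 4) + b * X * (\<epsilon> / 4)"
        using \<eta>X mult_left_mono[OF \<eta>(3) bX] by linarith
      also have "\<dots> = 1 + b * X * (1 + \<epsilon>)" by (simp add: algebra_simps)
      finally have le: "(1 + ?u) * exp \<eta> \<le> 1 + b * X * (1 + \<epsilon>)" .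
      have "ln (1 + ?u) + \<eta>
          = ln ((1 + ?u) * exp \<eta>)"
        using s0 by (subst ln_mult_pos) auto
      also have "\<dots> \<le> ln (1 + b * X * (1 + \<epsilon>))"
        using le s0 by (intro ln_mono) (auto intro!: mult_pos_pos)
      finally show "ln (1 + ?u) + \<beta> / real M
          \<le> ln (1 + pi\<^sup>2 / 16 * a * (max K (real M powr (2 + \<delta>)) / real M ^ 3) * (1 + \<epsilon>))"
        unfolding b_def X_def \<eta>_def by simp
    qed
  qed
qed

text \<open>Besides ln (e / x) <= e / x - 1, the identity e / x - 1 = (1 - x / e) + (x - e)^2 / (e
  x) is used: the first term has mean zero at e = E D, and the denominator of the second is at least
  d^2.\<close>

lemma (in prob_space) ln_expectation_gap:
  fixes D :: "'a \<Rightarrow> real"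
  assumes d: "0 < d" and D: "\<And>\<omega>. d \<le> D \<omega>" and si: "in_L2 M D"
    and ln_int: "integrable M (\<lambda>\<omega>. ln (D \<omega>))"
  shows "ln (expectation D) - expectation (\<lambda>\<omega>. ln (D \<omega>)) \<le> expectation (\<lambda>\<omega>. (D \<omega> - expectation D)\<^sup>2) / d\<^sup>2"
proof -
  define e where "e = expectation D"
  have iD: "integrable M D" using si by (rule in_L2_imp_integrable)
  have "d = expectation (\<lambda>\<omega>. d)" by (simp add: prob_space)
  also have "\<dots> \<le> e" unfolding e_def using D iD by (intro integral_mono) auto
  finally have e: "d \<le> e" .
  have "in_L2 M (\<lambda>\<omega>. D \<omega> + - e)"
    by (intro in_L2_add si in_L2_const)
  then have i2: "integrable M (\<lambda>\<omega>. (D \<omega> - e)\<^sup>2)"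
    by (auto dest: in_L2_norm)
  have pt: "ln e - ln (D \<omega>) \<le> (1 - D \<omega> / e) + (D \<omega> - e)\<^sup>2 / d\<^sup>2" for \<omega>
  proof -
    define x where "x = D \<omega>"
    have x: "d \<le> x" using D by (simp add: x_def)
    have "ln (e / x) \<le> e / x - 1" using d e x by (intro ln_le_minus_one) auto
    also have "\<dots> = (1 - x / e) + (x - e)\<^sup>2 / (e * x)"
      using d e x by (simp add: field_simps power2_eq_square)
    also have "(x - e)\<^sup>2 / (e * x) \<le> (x - e)\<^sup>2 / d\<^sup>2"
      unfolding power2_eq_square[of d] using d e x by (intro divide_left_mono mult_mono mult_pos_pos) auto
    finally show ?thesis using d e x by (simp add: ln_div x_def)
  qed
  have "expectation (\<lambda>\<omega>. ln e - ln (D \<omega>)) \<le> expectation (\<lambda>\<omega>. (1 - D \<omega> / e) + (D \<omega> - e)\<^sup>2 / d\<^sup>2)"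
    using pt iD i2 ln_int by (intro integral_mono) auto
  also have "\<dots> = expectation (\<lambda>\<omega>. (D \<omega> - e)\<^sup>2) / d\<^sup>2"
    using iD i2 d e by (simp add: prob_space e_def[symmetric])
  finally show ?thesis
    using ln_int by (simp add: prob_space e_def[symmetric])
qed

section \<open>Protocol P1\<close>

lemma (in prob_space) indep_vars_time_slice:
  assumes "indep_vars (\<lambda>_. borel) (\<lambda>(t, i). X t i) (UNIV \<times> I)"
  shows "indep_vars (\<lambda>_. borel) (X t) I"
proof -
  let ?X = "\<lambda>(t, i). X t i"
  have "indep_vars (\<lambda>j. PiM {(t, j)} (\<lambda>_. borel)) (\<lambda>j \<omega>. \<lambda>i\<in>{(t, j)}. ?X i \<omega>) I"
    by (rule indep_vars_restrict[OF assms]) (auto simp: disjoint_family_on_def)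
  then have "indep_vars (\<lambda>_. borel) (\<lambda>j \<omega>. (\<lambda>i\<in>{(t, j)}. ?X i \<omega>) (t, j)) I"
    by (rule indep_vars_compose2) measurable
  then show ?thesis by simp
qed

lemma (in prob_space) indep_var_time_slice:
  assumes ind: "indep_var
       (\<Pi>\<^sub>M _\<in>UNIV \<times> I. borel) (\<lambda>\<omega>. \<lambda>(t, i)\<in>UNIV \<times> I. X t i \<omega>)
       (\<Pi>\<^sub>M _\<in>UNIV \<times> J. borel) (\<lambda>\<omega>. \<lambda>(t, i)\<in>UNIV \<times> J. X t i \<omega>)"
  shows "indep_var (PiM I (\<lambda>_. borel)) (\<lambda>\<omega>. \<lambda>i\<in>I. X t i \<omega>) (PiM J (\<lambda>_. borel)) (\<lambda>\<omega>. \<lambda>i\<in>J. X t i \<omega>)"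
proof -
  have m: "(\<lambda>x. \<lambda>i\<in>B. x (t, i)) \<in> measurable (PiM (UNIV \<times> B) (\<lambda>_. borel)) (PiM B (\<lambda>_. borel))" for B
    by (intro measurable_restrict measurable_component_singleton) auto
  have "indep_var (PiM I (\<lambda>_. borel)) ((\<lambda>x. \<lambda>i\<in>I. x (t, i)) \<circ> (\<lambda>\<omega>. \<lambda>(t, i)\<in>UNIV \<times> I. X t i \<omega>))
      (PiM J (\<lambda>_. borel)) ((\<lambda>x. \<lambda>i\<in>J. x (t, i)) \<circ> (\<lambda>\<omega>. \<lambda>(t, i)\<in>UNIV \<times> J. X t i \<omega>))"
    by (rule indep_var_compose[OF ind m m])
  moreover have "(\<lambda>x. \<lambda>i\<in>B. x (t, i)) \<circ> (\<lambda>\<omega>. \<lambda>(t, i)\<in>UNIV \<times> B. X t i \<omega>) = (\<lambda>\<omega>. \<lambda>i\<in>B. X t i \<omega>)" for B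
    by (auto simp: fun_eq_iff restrict_def)
  ultimately show ?thesis by simp
qed

lemma random_modelD:
  assumes "random_model M K \<sigma>2 \<Omega> X"
  shows "prob_space.indep_vars \<Omega> (\<lambda>_. borel) (\<lambda>(t, i). X t i) (UNIV \<times> input_labels M K)"
    and "prob_space.indep_var \<Omega>
       (\<Pi>\<^sub>M _\<in>UNIV \<times> gain_labels M K. borel) (\<lambda>\<omega>. \<lambda>(t, i)\<in>UNIV \<times> gain_labels M K. X t i \<omega>)
       (\<Pi>\<^sub>M _\<in>UNIV \<times> input_labels M K. borel) (\<lambda>\<omega>. \<lambda>(t, i)\<in>UNIV \<times> input_labels M K. X t i \<omega>)"
    and "\<And>a. a \<in> {1..M} \<Longrightarrow> complex_normal \<Omega> (1 / real M) (X t (Signal a))"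
    and "\<And>k. k \<in> {1..K} \<Longrightarrow> complex_normal \<Omega> \<sigma>2 (X t (Relay_noise k))"
    and "\<And>a. a \<in> {1..M} \<Longrightarrow> complex_normal \<Omega> \<sigma>2 (X t (Dst_noise a))"
  using assms unfolding random_model_def by blast+

section \<open>A single network of fixed size\<close>

locale p1_channel =
  fixes M K :: nat and E_lo E_hi P_lo P_hi P_rel \<sigma>2 :: real and N :: "'a network" and t m :: nat
  assumes net: "p1_network M K E_lo E_hi P_lo P_hi \<sigma>2 N"
    and MK: "0 < M" "0 < K" "M dvd K" and m: "m \<in> {1..M}"
    and E: "0 < E_lo" "E_lo \<le> E_hi" and P: "0 < P_lo" "P_lo \<le> P_hi" "0 < P_rel" and \<sigma>2: "0 < \<sigma>2"
begin

abbreviation "\<Omega> \<equiv> prob_sp N"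
abbreviation "X \<equiv> rv N t"
abbreviation "C2 \<equiv> C2_P1 M K P_rel \<sigma>2 N m"
abbreviation "C1 \<equiv> C1_P1 M K P_rel \<sigma>2 N m"
abbreviation "out \<equiv> received M K P_rel \<sigma>2 N t m"
abbreviation "gain_space \<equiv> PiM (gain_labels M K) (\<lambda>_. borel :: complex measure)"

definition C_lo where "C_lo = sqrt (P_lo * E_lo * P_rel / (E_hi + \<sigma>2))"
definition C_hi where "C_hi = sqrt (P_hi * E_hi * P_rel / (E_lo + \<sigma>2))"
definition c_lo where "c_lo = sqrt (P_lo * P_rel / (E_hi + \<sigma>2))"
definition c_hi where "c_hi = sqrt (P_hi * P_rel / (E_lo + \<sigma>2))"

lemma src_amp: "k \<in> {1..K} \<Longrightarrow> a \<in> {1..M} \<Longrightarrow> E_lo \<le> src_amp N k a" "k \<in> {1..K} \<Longrightarrow> a \<in> {1..M} \<Longrightarrow> src_amp N k a \<le> E_hi"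
  and dst_amp: "k \<in> {1..K} \<Longrightarrow> P_lo \<le> dst_amp N m k" "k \<in> {1..K} \<Longrightarrow> dst_amp N m k \<le> P_hi"
  using net m unfolding p1_network_def by auto

text \<open>The number \<open>e\<close> is the average of the source coefficients at relay
  \<open>k\<close>. The factor K under the square root cancels that in \<open>d_P1\<close>, which is
  why the bounding constants depend on neither M nor K.\<close>

lemma gain_power:
  assumes k: "k \<in> {1..K}"
  obtains e where "(sqrt (real K) * d_P1 M K P_rel \<sigma>2 N k)\<^sup>2 = P_rel / (e + \<sigma>2)" "E_lo \<le> e" "e \<le> E_hi"
    "0 \<le> sqrt (real K) * d_P1 M K P_rel \<sigma>2 N k"
proof
  define e where "e = (\<Sum>a=1..M. src_amp N k a) / real M"
  have "real M * E_lo \<le> (\<Sum>a=1..M. src_amp N k a)"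
    using sum_bounded_below[of "{1..M}" E_lo "src_amp N k"] src_amp k by simp
  then show e_lo: "E_lo \<le> e" using MK by (simp add: e_def field_simps)
  have "(\<Sum>a=1..M. src_amp N k a) \<le> real M * E_hi"
    using sum_bounded_above[of "{1..M}" "src_amp N k" E_hi] src_amp k by simp
  then show "e \<le> E_hi" using MK by (simp add: e_def field_simps)
  define y where "y = real K * (e + \<sigma>2)"
  have y: "0 < y" using MK e_lo E \<sigma>2 by (simp add: y_def)
  have "real K / real M * (\<Sum>a=1..M. src_amp N k a) + real K * \<sigma>2 = y"
    by (simp add: y_def e_def distrib_left)
  then have d: "d_P1 M K P_rel \<sigma>2 N k = sqrt P_rel * y powr (- 1 / 2)"
    by (simp add: d_P1_def)
  have "(y powr (- 1 / 2))\<^sup>2 = y powr (- 1)"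
    unfolding power2_eq_square by (simp add: powr_add[symmetric])
  also have "\<dots> = 1 / y" using y by (simp add: powr_minus_divide)
  finally show "(sqrt (real K) * d_P1 M K P_rel \<sigma>2 N k)\<^sup>2 = P_rel / (e + \<sigma>2)"
    unfolding d power_mult_distrib using P MK by (simp add: y_def)
  show "0 \<le> sqrt (real K) * d_P1 M K P_rel \<sigma>2 N k"
    unfolding d using P by simp
qed

text \<open>Stated for a general factor \<open>x\<close> to serve both kinds of coefficients:
  \<open>x\<close> is a product of the two amplitudes for signals and \<open>dst_amp\<close> alone
  for relay noise.\<close>

lemma amplitude_bounds:
  assumes k: "k \<in> {1..K}" and x: "0 < x\<^sub>1" "x\<^sub>1 \<le> x" "x \<le> x\<^sub>2"
  defines "y \<equiv> sqrt (real K) * d_P1 M K P_rel \<sigma>2 N k * sqrt x"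
  shows "0 \<le> y" "sqrt (x\<^sub>1 * P_rel / (E_hi + \<sigma>2)) \<le> y" "y \<le> sqrt (x\<^sub>2 * P_rel / (E_lo + \<sigma>2))"
proof -
  obtain e where e: "(sqrt (real K) * d_P1 M K P_rel \<sigma>2 N k)\<^sup>2 = P_rel / (e + \<sigma>2)" "E_lo \<le> e" "e \<le> E_hi"
    "0 \<le> sqrt (real K) * d_P1 M K P_rel \<sigma>2 N k" using gain_power[OF k] .
  show nn: "0 \<le> y"
    unfolding y_def by (rule mult_nonneg_nonneg[OF e(4)]) (use x in simp)
  have eq: "y\<^sup>2 = x * P_rel / (e + \<sigma>2)"
    unfolding y_def power_mult_distrib[of "sqrt (real K) * d_P1 M K P_rel \<sigma>2 N k"] e(1) using x by simp
  have "x\<^sub>1 * P_rel / (E_hi + \<sigma>2) \<le> y\<^sup>2"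
    unfolding eq using x e E P \<sigma>2 by (intro frac_le mult_mono) auto
  then show "sqrt (x\<^sub>1 * P_rel / (E_hi + \<sigma>2)) \<le> y"
    using nn by (rule real_le_lsqrt[rotated 1])
  have "y\<^sup>2 \<le> x\<^sub>2 * P_rel / (E_lo + \<sigma>2)"
    unfolding eq using x e E P \<sigma>2 by (intro frac_le mult_mono) auto
  then show "y \<le> sqrt (x\<^sub>2 * P_rel / (E_lo + \<sigma>2))"
    by (rule real_le_rsqrt)
qed

lemma C2_bounds:
  assumes k: "k \<in> {1..K}" and a: "a \<in> {1..M}"
  shows "0 \<le> C2 a k" "C_lo \<le> C2 a k" "C2 a k \<le> C_hi"
proof -
  have "0 < P_lo * E_lo" "P_lo * E_lo \<le> dst_amp N m k * src_amp N k a" "dst_amp N m k * src_amp N k a \<le> P_hi * E_hi"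
    using src_amp[OF k a] dst_amp[OF k] E P by (auto intro!: mult_mono)
  from amplitude_bounds[OF k this] show "0 \<le> C2 a k" "C_lo \<le> C2 a k" "C2 a k \<le> C_hi"
    by (simp_all add: C2_P1_def C_lo_def C_hi_def)
qed

lemma C1_bounds:
  assumes k: "k \<in> {1..K}"
  shows "0 \<le> C1 k" "c_lo \<le> C1 k" "C1 k \<le> c_hi"
  using amplitude_bounds[OF k P(1) dst_amp[OF k]] by (simp_all add: C1_P1_def c_lo_def c_hi_def)

lemma model: "random_model M K \<sigma>2 \<Omega> (rv N)"
  using net by (simp add: p1_network_def)

sublocale prob_space \<Omega>
  using model by (simp add: random_model_def)

sublocale relay_rows \<Omega> X M K m "partner N" C2 C1 C_hi c_hi \<sigma>2
proof
  show "indep_vars (\<lambda>_. borel) X (gain_labels M K)"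
    and "i \<in> gain_labels M K \<Longrightarrow> complex_normal \<Omega> 1 (X i)" for i
    using model by (auto simp: random_model_def)
  have "partner N ` {1..K} \<subseteq> {1..M}"
    using net by (simp only: p1_network_def relay_partition_def)
  then show "partner N k \<in> {1..M}" if "k \<in> {1..K}" for k
    using that by blast
qed (simp_all only: m \<sigma>2[THEN less_imp_le] C1_bounds C2_bounds)

lemma w_eq: "w a k = a_coeff M K P_rel \<sigma>2 N t m a k"
  by (simp add: fun_eq_iff w_def a_coeff_def)

section \<open>The received signal as a linear fading channel\<close>

definition A :: "'a \<Rightarrow> complex" where
  "A \<omega> = of_real (1 / sqrt (real K)) * S K m \<omega>"

definition D :: "'a \<Rightarrow> real" where
  "D \<omega> = \<sigma>2 + Q K \<omega> / real K"

lemma Q_nonneg: "0 \<le> Q n \<omega>"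
  unfolding Q_def r_def using \<sigma>2 by (intro add_nonneg_nonneg divide_nonneg_nonneg sum_nonneg mult_nonneg_nonneg) auto

lemma D_ge: "\<sigma>2 \<le> D \<omega>"
  unfolding D_def using Q_nonneg by simp

lemma in_L2_A: "in_L2 \<Omega> A"
  unfolding A_def[abs_def] using m by (intro in_L2_cmult in_L2_S) auto

lemma in_L2_D: "in_L2 \<Omega> D"
  unfolding D_def[abs_def] divide_inverse mult.commute[of _ "inverse (real K)"]
  by (intro in_L2_add in_L2_const in_L2_cmult Q_moments) simp

text \<open>The coefficients as functions of the vector of gains rather than of the sample point,
  the form in which \<open>distributed_linear_fading\<close> separates gains from inputs.\<close>

definition a_fun :: "nat \<Rightarrow> nat \<Rightarrow> (label \<Rightarrow> complex) \<Rightarrow> complex" where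
  "a_fun a k x = of_real (C2 a k) * cnj (phase (x (Dst_gain (partner N k) k))) * x (Dst_gain m k) *
     cnj (phase (x (Src_gain k (partner N k)))) * x (Src_gain k a)"

definition b_fun :: "nat \<Rightarrow> (label \<Rightarrow> complex) \<Rightarrow> complex" where
  "b_fun k x = of_real (C1 k) * cnj (phase (x (Dst_gain (partner N k) k))) * x (Dst_gain m k) *
     cnj (phase (x (Src_gain k (partner N k))))"

definition G :: "'a \<Rightarrow> label \<Rightarrow> complex" where
  "G \<omega> = (\<lambda>i\<in>gain_labels M K. X i \<omega>)"

text \<open>Every input that disturbs destination \<open>m\<close> except its own noise, which is
  the distinguished summand of coefficient 1.\<close>

definition J :: "label set" where
  "J = Signal ` others \<union> Relay_noise ` {1..K}"

definition signal_fun :: "nat \<Rightarrow> (label \<Rightarrow> complex) \<Rightarrow> complex" where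
  "signal_fun a x = of_real (1 / sqrt (real K)) * (\<Sum>k=1..K. a_fun a k x)"

text \<open>Extended by 0 outside \<open>J\<close>, so that measurability holds for every label and
  not only for those in the sum.\<close>

definition \<alpha> :: "label \<Rightarrow> (label \<Rightarrow> complex) \<Rightarrow> complex" where
  "\<alpha> j x = (if j \<in> J then (case j of Signal a \<Rightarrow> signal_fun a x
      | Relay_noise k \<Rightarrow> of_real (1 / sqrt (real K)) * b_fun k x | _ \<Rightarrow> 0) else 0)"

definition input_power :: "label \<Rightarrow> real" where
  "input_power j = (case j of Signal a \<Rightarrow> 1 / real M | _ \<Rightarrow> \<sigma>2)"

lemma partner: "k \<in> {1..K} \<Longrightarrow> partner N k \<in> {1..M}"
  by (rule p)

lemma measurable_a_fun:
  assumes k: "k \<in> {1..K}" and a: "a \<in> {1..M}"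
  shows "a_fun a k \<in> borel_measurable (gain_space)"
    and "b_fun k \<in> borel_measurable (gain_space)"
proof -
  have [measurable]: "(\<lambda>x. x i) \<in> borel_measurable (gain_space)" if "i \<in> gain_labels M K" for i
    by (rule measurable_component_singleton[OF that])
  have [measurable]: "Dst_gain (partner N k) k \<in> gain_labels M K" "Dst_gain m k \<in> gain_labels M K"
    "Src_gain k (partner N k) \<in> gain_labels M K" "Src_gain k a \<in> gain_labels M K"
    using k a m partner[OF k] by (auto intro: Src_gain_in Dst_gain_in)
  show "a_fun a k \<in> borel_measurable (gain_space)"
    unfolding a_fun_def[abs_def] by measurable
  show "b_fun k \<in> borel_measurable (gain_space)"
    unfolding b_fun_def[abs_def] by measurable
qed

lemma measurable_signal_fun:
  "a \<in> {1..M} \<Longrightarrow> signal_fun a \<in> borel_measurable (gain_space)"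
  unfolding signal_fun_def[abs_def]
  by (intro borel_measurable_times borel_measurable_sum borel_measurable_const measurable_a_fun)

lemma measurable_\<alpha>: "\<alpha> j \<in> borel_measurable (gain_space)"
proof (cases "j \<in> J")
  case True
  then consider a where "j = Signal a" "a \<in> others" | k where "j = Relay_noise k" "k \<in> {1..K}"
    by (auto simp: J_def)
  then show ?thesis
  proof cases
    case 1
    then show ?thesis
      using True measurable_signal_fun[OF others_subset, of a] by (simp add: \<alpha>_def[abs_def])
  next
    case 2
    then show ?thesis
      using True measurable_a_fun(2)[OF _ m, of k] by (simp add: \<alpha>_def[abs_def])
  qed
qed (simp add: \<alpha>_def[abs_def])

lemma a_fun_G:
  assumes k: "k \<in> {1..K}" and a: "a \<in> {1..M}"
  shows "a_fun a k (G \<omega>) = w a k \<omega>" and "b_fun k (G \<omega>) = b_coeff M K P_rel \<sigma>2 N t m k \<omega>"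
  using Dst_gain_in[OF k partner[OF k]] Dst_gain_in[OF k m] Src_gain_in[OF k partner[OF k]] Src_gain_in[OF k a]
  by (simp_all add: a_fun_def b_fun_def w_def b_coeff_def G_def)

lemma signal_fun_G: "a \<in> {1..M} \<Longrightarrow> signal_fun a (G \<omega>) = of_real (1 / sqrt (real K)) * S K a \<omega>"
  by (simp add: signal_fun_def S_def a_fun_G)

lemma sum_J: "(\<Sum>j\<in>J. f j) = (\<Sum>a\<in>others. f (Signal a)) + (\<Sum>k=1..K. f (Relay_noise k))"
proof -
  have "(\<Sum>j\<in>J. f j) = (\<Sum>j\<in>Signal ` others. f j) + (\<Sum>j\<in>Relay_noise ` {1..K}. f j)"
    unfolding J_def using finite_others by (intro sum.union_disjoint) auto
  then show ?thesis by (simp add: sum.reindex inj_on_def)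
qed

lemma received_eq:
  "out \<omega> = X (Signal m) \<omega> * signal_fun m (G \<omega>) +
     (X (Dst_noise m) \<omega> + (\<Sum>j\<in>J. \<alpha> j (G \<omega>) * X j \<omega>))"
proof -
  have "(\<Sum>j\<in>J. \<alpha> j (G \<omega>) * X j \<omega>) = (\<Sum>a\<in>others. of_real (1 / sqrt (real K)) * S K a \<omega> * X (Signal a) \<omega>)
      + (\<Sum>k=1..K. of_real (1 / sqrt (real K)) * b_coeff M K P_rel \<sigma>2 N t m k \<omega> * X (Relay_noise k) \<omega>)"
    unfolding sum_J using a_fun_G(2)[OF _ m]
    by (intro arg_cong2[where f="(+)"] sum.cong refl) (simp_all add: \<alpha>_def J_def signal_fun_G[OF others_subset])
  then show ?thesis
    unfolding received_def others_def[symmetric] signal_fun_G[OF m]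
    by (simp add: S_def w_eq sum_distrib_left mult_ac)
qed

text \<open>Identifies the conditional variance delivered by the fading argument with the quadratic
  form \<open>Q\<close>, whose variance has been estimated.\<close>

lemma D_eq: "D \<omega> = \<sigma>2 + (\<Sum>j\<in>J. (cmod (\<alpha> j (G \<omega>)))\<^sup>2 * input_power j)"
proof -
  have 1: "(cmod (of_real (1 / sqrt (real K)) * z))\<^sup>2 = (cmod z)\<^sup>2 / real K" for z
    by (simp add: norm_divide power_divide norm_mult power_mult_distrib)
  have b: "(cmod (b_coeff M K P_rel \<sigma>2 N t m k \<omega>))\<^sup>2 * \<sigma>2 = r k \<omega>" for k
    by (simp add: b_coeff_def r_def norm_mult power_mult_distrib)
  have "(\<Sum>j\<in>J. (cmod (\<alpha> j (G \<omega>)))\<^sup>2 * input_power j)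
      = (\<Sum>a\<in>others. (cmod (S K a \<omega>))\<^sup>2 / real K * (1 / real M))
      + (\<Sum>k=1..K. (cmod (b_coeff M K P_rel \<sigma>2 N t m k \<omega>))\<^sup>2 / real K * \<sigma>2)"
    unfolding sum_J using a_fun_G(2)[OF _ m]
    by (intro arg_cong2[where f="(+)"] sum.cong refl)
      (simp_all only: 1[symmetric], simp_all add: \<alpha>_def J_def input_power_def signal_fun_G[OF others_subset])
  also have "\<dots> = Q K \<omega> / real K"
    by (simp add: Q_def b[symmetric] add_divide_distrib sum_divide_distrib mult_ac)
  finally show ?thesis by (simp add: D_def)
qed

lemma joint_density:
  "distributed \<Omega> (lborel \<Otimes>\<^sub>M lborel) (\<lambda>\<omega>. (out \<omega>, X (Signal m) \<omega>))
    (\<lambda>(y, s). ennreal (cgauss (1 / real M) s * expectation (\<lambda>\<omega>. cgauss (D \<omega>) (y - s * A \<omega>))))"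
proof -
  have A: "A = (\<lambda>\<omega>. signal_fun m (G \<omega>))"
    using m by (auto simp: A_def signal_fun_G fun_eq_iff)
  have r: "out = (\<lambda>\<omega>. X (Signal m) \<omega> * signal_fun m (G \<omega>) +
     (X (Dst_noise m) \<omega> + (\<Sum>j\<in>J. \<alpha> j (G \<omega>) * X j \<omega>)))"
    by (simp add: fun_eq_iff received_eq)
  have D: "D = (\<lambda>\<omega>. \<sigma>2 + (\<Sum>j\<in>J. (cmod (\<alpha> j (G \<omega>)))\<^sup>2 * input_power j))"
    by (simp add: fun_eq_iff D_eq)
  show ?thesis
    unfolding A r D
  proof (rule distributed_linear_fading[where I="input_labels M K" and N="gain_space"])
    show "finite J" using finite_others by (simp add: J_def)
    show "Dst_noise m \<notin> J" "Signal m \<notin> insert (Dst_noise m) J"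
      by (auto simp: J_def others_def)
    show "insert (Signal m) (insert (Dst_noise m) J) \<subseteq> input_labels M K"
      using m by (auto simp: J_def others_def input_labels_def)
    show "indep_var (gain_space) G (PiM (input_labels M K) (\<lambda>_. borel)) (\<lambda>\<omega>. \<lambda>j\<in>input_labels M K. X j \<omega>)"
      unfolding G_def[abs_def] by (rule indep_var_time_slice[OF random_modelD(2)[OF model]])
    show "indep_vars (\<lambda>_. borel) X (input_labels M K)"
      by (rule indep_vars_time_slice[OF random_modelD(1)[OF model]])
    show "complex_normal \<Omega> \<sigma>2 (X (Dst_noise m))" "complex_normal \<Omega> (1 / real M) (X (Signal m))"
      using random_modelD(3-5)[OF model] m by auto
    show "complex_normal \<Omega> (input_power j) (X j)" "0 < input_power j" if "j \<in> J" for j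
      using that random_modelD(3-5)[OF model] \<sigma>2 MK by (auto simp: J_def others_def input_power_def)
    show "signal_fun m \<in> borel_measurable (gain_space)"
      using m by (rule measurable_signal_fun)
    show "\<alpha> j \<in> borel_measurable (gain_space)" for j
      by (rule measurable_\<alpha>)
  qed (use MK \<sigma>2 in auto)
qed

sublocale fading: gaussian_fading_channel \<Omega> A D "1 / real M" \<sigma>2 out "X (Signal m)"
proof
  show "A \<in> borel_measurable \<Omega>" "D \<in> borel_measurable \<Omega>"
    using in_L2_A in_L2_D by (auto dest: in_L2_measurable)
  show "integrable \<Omega> A" "integrable \<Omega> D"
    using in_L2_A in_L2_D by (auto intro: in_L2_imp_integrable)
  show "integrable \<Omega> (\<lambda>\<omega>. (cmod (A \<omega>))\<^sup>2)"
    using in_L2_A by (rule in_L2_norm)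
  show "0 < 1 / real M" using MK by simp
  show "0 < \<sigma>2" by (rule \<sigma>2)
  show "\<sigma>2 \<le> D \<omega>" for \<omega> by (rule D_ge)
  show "distributed \<Omega> (lborel \<Otimes>\<^sub>M lborel) (\<lambda>\<omega>. (out \<omega>, X (Signal m) \<omega>))
    (\<lambda>(y, s). ennreal (cgauss (1 / real M) s * expectation (\<lambda>\<omega>. cgauss (D \<omega>) (y - s * A \<omega>))))"
    by (rule joint_density)
qed

section \<open>Mean gain and noise power in terms of the constants of the claim\<close>

definition \<mu> :: real where "\<mu> = mean_gain M K P_rel \<sigma>2 N m"
definition noise_lo :: real where "noise_lo = C_lo\<^sup>2 + \<sigma>2 * (c_lo\<^sup>2 + 1)"
definition noise_hi :: real where "noise_hi = C_hi\<^sup>2 + \<sigma>2 * (c_hi\<^sup>2 + 1)"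

lemma C_lo_nonneg: "0 \<le> C_lo" "0 \<le> C_hi" "0 \<le> c_lo" "0 \<le> c_hi"
  unfolding C_lo_def C_hi_def c_lo_def c_hi_def using E P \<sigma>2 by simp_all

lemma noise_lo_pos: "0 < noise_lo"
  unfolding noise_lo_def using \<sigma>2 by (intro add_nonneg_pos mult_pos_pos) (auto simp: add_nonneg_pos)

lemma C2_square_bounds:
  assumes "k \<in> {1..K}" "a \<in> {1..M}"
  shows "C_lo\<^sup>2 \<le> (C2 a k)\<^sup>2" "(C2 a k)\<^sup>2 \<le> C_hi\<^sup>2"
  using C2_bounds[OF assms] C_lo_nonneg by (auto intro: power_mono)

lemma C1_square_bounds:
  assumes "k \<in> {1..K}"
  shows "c_lo\<^sup>2 \<le> (C1 k)\<^sup>2" "(C1 k)\<^sup>2 \<le> c_hi\<^sup>2"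
  using C1_bounds[OF assms] C_lo_nonneg by (auto intro: power_mono)

text \<open>Only the relays assigned to pair \<open>m\<close> combine coherently; the others have
  mean zero. Hence the number known to the destination is the mean of the effective gain.\<close>

lemma expectation_S_m: "expectation (S K m) = of_real (sqrt (real K) * \<mu>)"
proof -
  have "expectation (S K m) = (\<Sum>k=1..K. expectation (w m k))"
    using m by (rule expectation_S) simp
  also have "\<dots> = (\<Sum>k=1..K. if partner N k = m then of_real (C2 m k * (pi / 4)) else 0)"
    using expectation_w[OF _ m] by (intro sum.cong refl) auto
  also have "\<dots> = of_real (\<Sum>k | k \<in> {1..K} \<and> partner N k = m. C2 m k * (pi / 4))"
    by (simp only: of_real_sum sum.inter_filter[OF finite_atLeastAtMost] if_distrib[of complex_of_real] of_real_0)
  also have "(\<Sum>k | k \<in> {1..K} \<and> partner N k = m. C2 m k * (pi / 4)) = sqrt (real K) * \<mu>"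
    unfolding \<mu>_def mean_gain_def sum_distrib_right[symmetric] using MK by simp
  finally show ?thesis .
qed

lemma expectation_Re_A: "expectation (\<lambda>\<omega>. Re (A \<omega>)) = \<mu>"
proof -
  have iS: "integrable \<Omega> (S K m)"
    using m by (intro in_L2_imp_integrable in_L2_S) auto
  have "expectation (\<lambda>\<omega>. Re (A \<omega>)) = Re (expectation A)"
    by (rule integral_Re[OF fading.integrable_A])
  also have "expectation A = of_real (1 / sqrt (real K)) * expectation (S K m)"
    unfolding A_def[abs_def] using iS by (rule Bochner_Integration.integral_mult_right)
  finally show ?thesis
    using MK by (simp add: expectation_S_m)
qed

text \<open>The variance of \<open>A\<close> is the average over K independent relays of variances
  at most \<open>C_hi\<^sup>2\<close>; the factor 1 / K comes from the normalisation of
  \<open>A\<close>.\<close>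

lemma expectation_A_square: "expectation (\<lambda>\<omega>. (cmod (A \<omega>))\<^sup>2) \<le> \<mu>\<^sup>2 + C_hi\<^sup>2"
proof -
  have "expectation (\<lambda>\<omega>. (cmod (A \<omega>))\<^sup>2) = expectation (\<lambda>\<omega>. (cmod (S K m \<omega>))\<^sup>2) / real K"
    by (simp add: A_def norm_divide power_divide)
  also have "expectation (\<lambda>\<omega>. (cmod (S K m \<omega>))\<^sup>2)
      = real K * \<mu>\<^sup>2 + (\<Sum>k=1..K. (C2 m k)\<^sup>2 - (cmod (expectation (w m k)))\<^sup>2)"
    using expectation_S_square[OF m order_refl] unfolding expectation_S_m by (simp add: power_mult_distrib norm_mult)
  also have "\<dots> \<le> real K * \<mu>\<^sup>2 + (\<Sum>k=1..K. C_hi\<^sup>2)"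
  proof (intro add_left_mono sum_mono)
    fix k assume "k \<in> {1..K}"
    from C2_square_bounds(2)[OF this m]
    show "(C2 m k)\<^sup>2 - (cmod (expectation (w m k)))\<^sup>2 \<le> C_hi\<^sup>2"
      using zero_le_power2[of "cmod (expectation (w m k))"] by linarith
  qed
  also have "(real K * \<mu>\<^sup>2 + (\<Sum>k=1..K. C_hi\<^sup>2)) / real K = \<mu>\<^sup>2 + C_hi\<^sup>2"
    using MK by (simp add: add_divide_distrib)
  finally show ?thesis
    using MK by (simp add: divide_right_mono)
qed

lemma expectation_D: "expectation D = \<sigma>2 + (\<Sum>k=1..K. expectation (q k)) / real K"
proof -
  have "integrable \<Omega> (Q K)"
    using Q_moments(1)[of K] by (intro in_L2_imp_integrable) simp
  then have "expectation D = \<sigma>2 + expectation (Q K) / real K"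
    unfolding D_def[abs_def] by (simp add: prob_space)
  then show ?thesis using Q_moments(2)[of K] by simp
qed

lemma expectation_q:
  assumes k: "k \<in> {1..K}"
  shows "(1 - 1 / real M) * C_lo\<^sup>2 + \<sigma>2 * c_lo\<^sup>2 \<le> expectation (q k)"
    and "expectation (q k) \<le> (1 - 1 / real M) * C_hi\<^sup>2 + \<sigma>2 * c_hi\<^sup>2"
proof -
  have eq: "expectation (q k) = (\<Sum>a\<in>others. (C2 a k)\<^sup>2) / real M + \<sigma>2 * (C1 k)\<^sup>2"
    using has_bochner_integral_q[OF k] by (simp add: has_bochner_integral_iff)
  have card: "real (card others) * z / real M = (1 - 1 / real M) * z" for z
    using MK card_others by (simp add: field_simps of_nat_diff)
  have "real (card others) * C_lo\<^sup>2 \<le> (\<Sum>a\<in>others. (C2 a k)\<^sup>2)"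
    using C2_square_bounds(1)[OF k others_subset] by (intro sum_bounded_below)
  then have "(1 - 1 / real M) * C_lo\<^sup>2 \<le> (\<Sum>a\<in>others. (C2 a k)\<^sup>2) / real M"
    unfolding card[symmetric] by (rule divide_right_mono) simp
  then show "(1 - 1 / real M) * C_lo\<^sup>2 + \<sigma>2 * c_lo\<^sup>2 \<le> expectation (q k)"
    unfolding eq using C1_square_bounds(1)[OF k] \<sigma>2 by (intro add_mono mult_left_mono) auto
  have "(\<Sum>a\<in>others. (C2 a k)\<^sup>2) \<le> real (card others) * C_hi\<^sup>2"
    using C2_square_bounds(2)[OF k others_subset] by (intro sum_bounded_above)
  then have "(\<Sum>a\<in>others. (C2 a k)\<^sup>2) / real M \<le> (1 - 1 / real M) * C_hi\<^sup>2"
    unfolding card[symmetric] by (rule divide_right_mono) simp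
  then show "expectation (q k) \<le> (1 - 1 / real M) * C_hi\<^sup>2 + \<sigma>2 * c_hi\<^sup>2"
    unfolding eq using C1_square_bounds(2)[OF k] \<sigma>2 by (intro add_mono mult_left_mono) auto
qed

text \<open>There are M - 1 interferers of power 1 / M, hence the factor 1 - 1 / M on the
  interference part. In the lower bound it is extended to the noise part for uniformity; in the
  upper bound the free share \<open>C_hi\<^sup>2 / real M\<close> is kept for the variance of the
  effective gain.\<close>

lemma expectation_D_bounds:
  shows "(1 - 1 / real M) * noise_lo \<le> expectation D"
    and "C_hi\<^sup>2 / real M + expectation D \<le> noise_hi"
proof -
  have "real K * ((1 - 1 / real M) * C_lo\<^sup>2 + \<sigma>2 * c_lo\<^sup>2) \<le> (\<Sum>k=1..K. expectation (q k))"
    using sum_bounded_below[of "{1..K}" _ "\<lambda>k. expectation (q k)", OF expectation_q(1)] by simp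
  then have lo: "(1 - 1 / real M) * C_lo\<^sup>2 + \<sigma>2 * c_lo\<^sup>2 \<le> (\<Sum>k=1..K. expectation (q k)) / real K"
    using MK by (simp add: pos_le_divide_eq mult.commute)
  have "(1 - 1 / real M) * (\<sigma>2 * (c_lo\<^sup>2 + 1)) \<le> \<sigma>2 * (c_lo\<^sup>2 + 1)"
    using \<sigma>2 MK(1) by (intro mult_left_le_one_le) auto
  then show "(1 - 1 / real M) * noise_lo \<le> expectation D"
    using lo unfolding noise_lo_def expectation_D by (simp add: algebra_simps)
  have "(\<Sum>k=1..K. expectation (q k)) \<le> real K * ((1 - 1 / real M) * C_hi\<^sup>2 + \<sigma>2 * c_hi\<^sup>2)"
    using sum_bounded_above[of "{1..K}" "\<lambda>k. expectation (q k)", OF expectation_q(2)] by simp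
  then have "(\<Sum>k=1..K. expectation (q k)) / real K \<le> (1 - 1 / real M) * C_hi\<^sup>2 + \<sigma>2 * c_hi\<^sup>2"
    using MK by (simp add: pos_divide_le_eq mult.commute)
  then show "C_hi\<^sup>2 / real M + expectation D \<le> noise_hi"
    unfolding noise_hi_def expectation_D by (simp add: algebra_simps)
qed

lemma mean_gain_bounds: "pi / 4 * sqrt (real K) / real M * C_lo \<le> \<mu>" "\<mu> \<le> pi / 4 * sqrt (real K) / real M * C_hi"
proof -
  let ?I = "{k. k \<in> {1..K} \<and> partner N k = m}"
  let ?s = "\<Sum>k\<in>?I. C2 m k"
  have "card {k\<in>{1..K}. partner N k = m} = K div M"
    using net m by (simp only: p1_network_def relay_partition_def)
  \<comment> \<open>The quotient \<open>K div M\<close> is exact because M divides K.\<close>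
  then have card: "real (card ?I) = real K / real M"
    using MK by (simp add: real_of_nat_div)
  have "real (card ?I) * C_lo \<le> ?s"
    using C2_bounds(2)[OF _ m] by (intro sum_bounded_below) auto
  then have 1: "real K / real M * C_lo \<le> ?s" unfolding card .
  have "?s \<le> real (card ?I) * C_hi"
    using C2_bounds(3)[OF _ m] by (intro sum_bounded_above) auto
  then have 2: "?s \<le> real K / real M * C_hi" unfolding card .
  have e: "pi / (4 * sqrt (real K)) * (real K / real M * z) = pi / 4 * sqrt (real K) / real M * z" for z
  proof -
    have "pi / (4 * sqrt (real K)) * (real K / real M * z) = pi / 4 * (real K / sqrt (real K)) / real M * z"
      by simp
    also have "real K / sqrt (real K) = sqrt (real K)" by (rule real_div_sqrt) simp
    finally show ?thesis .
  qed
  have mu: "\<mu> = pi / (4 * sqrt (real K)) * ?s"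
    by (simp add: \<mu>_def mean_gain_def)
  show "pi / 4 * sqrt (real K) / real M * C_lo \<le> \<mu>"
    unfolding mu e[symmetric] by (rule mult_left_mono[OF 1]) simp
  show "\<mu> \<le> pi / 4 * sqrt (real K) / real M * C_hi"
    unfolding mu e[symmetric] by (rule mult_left_mono[OF 2]) simp
qed

text \<open>The squared mean is of order K / M^2, since K / M coherent relays carry the amplitude 1
  / sqrt K; the signal power supplies the third factor 1 / M.\<close>

lemma mean_gain_square_bounds:
  "pi\<^sup>2 / 16 * C_lo\<^sup>2 * (real K / real M ^ 3) \<le> \<mu>\<^sup>2 / real M"
  "\<mu>\<^sup>2 / real M \<le> pi\<^sup>2 / 16 * C_hi\<^sup>2 * (real K / real M ^ 3)"
proof -
  have e: "(pi / 4 * sqrt (real K) / real M * z)\<^sup>2 / real M = pi\<^sup>2 / 16 * z\<^sup>2 * (real K / real M ^ 3)" for z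
    by (simp add: power_mult_distrib power_divide power2_eq_square[of "real M"] power3_eq_cube mult_ac)
  have lo: "0 \<le> pi / 4 * sqrt (real K) / real M * C_lo"
    using C_lo_nonneg by simp
  show "pi\<^sup>2 / 16 * C_lo\<^sup>2 * (real K / real M ^ 3) \<le> \<mu>\<^sup>2 / real M"
    unfolding e[symmetric] by (intro divide_right_mono power_mono mean_gain_bounds lo) simp
  have "0 \<le> \<mu>" using lo mean_gain_bounds(1) by linarith
  then show "\<mu>\<^sup>2 / real M \<le> pi\<^sup>2 / 16 * C_hi\<^sup>2 * (real K / real M ^ 3)"
    unfolding e[symmetric] by (intro divide_right_mono power_mono mean_gain_bounds) auto
qed

lemma variance_D: "expectation (\<lambda>\<omega>. (D \<omega> - expectation D)\<^sup>2) \<le> (B1 + 4 * C_hi ^ 4) / real M"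
proof -
  have iQ: "integrable \<Omega> (Q K)"
    using Q_moments(1)[of K] by (intro in_L2_imp_integrable) simp
  have ED: "expectation D = \<sigma>2 + expectation (Q K) / real K"
    unfolding D_def[abs_def] using iQ by (simp add: prob_space)
  have "expectation (\<lambda>\<omega>. (D \<omega> - expectation D)\<^sup>2) = expectation (\<lambda>\<omega>. (Q K \<omega> - expectation (Q K))\<^sup>2) / (real K)\<^sup>2"
    unfolding ED by (simp add: D_def diff_divide_distrib[symmetric] power_divide)
  also have "\<dots> \<le> (real K * B1 + 4 * C_hi ^ 4 / real M * (real K)\<^sup>2) / (real K)\<^sup>2"
    by (intro divide_right_mono Q_moments(3)) auto
  also have "\<dots> = B1 / real K + 4 * C_hi ^ 4 / real M"
    using MK by (simp add: add_divide_distrib power2_eq_square)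
  \<comment> \<open>As M divides the positive number K, M <= K; this puts the contribution of the
    independent diagonal terms on the scale 1/M of the cross terms.\<close>
  also have "B1 / real K \<le> B1 / real M"
  proof (rule divide_left_mono)
    show "real M \<le> real K" using MK by (simp add: dvd_imp_le)
    show "0 \<le> B1" unfolding B1_def using C_lo_nonneg \<sigma>2 by simp
  qed (use MK in simp)
  finally show ?thesis by (simp add: add_divide_distrib)
qed

section \<open>The two rate bounds for a fixed network\<close>

text \<open>The mean gain acts as signal, and the difference \<open>?V - ?s\<close> collects all
  other power: the mean noise and the variance of the gain divided by M. Together they are at most
  \<open>noise_hi\<close>.\<close>

lemma mutual_information_lower:
  "ln (1 + pi\<^sup>2 / 16 * (C_lo\<^sup>2 / noise_hi) * (real K / real M ^ 3))
    \<le> mutual_information 2 borel borel (out) (X (Signal m)) * ln 2"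
proof -
  let ?V = "fading.output_power" and ?s = "\<mu>\<^sup>2 / real M"
  note snr = fading.mutual_information_ge_snr[OF expectation_Re_A]
  have n: "0 < ?V - ?s" using snr(2) by simp
  have ratio: "x / (x - y) = 1 + y / (x - y)" if "0 < x - y" for x y :: real
    using that by (simp add: field_simps)
  have V: "?V = expectation (\<lambda>\<omega>. (cmod (A \<omega>))\<^sup>2) / real M + expectation D"
    by (simp add: fading.output_power_def)
  have "expectation (\<lambda>\<omega>. (cmod (A \<omega>))\<^sup>2) / real M \<le> (\<mu>\<^sup>2 + C_hi\<^sup>2) / real M"
    by (rule divide_right_mono[OF expectation_A_square]) simp
  then have hi: "?V - ?s \<le> noise_hi"
    using expectation_D_bounds(2) unfolding V by (simp add: add_divide_distrib)
  have "pi\<^sup>2 / 16 * (C_lo\<^sup>2 / noise_hi) * (real K / real M ^ 3) = (pi\<^sup>2 / 16 * C_lo\<^sup>2 * (real K / real M ^ 3)) / noise_hi"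
    by simp
  also have "\<dots> \<le> ?s / (?V - ?s)"
    using n hi mean_gain_square_bounds(1) by (intro frac_le) auto
  finally have "1 + pi\<^sup>2 / 16 * (C_lo\<^sup>2 / noise_hi) * (real K / real M ^ 3) \<le> ?V / (?V - ?s)"
    using ratio[OF n] by simp
  moreover have "0 < 1 + pi\<^sup>2 / 16 * (C_lo\<^sup>2 / noise_hi) * (real K / real M ^ 3)"
    using n hi by (intro add_pos_nonneg mult_nonneg_nonneg divide_nonneg_nonneg) auto
  ultimately have "ln (1 + pi\<^sup>2 / 16 * (C_lo\<^sup>2 / noise_hi) * (real K / real M ^ 3)) \<le> ln (?V / (?V - ?s))"
    by (intro ln_mono) auto
  also have "\<dots> \<le> mutual_information 2 borel borel (out) (X (Signal m)) * ln 2"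
    using snr(1) by simp
  finally show ?thesis .
qed

text \<open>Here the full second moment of the gain counts as signal, so its variance yields the 1 /
  M beside K / M^3. The divisor 1 - 1 / M comes from the mean noise and is positive for M at least
  2.\<close>

lemma mutual_information_upper:
  assumes M2: "2 \<le> M"
  shows "mutual_information 2 borel borel (out) (X (Signal m)) * ln 2
    \<le> ln (1 + C_hi\<^sup>2 / noise_lo * (pi\<^sup>2 / 16 * (real K / real M ^ 3) + 1 / real M) / (1 - 1 / real M))
      + (B1 + 4 * C_hi ^ 4) / \<sigma>2\<^sup>2 / real M"
proof -
  let ?V = "fading.output_power"
  define e where "e = expectation D"
  define s where "s = expectation (\<lambda>\<omega>. (cmod (A \<omega>))\<^sup>2) / real M"
  have iM: "0 < 1 - 1 / real M" using M2 by (simp add: field_simps)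
  have V: "?V = s + e"
    by (simp add: fading.output_power_def s_def e_def)
  have e0: "0 < e" unfolding e_def by (rule fading.mean_noise_pos)
  have s0: "0 \<le> s" unfolding s_def by (intro divide_nonneg_nonneg Bochner_Integration.integral_nonneg) auto
  have "mutual_information 2 borel borel (out) (X (Signal m)) * ln 2
      \<le> ln ?V - expectation (\<lambda>\<omega>. ln (D \<omega>))"
    by (rule fading.mutual_information_le)
  \<comment> \<open>The expected logarithm of the noise power is replaced by the logarithm of its
    mean, at the price of the variance over \<sigma>2 squared.\<close>
  also have "\<dots> \<le> ln ?V - ln e + expectation (\<lambda>\<omega>. (D \<omega> - e)\<^sup>2) / \<sigma>2\<^sup>2"
    using ln_expectation_gap[OF \<sigma>2 D_ge in_L2_D fading.integrable_ln_D] unfolding e_def by linarith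
  also have "expectation (\<lambda>\<omega>. (D \<omega> - e)\<^sup>2) / \<sigma>2\<^sup>2 \<le> (B1 + 4 * C_hi ^ 4) / real M / \<sigma>2\<^sup>2"
    unfolding e_def by (rule divide_right_mono[OF variance_D]) simp
  also have "ln ?V - ln e = ln (1 + s / e)"
  proof -
    have "ln ?V - ln e = ln ((s + e) / e)"
      unfolding V using s0 e0 by (subst ln_div) auto
    then show ?thesis using e0 by (simp add: add_divide_distrib add.commute)
  qed
  also have "ln (1 + s / e) \<le> ln (1 + C_hi\<^sup>2 / noise_lo * (pi\<^sup>2 / 16 * (real K / real M ^ 3) + 1 / real M) / (1 - 1 / real M))"
  proof (rule ln_mono)
    have "s \<le> (\<mu>\<^sup>2 + C_hi\<^sup>2) / real M"
      unfolding s_def by (rule divide_right_mono[OF expectation_A_square]) simp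
    also have "\<dots> \<le> C_hi\<^sup>2 * (pi\<^sup>2 / 16 * (real K / real M ^ 3) + 1 / real M)"
      using mean_gain_square_bounds(2) by (simp add: add_divide_distrib algebra_simps)
    finally have s_le: "s \<le> \<dots>" .
    have "s / e \<le> C_hi\<^sup>2 * (pi\<^sup>2 / 16 * (real K / real M ^ 3) + 1 / real M) / ((1 - 1 / real M) * noise_lo)"
      using s_le s0 iM noise_lo_pos expectation_D_bounds(1) unfolding e_def by (intro frac_le) auto
    then show "1 + s / e \<le> 1 + C_hi\<^sup>2 / noise_lo * (pi\<^sup>2 / 16 * (real K / real M ^ 3) + 1 / real M) / (1 - 1 / real M)"
      by (simp add: mult.commute)
    show "0 < 1 + s / e" using s0 e0 by (intro add_pos_nonneg) auto
  qed
  finally show ?thesis by (simp add: mult.commute)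
qed

end

section \<open>Passage to large M\<close>

theorem theorem3:
  fixes E_lo E_hi P_lo P_hi P_rel \<sigma>2 :: real
    and net :: "nat \<Rightarrow> nat \<Rightarrow> 'a network"
    and C_lo C_hi c_lo c_hi CSN_lo CSN_hi :: real
    and \<epsilon> \<delta> :: real
  assumes "0 < E_lo" "E_lo \<le> E_hi" "0 < P_lo" "P_lo \<le> P_hi" "0 < P_rel" "0 < \<sigma>2"
    and net: "\<And>M K. 0 < M \<Longrightarrow> 0 < K \<Longrightarrow> M dvd K \<Longrightarrow>
                p1_network M K E_lo E_hi P_lo P_hi \<sigma>2 (net M K)"
    and "C_lo = sqrt (P_lo * E_lo * P_rel / (E_hi + \<sigma>2))"
    and "C_hi = sqrt (P_hi * E_hi * P_rel / (E_lo + \<sigma>2))"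
    and "c_lo = sqrt (P_lo * P_rel / (E_hi + \<sigma>2))"
    and "c_hi = sqrt (P_hi * P_rel / (E_lo + \<sigma>2))"
    and "CSN_hi = sqrt (C_hi\<^sup>2 + \<sigma>2 * (c_hi\<^sup>2 + 1))"
    and "CSN_lo = sqrt (C_lo\<^sup>2 + \<sigma>2 * (c_lo\<^sup>2 + 1))"
    and "0 < \<epsilon>" "0 < \<delta>"
  shows "\<exists>M\<^sub>0>0. \<exists>K\<^sub>0>0. \<forall>M\<ge>M\<^sub>0. \<forall>K\<ge>K\<^sub>0. M dvd K \<longrightarrow> (\<forall>m\<in>{1..M}. \<forall>t.
      (let lo = 1 + pi\<^sup>2 / 16 * (C_lo\<^sup>2 / CSN_hi\<^sup>2) * (real K / real M ^ 3) * (1 - \<epsilon>);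
           hi = 1 + pi\<^sup>2 / 16 * (C_hi\<^sup>2 / CSN_lo\<^sup>2) *
                  (max (real K) (real M powr (2 + \<delta>)) / real M ^ 3) * (1 + \<epsilon>);
           C = capacity_P1 M K P_rel \<sigma>2 (net M K) t m
       in (0 < lo \<longrightarrow> 1 / 2 * log 2 lo \<le> C) \<and> C \<le> 1 / 2 * log 2 hi))"
proof -
  have C_lo: "C_lo\<^sup>2 / CSN_hi\<^sup>2 = C_lo\<^sup>2 / (C_hi\<^sup>2 + \<sigma>2 * (c_hi\<^sup>2 + 1))"
    and C_hi: "C_hi\<^sup>2 / CSN_lo\<^sup>2 = C_hi\<^sup>2 / (C_lo\<^sup>2 + \<sigma>2 * (c_lo\<^sup>2 + 1))"
    using assms by (simp_all add: add_nonneg_nonneg)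
  define a where "a = C_hi\<^sup>2 / CSN_lo\<^sup>2"
  \<comment> \<open>The constant of \<open>mutual_information_upper\<close> with \<open>B1\<close>
    written out, as \<beta> must be fixed before M and K are chosen.\<close>
  define \<beta> where "\<beta> = (8 * C_hi ^ 4 + 4 * \<sigma>2\<^sup>2 * c_hi ^ 4 + 4 * C_hi ^ 4) / \<sigma>2\<^sup>2"
  have "0 < C_hi\<^sup>2" using assms by simp
  moreover have "0 < C_lo\<^sup>2 + \<sigma>2 * (c_lo\<^sup>2 + 1)"
    using \<open>0 < \<sigma>2\<close> by (intro add_nonneg_pos mult_pos_pos) (auto simp: add_nonneg_pos)
  ultimately have a: "0 < a" unfolding a_def C_hi by simp
  have \<beta>: "0 \<le> \<beta>" unfolding \<beta>_def by (intro divide_nonneg_nonneg add_nonneg_nonneg) auto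
  obtain M\<^sub>1 where M1: "ln (1 + a * (pi\<^sup>2 / 16 * (K / real M ^ 3) + 1 / real M) / (1 - 1 / real M)) + \<beta> / real M
    \<le> ln (1 + pi\<^sup>2 / 16 * a * (max K (real M powr (2 + \<delta>)) / real M ^ 3) * (1 + \<epsilon>))"
    if "M\<^sub>1 \<le> M" "0 \<le> K" for M K
    using rate_bound_absorb[OF a \<beta> \<open>0 < \<epsilon>\<close> \<open>0 < \<delta>\<close>] unfolding eventually_sequentially by blast
  show ?thesis
  \<comment> \<open>All estimates are uniform in K, because divisibility already forces M <= K;
    hence K0 = 1. The 2 keeps 1 - 1 / M positive.\<close>
  proof (rule exI[of _ "max 2 M\<^sub>1"], intro conjI, simp, rule exI[of _ 1], intro conjI allI impI ballI)
    fix M K m t :: nat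
    assume M: "max 2 M\<^sub>1 \<le> M" and K: "1 \<le> K" and dvd: "M dvd K" and m: "m \<in> {1..M}"
    interpret ch: p1_channel M K E_lo E_hi P_lo P_hi P_rel \<sigma>2 "net M K" t m
      using assms(1-6) net[of M K] M K dvd m by unfold_locales auto
    have eqs: "ch.C_lo = C_lo" "ch.C_hi = C_hi" "ch.c_lo = c_lo" "ch.c_hi = c_hi"
      by (simp_all only: ch.C_lo_def ch.C_hi_def ch.c_lo_def ch.c_hi_def assms)
    let ?I = "prob_space.mutual_information (prob_sp (net M K)) 2 borel borel
      (received M K P_rel \<sigma>2 (net M K) t m) (rv (net M K) t (Signal m))"
    define lo where "lo = 1 + pi\<^sup>2 / 16 * (C_lo\<^sup>2 / CSN_hi\<^sup>2) * (real K / real M ^ 3) * (1 - \<epsilon>)"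
    define hi where "hi = 1 + pi\<^sup>2 / 16 * (C_hi\<^sup>2 / CSN_lo\<^sup>2) *
                  (max (real K) (real M powr (2 + \<delta>)) / real M ^ 3) * (1 + \<epsilon>)"
    have cap: "capacity_P1 M K P_rel \<sigma>2 (net M K) t m = 1 / 2 * (?I * ln 2 / ln 2)"
      by (simp add: capacity_P1_def)
    have log: "1 / 2 * log 2 x = 1 / 2 * (ln x / ln 2)" for x by (simp add: log_def)
    \<comment> \<open>For \<epsilon> > 1 the argument may fail to be positive, and then the lower
      bound has no meaning as a logarithm.\<close>
    have "1 / 2 * log 2 lo \<le> capacity_P1 M K P_rel \<sigma>2 (net M K) t m" if "0 < lo"
    proof -
      have "lo \<le> 1 + pi\<^sup>2 / 16 * (C_lo\<^sup>2 / CSN_hi\<^sup>2) * (real K / real M ^ 3)"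
        unfolding lo_def using \<open>0 < \<epsilon>\<close> by (intro add_left_mono mult_left_le) auto
      then have "ln lo \<le> ln (1 + pi\<^sup>2 / 16 * (C_lo\<^sup>2 / CSN_hi\<^sup>2) * (real K / real M ^ 3))"
        using that by (intro ln_mono) auto
      also have "\<dots> \<le> ?I * ln 2"
        using ch.mutual_information_lower unfolding ch.noise_hi_def eqs C_lo .
      finally show ?thesis
        unfolding cap log by (intro mult_left_mono divide_right_mono) auto
    qed
    moreover have "capacity_P1 M K P_rel \<sigma>2 (net M K) t m \<le> 1 / 2 * log 2 hi"
    proof -
      have "?I * ln 2 \<le> ln (1 + a * (pi\<^sup>2 / 16 * (real K / real M ^ 3) + 1 / real M) / (1 - 1 / real M)) + \<beta> / real M"
        using ch.mutual_information_upper[unfolded ch.B1_def] M unfolding ch.noise_lo_def eqs a_def C_hi \<beta>_def by simp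
      also have "\<dots> \<le> ln hi"
        using M1[of M "real K"] M unfolding hi_def a_def by simp
      finally show ?thesis
        unfolding cap log by (intro mult_left_mono divide_right_mono) auto
    qed
    ultimately show "let lo = 1 + pi\<^sup>2 / 16 * (C_lo\<^sup>2 / CSN_hi\<^sup>2) * (real K / real M ^ 3) * (1 - \<epsilon>);
           hi = 1 + pi\<^sup>2 / 16 * (C_hi\<^sup>2 / CSN_lo\<^sup>2) *
                  (max (real K) (real M powr (2 + \<delta>)) / real M ^ 3) * (1 + \<epsilon>);
           C = capacity_P1 M K P_rel \<sigma>2 (net M K) t m
       in (0 < lo \<longrightarrow> 1 / 2 * log 2 lo \<le> C) \<and> C \<le> 1 / 2 * log 2 hi"
      unfolding Let_def lo_def hi_def by blast
  qed simp
qed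

end
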